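(* Let $p$ be a prime, let $\mathcal{F}$ be a saturated fusion system on a finite $p$-group $S$, and let $U\le S$ be a subgroup. Then the following are equivalent. (1) $\mathcal{F}=N_{\mathcal{F}}(U)$. (2) For every $P\le S$ and every homomorphism $\varphi\colon P\to S$, $\chi_{[P,\varphi]}(\omega_{\mathcal{F}}) = 0$ unless $P\geq U$ and $\varphi$ belongs to $N_{\mathcal{F}}(U)$.
   Context: Fusion systems and saturation are in the standard sense of Broto--Levi--Oliver. For a subgroup $U\le S$, $N_{\mathcal{F}}(U)$ is the normalizer fusion system: the fusion system on $N_S(U)$ whose morphisms $P\to Q$ (for $P,Q\le N_S(U)$) are those $\varphi\in\mathrm{Hom}_{\mathcal{F}}(P,Q)$ that extend to some $\bar\varphi\in\mathrm{Hom}_{\mathcal{F}}(PU,QU)$ with $\bar\varphi(U)=U$. The equality $\mathcal{F}=N_{\mathcal{F}}(U)$ includes $N_S(U)=S$. Burnside modules. For finite groups $G,H$, a $(G,H)$-biset is a set with commuting left $H$-action and right $G$-action. $A(G,H)$ is the Grothendieck group (under disjoint union) of isomorphism classes of finite $(G,H)$-bisets whose left $H$-action is free; $A(G,H)_{(p)}$ is its $p$-localization. For $K\le G$ and a homomorphism $\varphi\colon K\to H$, $[K,\varphi]_G^H$ (or $[K,\varphi]$) is the class of $H\times_{K,\varphi}G=(H\times G)/\sim$, where $(h,kg)\sim(h\varphi(k),g)$ for $k\in K$. These classes, over conjugacy classes of pairs $(K,\varphi)$ (conjugacy in both $G$ and $H$), form a $\mathbb{Z}_{(p)}$-basis of $A(G,H)_{(p)}$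 (the standard basis), and $\chi_{[K,\varphi]}(X)\in\mathbb{Z}_{(p)}$ denotes the coefficient of $[K,\varphi]$ in $X\in A(G,H)_{(p)}$. The bilinear composition $A(H,K)\times A(G,H)\to A(G,K)$ is given on bisets by $X\circ Y=X\times_H Y$. The map $\mathrm{incl}$ denotes the relevant inclusion of subgroups. Characteristic idempotents. Let $\mathcal{F}$ be a fusion system on $S$. An element $X\in A(S,S)_{(p)}$ is $\mathcal{F}$-generated if it is a linear combination of basis elements $[P,\varphi]$ with $\varphi$ in $\mathcal{F}$. For a finite group $H$, $X\in A(S,H)_{(p)}$ is right $\mathcal{F}$-stable if $X\circ[P,\varphi]_P^S=X\circ[P,\mathrm{incl}]_P^S$ for all $P\le S$, $\varphi\in\mathrm{Hom}_{\mathcal{F}}(P,S)$; $X\in A(H,S)_{(p)}$ is left $\mathcal{F}$-stable if $[\varphi(P),\varphi^{-1}]_S^P\circ X=[P,\mathrm{id}]_S^P\circ X$ for all such $P,\varphi$. The augmentation $\epsilon\colon A(S,S)_{(p)}\to\mathbb{Z}_{(p)}$ is the linear map with $\epsilon([P,\varphi]_S^S)=|S/P|$. For $\mathcal{F}$ saturated, a characteristic idempotent for $\mathcal{F}$ is an idempotent of the ring $A(S,S)_{(p)}$ that is $\mathcal{F}$-generated, left and right $\mathcal{F}$-stable, and of augmentation prime to $p$. It is known that every saturated fusion system $\mathcal{F}$ has exactly one characteristic idempotent; it is denoted $\omega_{\mathcal{F}}$. *)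

theory Defs
  imports Complex_Main "HOL-Algebra.Sylow" "HOL-Algebra.Group_Action" "HOL-Library.Poly_Mapping"
begin

section \<open>Fusion systems\<close>

abbreviation sub_group :: "('a, 'm) monoid_scheme \<Rightarrow> 'a set \<Rightarrow> ('a, 'm) monoid_scheme"
  where "sub_group S P \<equiv> S\<lparr>carrier := P\<rparr>"

definition p_group :: "nat \<Rightarrow> ('a, 'm) monoid_scheme \<Rightarrow> bool"
  where "p_group p S \<longleftrightarrow> group S \<and> finite (carrier S) \<and> (\<exists>n. order S = p ^ n)"

definition sylow_subgroup :: "nat \<Rightarrow> ('a, 'm) monoid_scheme \<Rightarrow> 'a set \<Rightarrow> bool"
  where "sylow_subgroup p G H \<longleftrightarrow> subgroup H G \<and> card H = p ^ multiplicity p (order G)"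

definition centralizer :: "('a, 'm) monoid_scheme \<Rightarrow> 'a set \<Rightarrow> 'a set"
  where "centralizer S P = {g \<in> carrier S. \<forall>x\<in>P. g \<otimes>\<^bsub>S\<^esub> x = x \<otimes>\<^bsub>S\<^esub> g}"

text \<open>Maps between subgroups \<open>P\<close>, \<open>Q\<close> are represented as functions that are extensional on \<open>P\<close>,
  so that equality of maps is equality of functions.\<close>

definition Homs :: "('a, 'm) monoid_scheme \<Rightarrow> 'a set \<Rightarrow> 'a set \<Rightarrow> ('a \<Rightarrow> 'a) set"
  where "Homs S P Q = hom (sub_group S P) (sub_group S Q) \<inter> extensional P"

definition Inj :: "('a, 'm) monoid_scheme \<Rightarrow> 'a set \<Rightarrow> 'a set \<Rightarrow> ('a \<Rightarrow> 'a) set"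
  where "Inj S P Q = mon (sub_group S P) (sub_group S Q) \<inter> extensional P"

definition conj_map :: "('a, 'm) monoid_scheme \<Rightarrow> 'a set \<Rightarrow> 'a \<Rightarrow> 'a \<Rightarrow> 'a"
  where "conj_map S P g = (\<lambda>x\<in>P. g \<otimes>\<^bsub>S\<^esub> x \<otimes>\<^bsub>S\<^esub> inv\<^bsub>S\<^esub> g)"

definition Hom_conj :: "('a, 'm) monoid_scheme \<Rightarrow> 'a set \<Rightarrow> 'a set \<Rightarrow> ('a \<Rightarrow> 'a) set"
  where "Hom_conj S P Q = {conj_map S P g | g. g \<in> carrier S \<and> conj_map S P g ` P \<subseteq> Q}"

definition inv_map :: "'a set \<Rightarrow> ('a \<Rightarrow> 'b) \<Rightarrow> 'b \<Rightarrow> 'a"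
  where "inv_map P \<phi> = (\<lambda>y\<in>\<phi> ` P. inv_into P \<phi> y)"

text \<open>A fusion system is given by its morphism sets \<open>F P Q\<close>; by convention these are empty
  unless \<open>P\<close> and \<open>Q\<close> are objects.\<close>

type_synonym 'a homsets = "'a set \<Rightarrow> 'a set \<Rightarrow> ('a \<Rightarrow> 'a) set"

definition fusion_system :: "('a, 'm) monoid_scheme \<Rightarrow> 'a homsets \<Rightarrow> bool"
  where "fusion_system S F \<longleftrightarrow>
    (\<forall>P Q. \<not> (subgroup P S \<and> subgroup Q S) \<longrightarrow> F P Q = {}) \<and>
    (\<forall>P Q. subgroup P S \<and> subgroup Q S \<longrightarrow> Hom_conj S P Q \<subseteq> F P Q \<and> F P Q \<subseteq> Inj S P Q) \<and>
    (\<forall>P Q R \<phi> \<psi>. \<phi> \<in> F P Q \<and> \<psi> \<in> F Q R \<longrightarrow> compose P \<psi> \<phi> \<in> F P R) \<and>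
    (\<forall>P Q \<phi>. \<phi> \<in> F P Q \<longrightarrow> \<phi> \<in> F P (\<phi> ` P) \<and> inv_map P \<phi> \<in> F (\<phi> ` P) P)"

definition fconj :: "'a homsets \<Rightarrow> 'a set \<Rightarrow> 'a set \<Rightarrow> bool"
  where "fconj F P Q \<longleftrightarrow> (\<exists>\<phi>\<in>F P Q. \<phi> ` P = Q)"

definition fully_centralized :: "('a, 'm) monoid_scheme \<Rightarrow> 'a homsets \<Rightarrow> 'a set \<Rightarrow> bool"
  where "fully_centralized S F P \<longleftrightarrow>
    (\<forall>Q. fconj F P Q \<longrightarrow> card (centralizer S Q) \<le> card (centralizer S P))"

definition fully_normalized :: "('a, 'm) monoid_scheme \<Rightarrow> 'a homsets \<Rightarrow> 'a set \<Rightarrow> bool"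
  where "fully_normalized S F P \<longleftrightarrow>
    (\<forall>Q. fconj F P Q \<longrightarrow> card (normalizer S Q) \<le> card (normalizer S P))"

definition Aut_grp :: "'a homsets \<Rightarrow> 'a set \<Rightarrow> ('a \<Rightarrow> 'a) monoid"
  where "Aut_grp F P = (BijGroup P)\<lparr>carrier := F P P\<rparr>"

text \<open>\<open>N\<^sub>\<phi>\<close>: the \<open>g\<close> in \<open>N\<^sub>S(P)\<close> for which \<open>\<phi> \<circ> c\<^sub>g \<circ> \<phi>\<inverse>\<close> lies in \<open>Aut\<^sub>S(\<phi>(P))\<close>.\<close>

definition N_phi :: "('a, 'm) monoid_scheme \<Rightarrow> 'a set \<Rightarrow> ('a \<Rightarrow> 'a) \<Rightarrow> 'a set"
  where "N_phi S P \<phi> = {g \<in> normalizer S P.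
    compose (\<phi> ` P) \<phi> (compose (\<phi> ` P) (conj_map S P g) (inv_map P \<phi>))
      \<in> Hom_conj S (\<phi> ` P) (\<phi> ` P)}"

definition saturated :: "nat \<Rightarrow> ('a, 'm) monoid_scheme \<Rightarrow> 'a homsets \<Rightarrow> bool"
  where "saturated p S F \<longleftrightarrow>
    (\<forall>P. subgroup P S \<and> fully_normalized S F P \<longrightarrow>
      fully_centralized S F P \<and> sylow_subgroup p (Aut_grp F P) (Hom_conj S P P)) \<and>
    (\<forall>P \<phi>. subgroup P S \<and> \<phi> \<in> F P (carrier S) \<and> fully_centralized S F (\<phi> ` P) \<longrightarrow>
      (\<exists>\<psi>\<in>F (N_phi S P \<phi>) (carrier S). restrict \<psi> P = \<phi>))"

definition normalizer_system ::
    "('a, 'm) monoid_scheme \<Rightarrow> 'a homsets \<Rightarrow> 'a set \<Rightarrow> 'a homsets"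
  where "normalizer_system S F U P Q =
    (if subgroup P (sub_group S (normalizer S U)) \<and> subgroup Q (sub_group S (normalizer S U))
     then {\<phi> \<in> F P Q. \<exists>\<psi>\<in>F (P <#>\<^bsub>S\<^esub> U) (Q <#>\<^bsub>S\<^esub> U). restrict \<psi> P = \<phi> \<and> \<psi> ` U = U}
     else {})"

section \<open>Bisets\<close>

text \<open>In \<open>('g, 'h, 'x) biset\<close> the group acting on the right lives in \<open>'g\<close> and the group acting
  on the left in \<open>'h\<close>, as in the convention for \<open>(G, H)\<close>-bisets.\<close>

record ('g, 'h, 'x) biset =
  points :: "'x set"
  lact :: "'h \<Rightarrow> 'x \<Rightarrow> 'x"
  ract :: "'x \<Rightarrow> 'g \<Rightarrow> 'x"

definition is_biset ::
    "('g, 'm) monoid_scheme \<Rightarrow> ('h, 'n) monoid_scheme \<Rightarrow> ('g, 'h, 'x) biset \<Rightarrow> bool"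
  where "is_biset G H X \<longleftrightarrow>
    (\<forall>x\<in>points X.
      (\<forall>h\<in>carrier H. lact X h x \<in> points X) \<and>
      lact X \<one>\<^bsub>H\<^esub> x = x \<and>
      (\<forall>h\<in>carrier H. \<forall>h'\<in>carrier H. lact X (h \<otimes>\<^bsub>H\<^esub> h') x = lact X h (lact X h' x)) \<and>
      (\<forall>g\<in>carrier G. ract X x g \<in> points X) \<and>
      ract X x \<one>\<^bsub>G\<^esub> = x \<and>
      (\<forall>g\<in>carrier G. \<forall>g'\<in>carrier G. ract X x (g \<otimes>\<^bsub>G\<^esub> g') = ract X (ract X x g) g') \<and>
      (\<forall>h\<in>carrier H. \<forall>g\<in>carrier G. ract X (lact X h x) g = lact X h (ract X x g)))"

definition fin_free_biset ::
    "('g, 'm) monoid_scheme \<Rightarrow> ('h, 'n) monoid_scheme \<Rightarrow> ('g, 'h, 'x) biset \<Rightarrow> bool"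
  where "fin_free_biset G H X \<longleftrightarrow> is_biset G H X \<and> finite (points X) \<and>
    (\<forall>x\<in>points X. \<forall>h\<in>carrier H. lact X h x = x \<longrightarrow> h = \<one>\<^bsub>H\<^esub>)"

definition biset_isomorphic :: "('g, 'm) monoid_scheme \<Rightarrow> ('h, 'n) monoid_scheme \<Rightarrow>
    ('g, 'h, 'x) biset \<Rightarrow> ('g, 'h, 'y) biset \<Rightarrow> bool"
  where "biset_isomorphic G H X Y \<longleftrightarrow> (\<exists>f. bij_betw f (points X) (points Y) \<and>
    (\<forall>x\<in>points X. (\<forall>h\<in>carrier H. f (lact X h x) = lact Y h (f x)) \<and>
                  (\<forall>g\<in>carrier G. f (ract X x g) = ract Y (f x) g)))"

definition biset_sum :: "('g, 'h, 'x) biset \<Rightarrow> ('g, 'h, 'y) biset \<Rightarrow> ('g, 'h, 'x + 'y) biset"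
  where "biset_sum X Y = \<lparr>points = points X <+> points Y,
    lact = (\<lambda>h. map_sum (lact X h) (lact Y h)),
    ract = (\<lambda>z g. map_sum (\<lambda>x. ract X x g) (\<lambda>y. ract Y y g) z)\<rparr>"

text \<open>\<open>X \<times>\<^sub>H Y\<close>, the quotient of \<open>X \<times> Y\<close> by \<open>(x h, y) \<sim> (x, h y)\<close>. Since \<open>H\<close> is a group, these
  generating pairs already form an equivalence relation.\<close>

definition biset_prod :: "('h, 'm) monoid_scheme \<Rightarrow> ('h, 'k, 'x) biset \<Rightarrow> ('g, 'h, 'y) biset \<Rightarrow>
    ('g, 'k, ('x \<times> 'y) set) biset"
  where "biset_prod H X Y = \<lparr>
    points = (points X \<times> points Y) //
      {((ract X x h, y), (x, lact Y h y)) | x h y. x \<in> points X \<and> h \<in> carrier H \<and> y \<in> points Y},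
    lact = (\<lambda>k. image (\<lambda>(x, y). (lact X k x, y))),
    ract = (\<lambda>C g. (\<lambda>(x, y). (x, ract Y y g)) ` C)\<rparr>"

text \<open>\<open>H \<times>\<^bsub>K,\<phi>\<^esub> G\<close>, the quotient of \<open>H \<times> G\<close> by \<open>(h, k g) \<sim> (h \<phi>(k), g)\<close>; again the generating
  pairs already form an equivalence relation.\<close>

definition std_biset :: "('g, 'm) monoid_scheme \<Rightarrow> ('h, 'n) monoid_scheme \<Rightarrow>
    'g set \<Rightarrow> ('g \<Rightarrow> 'h) \<Rightarrow> ('g, 'h, ('h \<times> 'g) set) biset"
  where "std_biset G H K \<phi> = \<lparr>
    points = (carrier H \<times> carrier G) //
      {((h, k \<otimes>\<^bsub>G\<^esub> g), (h \<otimes>\<^bsub>H\<^esub> \<phi> k, g)) | h k g. h \<in> carrier H \<and> k \<in> K \<and> g \<in> carrier G},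
    lact = (\<lambda>h'. image (\<lambda>(h, g). (h' \<otimes>\<^bsub>H\<^esub> h, g))),
    ract = (\<lambda>C g'. (\<lambda>(h, g). (h, g \<otimes>\<^bsub>G\<^esub> g')) ` C)\<rparr>"

section \<open>Burnside modules\<close>

text \<open>Every finite biset is isomorphic to one whose points are natural numbers, so isomorphism
  classes are represented as sets of bisets on \<open>nat\<close>; the biset \<open>X\<close> itself may live on any type.\<close>

type_synonym ('g, 'h) biset_class = "('g, 'h, nat) biset set"

definition iso_class :: "('g, 'm) monoid_scheme \<Rightarrow> ('h, 'n) monoid_scheme \<Rightarrow>
    ('g, 'h, 'x) biset \<Rightarrow> ('g, 'h) biset_class"
  where "iso_class G H X = {Y. fin_free_biset G H Y \<and> biset_isomorphic G H X Y}"

definition iso_classes ::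
    "('g, 'm) monoid_scheme \<Rightarrow> ('h, 'n) monoid_scheme \<Rightarrow> ('g, 'h) biset_class set"
  where "iso_classes G H = {iso_class G H X | X :: ('g, 'h, nat) biset. fin_free_biset G H X}"

definition Z_loc :: "nat \<Rightarrow> rat set"
  where "Z_loc p = {of_int a / of_int b | a b. \<not> int p dvd b}"

text \<open>The \<open>p\<close>-localized Grothendieck group is presented as the free \<open>\<int>\<^sub>(\<^sub>p\<^sub>)\<close>-module on isomorphism
  classes modulo the \<open>\<int>\<^sub>(\<^sub>p\<^sub>)\<close>-submodule generated by all \<open>[X \<squnion> Y] - [X] - [Y]\<close>.\<close>

definition formal_combs :: "nat \<Rightarrow> ('g, 'm) monoid_scheme \<Rightarrow> ('h, 'n) monoid_scheme \<Rightarrow>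
    (('g, 'h) biset_class \<Rightarrow>\<^sub>0 rat) set"
  where "formal_combs p G H =
    {x. Poly_Mapping.keys x \<subseteq> iso_classes G H \<and> (\<forall>c. Poly_Mapping.lookup x c \<in> Z_loc p)}"

inductive_set sum_relations :: "nat \<Rightarrow> ('g, 'm) monoid_scheme \<Rightarrow> ('h, 'n) monoid_scheme \<Rightarrow>
    (('g, 'h) biset_class \<Rightarrow>\<^sub>0 rat) set"
  for p :: nat and G :: "('g, 'm) monoid_scheme" and H :: "('h, 'n) monoid_scheme"
  where
    zero: "0 \<in> sum_relations p G H"
  | add: "\<lbrakk>z \<in> sum_relations p G H; r \<in> Z_loc p;
        fin_free_biset G H (X :: ('g, 'h, nat) biset);
        fin_free_biset G H (Y :: ('g, 'h, nat) biset)\<rbrakk> \<Longrightarrow>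
      z + (Poly_Mapping.single (iso_class G H (biset_sum X Y)) r
           - Poly_Mapping.single (iso_class G H X) r
           - Poly_Mapping.single (iso_class G H Y) r) \<in> sum_relations p G H"

definition burnside_rel :: "nat \<Rightarrow> ('g, 'm) monoid_scheme \<Rightarrow> ('h, 'n) monoid_scheme \<Rightarrow>
    (('g, 'h) biset_class \<Rightarrow>\<^sub>0 rat) rel"
  where "burnside_rel p G H =
    {(x, y). x \<in> formal_combs p G H \<and> y \<in> formal_combs p G H \<and> x - y \<in> sum_relations p G H}"

type_synonym ('g, 'h) burnside_elt = "(('g, 'h) biset_class \<Rightarrow>\<^sub>0 rat) set"

definition burnside :: "nat \<Rightarrow> ('g, 'm) monoid_scheme \<Rightarrow> ('h, 'n) monoid_scheme \<Rightarrow>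
    ('g, 'h) burnside_elt set"
  where "burnside p G H = formal_combs p G H // burnside_rel p G H"

definition b_class :: "nat \<Rightarrow> ('g, 'm) monoid_scheme \<Rightarrow> ('h, 'n) monoid_scheme \<Rightarrow>
    (('g, 'h) biset_class \<Rightarrow>\<^sub>0 rat) \<Rightarrow> ('g, 'h) burnside_elt"
  where "b_class p G H x = burnside_rel p G H `` {x}"

definition b_add :: "nat \<Rightarrow> ('g, 'm) monoid_scheme \<Rightarrow> ('h, 'n) monoid_scheme \<Rightarrow>
    ('g, 'h) burnside_elt \<Rightarrow> ('g, 'h) burnside_elt \<Rightarrow> ('g, 'h) burnside_elt"
  where "b_add p G H X Y = (\<Union>x\<in>X. \<Union>y\<in>Y. b_class p G H (x + y))"

definition b_smult :: "nat \<Rightarrow> ('g, 'm) monoid_scheme \<Rightarrow> ('h, 'n) monoid_scheme \<Rightarrow>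
    rat \<Rightarrow> ('g, 'h) burnside_elt \<Rightarrow> ('g, 'h) burnside_elt"
  where "b_smult p G H r X = (\<Union>x\<in>X. b_class p G H (Poly_Mapping.map ((*) r) x))"

definition class_prod :: "('g, 'm) monoid_scheme \<Rightarrow> ('h, 'n) monoid_scheme \<Rightarrow>
    ('k, 'l) monoid_scheme \<Rightarrow> ('h, 'k) biset_class \<Rightarrow> ('g, 'h) biset_class \<Rightarrow> ('g, 'k) biset_class"
  where "class_prod G H K c d = (\<Union>X\<in>c. \<Union>Y\<in>d. iso_class G K (biset_prod H X Y))"

text \<open>Composition \<open>A(H,K) \<times> A(G,H) \<rightarrow> A(G,K)\<close>, the bilinear extension of \<open>X \<times>\<^sub>H Y\<close>.\<close>

definition b_comp :: "nat \<Rightarrow> ('g, 'm) monoid_scheme \<Rightarrow> ('h, 'n) monoid_scheme \<Rightarrow>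
    ('k, 'l) monoid_scheme \<Rightarrow>
    ('h, 'k) burnside_elt \<Rightarrow> ('g, 'h) burnside_elt \<Rightarrow> ('g, 'k) burnside_elt"
  where "b_comp p G H K X Y = (\<Union>x\<in>X. \<Union>y\<in>Y. b_class p G K
    (\<Sum>c\<in>Poly_Mapping.keys x. \<Sum>d\<in>Poly_Mapping.keys y.
      Poly_Mapping.single (class_prod G H K c d)
        (Poly_Mapping.lookup x c * Poly_Mapping.lookup y d)))"

definition bracket :: "nat \<Rightarrow> ('g, 'm) monoid_scheme \<Rightarrow> ('h, 'n) monoid_scheme \<Rightarrow>
    'g set \<Rightarrow> ('g \<Rightarrow> 'h) \<Rightarrow> ('g, 'h) burnside_elt"
  where "bracket p G H K \<phi> =
    b_class p G H (Poly_Mapping.single (iso_class G H (std_biset G H K \<phi>)) 1)"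

definition std_classes ::
    "('g, 'm) monoid_scheme \<Rightarrow> ('h, 'n) monoid_scheme \<Rightarrow> ('g, 'h) biset_class set"
  where "std_classes G H =
    {iso_class G H (std_biset G H K \<phi>) | K \<phi>. subgroup K G \<and> \<phi> \<in> hom (sub_group G K) H}"

text \<open>\<open>\<chi>\<^bsub>[K,\<phi>]\<^esub>(X)\<close>: the standard basis expansion of \<open>X\<close> is the unique formal combination in the
  class \<open>X\<close> that is supported on the classes of the \<open>H \<times>\<^bsub>K,\<phi>\<^esub> G\<close>.\<close>

definition chi :: "('g, 'm) monoid_scheme \<Rightarrow> ('h, 'n) monoid_scheme \<Rightarrow>
    'g set \<Rightarrow> ('g \<Rightarrow> 'h) \<Rightarrow> ('g, 'h) burnside_elt \<Rightarrow> rat"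
  where "chi G H K \<phi> X =
    Poly_Mapping.lookup (THE x. x \<in> X \<and> Poly_Mapping.keys x \<subseteq> std_classes G H)
      (iso_class G H (std_biset G H K \<phi>))"

section \<open>Characteristic idempotents\<close>

definition generated :: "('a, 'm) monoid_scheme \<Rightarrow> 'a homsets \<Rightarrow> ('a, 'a) burnside_elt \<Rightarrow> bool"
  where "generated S F X \<longleftrightarrow> (\<exists>x\<in>X. Poly_Mapping.keys x \<subseteq>
    {iso_class S S (std_biset S S P \<phi>) | P \<phi>. subgroup P S \<and> \<phi> \<in> F P (carrier S)})"

definition right_stable :: "nat \<Rightarrow> ('a, 'm) monoid_scheme \<Rightarrow> 'a homsets \<Rightarrow>
    ('h, 'n) monoid_scheme \<Rightarrow> ('a, 'h) burnside_elt \<Rightarrow> bool"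
  where "right_stable p S F H X \<longleftrightarrow>
    (\<forall>P \<phi>. subgroup P S \<and> \<phi> \<in> F P (carrier S) \<longrightarrow>
      b_comp p (sub_group S P) S H X (bracket p (sub_group S P) S P \<phi>) =
      b_comp p (sub_group S P) S H X (bracket p (sub_group S P) S P (\<lambda>x\<in>P. x)))"

definition left_stable :: "nat \<Rightarrow> ('a, 'm) monoid_scheme \<Rightarrow> 'a homsets \<Rightarrow>
    ('h, 'n) monoid_scheme \<Rightarrow> ('h, 'a) burnside_elt \<Rightarrow> bool"
  where "left_stable p S F H X \<longleftrightarrow>
    (\<forall>P \<phi>. subgroup P S \<and> \<phi> \<in> F P (carrier S) \<longrightarrow>
      b_comp p H S (sub_group S P) (bracket p S (sub_group S P) (\<phi> ` P) (inv_map P \<phi>)) X =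
      b_comp p H S (sub_group S P) (bracket p S (sub_group S P) P (\<lambda>x\<in>P. x)) X)"

definition augmentation :: "nat \<Rightarrow> ('a, 'm) monoid_scheme \<Rightarrow> ('a, 'a) burnside_elt \<Rightarrow> rat"
  where "augmentation p S = (THE e. e \<in> burnside p S S \<rightarrow>\<^sub>E Z_loc p \<and>
    (\<forall>X\<in>burnside p S S. \<forall>Y\<in>burnside p S S. e (b_add p S S X Y) = e X + e Y) \<and>
    (\<forall>r\<in>Z_loc p. \<forall>X\<in>burnside p S S. e (b_smult p S S r X) = r * e X) \<and>
    (\<forall>P \<phi>. subgroup P S \<and> \<phi> \<in> hom (sub_group S P) S \<longrightarrow>
      e (bracket p S S P \<phi>) = of_nat (card (rcosets\<^bsub>S\<^esub> P))))"

definition characteristic_idempotent ::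
    "nat \<Rightarrow> ('a, 'm) monoid_scheme \<Rightarrow> 'a homsets \<Rightarrow> ('a, 'a) burnside_elt \<Rightarrow> bool"
  where "characteristic_idempotent p S F \<omega> \<longleftrightarrow>
    \<omega> \<in> burnside p S S \<and>
    b_comp p S S S \<omega> \<omega> = \<omega> \<and>
    generated S F \<omega> \<and>
    left_stable p S F S \<omega> \<and>
    right_stable p S F S \<omega> \<and>
    augmentation p S \<omega> \<notin> (*) (of_nat p) ` Z_loc p"

end

theory Submission
  imports Defs "HOL-Algebra.Zassenhaus"
begin

text \<open>
  The marks \<open>\<Phi>\<^bsub>P,\<phi>\<^esub>(X)\<close>, counting the points \<open>x\<close> with \<open>x q = \<phi>(q) x\<close> for all \<open>q \<in> P\<close>, are linear
  in \<open>X\<close> and triangular on the standard basis, and marks of a composite are sums of products of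
  marks: \<open>|H| \<Phi>\<^bsub>\<alpha>,\<beta>\<^esub>(X \<circ> Y) = \<Sum>\<^sub>\<eta> \<Phi>\<^bsub>\<eta>,\<beta>\<^esub>(X) \<Phi>\<^bsub>\<alpha>,\<eta>\<^esub>(Y)\<close>, where \<open>\<eta>\<close> runs over the maps into \<open>H\<close>.
  Stability makes \<open>\<Phi>\<^bsub>P,\<phi>\<^esub>(\<omega>)\<close> independent of \<open>\<phi> \<in> F(P,S)\<close>, and \<open>F\<close>-generation makes it vanish for
  \<open>\<phi> \<notin> F(P,S)\<close>. Let \<open>T\<^sub>P\<close> be the sum of all these marks. Idempotence gives \<open>|S| \<Phi>\<^bsub>P,\<phi>\<^esub>(\<omega>) =
  \<Phi>\<^bsub>P,\<phi>\<^esub>(\<omega>) T\<^sub>P\<close>, and \<open>T\<^sub>P / |S|\<close> is congruent to the augmentation modulo \<open>p\<close>, hence nonzero.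
  Therefore \<open>\<Phi>\<^bsub>P,\<phi>\<^esub>(\<omega>) = |S| / |F(P,S)|\<close> for \<open>\<phi> \<in> F(P,S)\<close>.

  These marks being nonzero, every morphism of \<open>F\<close> is, up to conjugation in \<open>S\<close>, a restriction of
  some \<open>\<psi>\<close> with \<open>[Q,\<psi>]\<close> occurring in \<open>\<omega>\<close>, which gives one implication. Conversely, if \<open>F =
  N\<^sub>F(U)\<close>, then on the part of \<open>\<omega>\<close> supported on \<open>Q \<ge> U\<close> the mark at \<open>(P,\<phi>)\<close> is the sum of the
  marks at the extensions of \<open>\<phi>\<close> to \<open>PU\<close>. Every \<open>\<phi>\<close> has \<open>|F(PU,S)| / |F(P,S)|\<close> extensions, so this
  part already has all the marks of \<open>\<omega>\<close>, and by triangularity nothing else occurs.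
\<close>

section \<open>Counting and conjugation\<close>

lemma sum_card_unique_cover:
  assumes "finite A" "finite E" "\<And>i. i \<in> E \<Longrightarrow> B i \<subseteq> A" "\<And>x. x \<in> A \<Longrightarrow> \<exists>!i. i \<in> E \<and> x \<in> B i"
  shows "(\<Sum>i\<in>E. card (B i)) = card A"
proof -
  have "card (\<Union>i\<in>E. B i) = (\<Sum>i\<in>E. card (B i))"
  proof (rule card_UN_disjoint[OF assms(2)])
    show "\<forall>i\<in>E. finite (B i)"
      using finite_subset[OF assms(3,1)] by simp
    show "\<forall>i\<in>E. \<forall>j\<in>E. i \<noteq> j \<longrightarrow> B i \<inter> B j = {}"
    proof (intro ballI impI, rule ccontr)
      fix i j assume "i \<in> E" "j \<in> E" "i \<noteq> j" "B i \<inter> B j \<noteq> {}"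
      then obtain x where "x \<in> B i" "x \<in> B j"
        by blast
      then show False
        using assms(4)[of x] assms(3)[OF \<open>i \<in> E\<close>] \<open>i \<in> E\<close> \<open>j \<in> E\<close> \<open>i \<noteq> j\<close> by blast
    qed
  qed
  moreover have "(\<Union>i\<in>E. B i) = A"
  proof (intro equalityI UN_least assms(3) subsetI)
    show "x \<in> (\<Union>i\<in>E. B i)" if "x \<in> A" for x
      using assms(4)[OF that] by blast
  qed
  ultimately show ?thesis
    by simp
qed

definition conjugate :: "('a, 'm) monoid_scheme \<Rightarrow> 'a \<Rightarrow> 'a \<Rightarrow> 'a"
  where "conjugate G g x = g \<otimes>\<^bsub>G\<^esub> x \<otimes>\<^bsub>G\<^esub> inv\<^bsub>G\<^esub> g"

lemma sum_mult_card_unique_cover: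
  fixes f :: "'i \<Rightarrow> 'c :: comm_semiring_1"
  assumes "finite A" "finite E" "\<And>i. i \<in> E \<Longrightarrow> B i \<subseteq> A" "\<And>x. x \<in> A \<Longrightarrow> \<exists>!i. i \<in> E \<and> x \<in> B i"
    and "\<And>i. \<lbrakk>i \<in> E; B i \<noteq> {}\<rbrakk> \<Longrightarrow> f i = a"
  shows "(\<Sum>i\<in>E. f i * of_nat (card (B i))) = a * of_nat (card A)"
proof -
  have "(\<Sum>i\<in>E. f i * of_nat (card (B i))) = (\<Sum>i\<in>E. a * of_nat (card (B i)))"
    using assms(5) by (intro sum.cong refl) (metis card.empty mult_zero_right of_nat_0)
  also have "\<dots> = a * of_nat (\<Sum>i\<in>E. card (B i))"
    by (simp add: sum_distrib_left)
  also have "(\<Sum>i\<in>E. card (B i)) = card A"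
    using assms(1-4) by (rule sum_card_unique_cover)
  finally show ?thesis .
qed

lemma conj_map_eq_conjugate: "conj_map S P g = (\<lambda>x\<in>P. conjugate S g x)"
  by (simp add: conj_map_def conjugate_def)

context group
begin

lemma conjugate_closed [simp]:
  "\<lbrakk>g \<in> carrier G; x \<in> carrier G\<rbrakk> \<Longrightarrow> conjugate G g x \<in> carrier G"
  by (simp add: conjugate_def)

lemma conjugate_by_one [simp]: "x \<in> carrier G \<Longrightarrow> conjugate G \<one> x = x"
  by (simp add: conjugate_def)

lemma conjugate_conjugate:
  "\<lbrakk>g \<in> carrier G; h \<in> carrier G; x \<in> carrier G\<rbrakk> \<Longrightarrow>
    conjugate G g (conjugate G h x) = conjugate G (g \<otimes> h) x"
  by (simp add: conjugate_def inv_mult_group m_assoc)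

lemma conjugate_inv_conjugate [simp]:
  assumes "g \<in> carrier G" "x \<in> carrier G"
  shows "conjugate G (inv g) (conjugate G g x) = x"
    and "conjugate G g (conjugate G (inv g) x) = x"
  using assms by (simp_all add: conjugate_conjugate)

lemma conjugate_mult:
  assumes "g \<in> carrier G" "x \<in> carrier G" "y \<in> carrier G"
  shows "conjugate G g (x \<otimes> y) = conjugate G g x \<otimes> conjugate G g y"
proof -
  have "inv g \<otimes> (g \<otimes> (y \<otimes> inv g)) = y \<otimes> inv g"
    using assms by (simp add: m_assoc[symmetric])
  then show ?thesis
    using assms by (simp add: conjugate_def m_assoc)
qed

lemma conjugate_mult_same [simp]:
  assumes "g \<in> carrier G" "x \<in> carrier G"
  shows "conjugate G g x \<otimes> g = g \<otimes> x" and "inv g \<otimes> conjugate G g x = x \<otimes> inv g"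
  using assms by (simp_all add: conjugate_def m_assoc) (simp add: m_assoc[symmetric])

lemma conjugate_eq_iff_mult:
  assumes "g \<in> carrier G" "x \<in> carrier G" "y \<in> carrier G"
  shows "conjugate G g x = y \<longleftrightarrow> g \<otimes> x = y \<otimes> g"
  using assms by (metis conjugate_closed conjugate_mult_same(1) right_cancel)

lemma conjugate_eq_iff:
  assumes "g \<in> carrier G" "x \<in> carrier G" "y \<in> carrier G"
  shows "conjugate G g x = y \<longleftrightarrow> x = conjugate G (inv g) y"
  using assms by auto

lemma inj_on_conjugate: "g \<in> carrier G \<Longrightarrow> inj_on (conjugate G g) (carrier G)"
  by (metis conjugate_inv_conjugate(1) inj_onI)

lemma normal_conjugate_closed:
  "\<lbrakk>N \<lhd> G; g \<in> carrier G; x \<in> N\<rbrakk> \<Longrightarrow> conjugate G g x \<in> N"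
  by (simp add: conjugate_def normal.inv_op_closed2)

lemma subset_of_conjugate_subset:
  assumes "g \<in> carrier G" "A \<subseteq> carrier G"
    and "\<And>x. x \<in> A \<Longrightarrow> conjugate G (inv g) x \<in> B" "\<And>x. x \<in> B \<Longrightarrow> conjugate G g x \<in> D"
  shows "A \<subseteq> D"
  using assms by (metis conjugate_inv_conjugate(2) subsetD subsetI)

lemma conjugate_set_mult_closed:
  assumes "subgroup Q G" "N \<lhd> G" "N \<subseteq> Q" "g \<in> carrier G" "P \<subseteq> carrier G"
    and "\<And>x. x \<in> P \<Longrightarrow> conjugate G g x \<in> Q" and "y \<in> P <#> N"
  shows "conjugate G g y \<in> Q"
proof -
  obtain a u where y: "a \<in> P" "u \<in> N" "y = a \<otimes> u"
    using assms(7) by (auto simp: set_mult_def)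
  have "a \<in> carrier G" "u \<in> carrier G"
    using y assms(3,5) subgroup.mem_carrier[OF assms(1)] by auto
  then have "conjugate G g y = conjugate G g a \<otimes> conjugate G g u"
    using y assms(4) by (simp add: conjugate_mult)
  moreover have "conjugate G g u \<in> Q"
    using normal_conjugate_closed[OF assms(2,4) y(2)] assms(3) by blast
  ultimately show ?thesis
    using subgroup.m_closed[OF assms(1)] assms(6) y(1) by simp
qed

lemma sum_card_conjugate_twists:
  fixes f :: "('q \<Rightarrow> 'a) \<Rightarrow> 'c :: comm_semiring_1"
  assumes fin: "finite P" "finite (carrier G)" "finite A" and \<phi>: "\<phi> \<in> P \<rightarrow> carrier G"
    and R: "\<And>x. x \<in> A \<Longrightarrow> \<exists>t\<in>carrier G. \<forall>q\<in>P. \<forall>u\<in>carrier G. R x q u \<longleftrightarrow> u = conjugate G t (\<phi> q)"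
    and f: "\<And>t. t \<in> carrier G \<Longrightarrow> f (\<lambda>q\<in>P. conjugate G t (\<phi> q)) = a"
  shows "(\<Sum>\<eta>\<in>P \<rightarrow>\<^sub>E carrier G. f \<eta> * of_nat (card {x \<in> A. \<forall>q\<in>P. R x q (\<eta> q)})) = a * of_nat (card A)"
proof (rule sum_mult_card_unique_cover)
  have twist: "\<exists>t\<in>carrier G. \<forall>\<eta>\<in>P \<rightarrow>\<^sub>E carrier G.
      (\<forall>q\<in>P. R x q (\<eta> q)) \<longleftrightarrow> \<eta> = (\<lambda>q\<in>P. conjugate G t (\<phi> q))" if x: "x \<in> A" for x
  proof -
    obtain t where t: "t \<in> carrier G" "\<forall>q\<in>P. \<forall>u\<in>carrier G. R x q u \<longleftrightarrow> u = conjugate G t (\<phi> q)"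
      using R[OF x] by blast
    have "(\<forall>q\<in>P. R x q (\<eta> q)) \<longleftrightarrow> \<eta> = (\<lambda>q\<in>P. conjugate G t (\<phi> q))" if "\<eta> \<in> P \<rightarrow>\<^sub>E carrier G" for \<eta>
    proof -
      have "(\<forall>q\<in>P. R x q (\<eta> q)) \<longleftrightarrow> (\<forall>q\<in>P. \<eta> q = conjugate G t (\<phi> q))"
        using t(2) PiE_mem[OF that] by (intro ball_cong refl) simp
      also have "\<dots> \<longleftrightarrow> restrict \<eta> P = (\<lambda>q\<in>P. conjugate G t (\<phi> q))"
        by (auto simp: fun_eq_iff restrict_def)
      finally show ?thesis
        using that by (simp add: PiE_restrict)
    qed
    then show ?thesis
      using t(1) by blast
  qed
  show "\<exists>!\<eta>. \<eta> \<in> P \<rightarrow>\<^sub>E carrier G \<and> x \<in> {x \<in> A. \<forall>q\<in>P. R x q (\<eta> q)}" if x: "x \<in> A" for x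
  proof -
    obtain t where t: "t \<in> carrier G" "\<And>\<eta>. \<eta> \<in> P \<rightarrow>\<^sub>E carrier G \<Longrightarrow>
        (\<forall>q\<in>P. R x q (\<eta> q)) \<longleftrightarrow> \<eta> = (\<lambda>q\<in>P. conjugate G t (\<phi> q))"
      using twist[OF x] by blast
    have mem: "(\<lambda>q\<in>P. conjugate G t (\<phi> q)) \<in> P \<rightarrow>\<^sub>E carrier G"
      using t(1) \<phi> by (simp add: Pi_iff)
    show ?thesis
    proof (rule ex1I[of _ "\<lambda>q\<in>P. conjugate G t (\<phi> q)"])
      show "(\<lambda>q\<in>P. conjugate G t (\<phi> q)) \<in> P \<rightarrow>\<^sub>E carrier G \<and>
          x \<in> {x \<in> A. \<forall>q\<in>P. R x q ((\<lambda>q\<in>P. conjugate G t (\<phi> q)) q)}"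
        using t(2)[OF mem] mem x by blast
    qed (use t(2) in blast)
  qed
  show "f \<eta> = a" if \<eta>: "\<eta> \<in> P \<rightarrow>\<^sub>E carrier G" and "{x \<in> A. \<forall>q\<in>P. R x q (\<eta> q)} \<noteq> {}" for \<eta>
  proof -
    from that(2) obtain x where "x \<in> A" "\<forall>q\<in>P. R x q (\<eta> q)"
      by blast
    then obtain t where "t \<in> carrier G" "\<eta> = (\<lambda>q\<in>P. conjugate G t (\<phi> q))"
      using twist \<eta> by blast
    then show ?thesis
      using f by simp
  qed
qed (use fin in \<open>auto simp: finite_PiE\<close>)

lemma conjugate_subgroup:
  "\<lbrakk>subgroup K G; g \<in> K\<rbrakk> \<Longrightarrow> conjugate (G\<lparr>carrier := K\<rparr>) g x = conjugate G g x"
  by (simp add: conjugate_def m_inv_consistent)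

end

lemma (in group_hom) hom_conjugate:
  "\<lbrakk>g \<in> carrier G; x \<in> carrier G\<rbrakk> \<Longrightarrow> h (conjugate G g x) = conjugate H (h g) (h x)"
  by (simp add: conjugate_def)

section \<open>Bisets\<close>

subsection \<open>Actions and fixed points\<close>

definition fixed_points :: "('g, 'h, 'x) biset \<Rightarrow> 'q set \<Rightarrow> ('q \<Rightarrow> 'g) \<Rightarrow> ('q \<Rightarrow> 'h) \<Rightarrow> 'x set"
  where "fixed_points X P \<alpha> \<beta> = {x \<in> points X. \<forall>q\<in>P. ract X x (\<alpha> q) = lact X (\<beta> q) x}"

lemma fixed_points_empty [simp]: "fixed_points X {} \<alpha> \<beta> = points X"
  by (simp add: fixed_points_def)

lemma fixed_points_cong:
  "\<lbrakk>\<And>q. q \<in> P \<Longrightarrow> \<alpha> q = \<alpha>' q; \<And>q. q \<in> P \<Longrightarrow> \<beta> q = \<beta>' q\<rbrakk> \<Longrightarrow>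
    fixed_points X P \<alpha> \<beta> = fixed_points X P \<alpha>' \<beta>'"
  by (auto simp: fixed_points_def)

lemma finite_fixed_points [simp]: "finite (points X) \<Longrightarrow> finite (fixed_points X P \<alpha> \<beta>)"
  by (simp add: fixed_points_def)

locale group_pair = G: group G + H: group H
  for G :: "('g, 'm) monoid_scheme" and H :: "('h, 'n) monoid_scheme"

locale group_biset = group_pair G H
  for G :: "('g, 'm) monoid_scheme" and H :: "('h, 'n) monoid_scheme" +
  fixes X :: "('g, 'h, 'x) biset"
  assumes is_biset: "is_biset G H X"
begin

lemma lact_closed [simp]: "\<lbrakk>x \<in> points X; h \<in> carrier H\<rbrakk> \<Longrightarrow> lact X h x \<in> points X"
  and lact_one [simp]: "x \<in> points X \<Longrightarrow> lact X \<one>\<^bsub>H\<^esub> x = x"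
  and lact_lact [simp]: "\<lbrakk>x \<in> points X; h \<in> carrier H; h' \<in> carrier H\<rbrakk> \<Longrightarrow>
    lact X h (lact X h' x) = lact X (h \<otimes>\<^bsub>H\<^esub> h') x"
  and ract_closed [simp]: "\<lbrakk>x \<in> points X; g \<in> carrier G\<rbrakk> \<Longrightarrow> ract X x g \<in> points X"
  and ract_one [simp]: "x \<in> points X \<Longrightarrow> ract X x \<one>\<^bsub>G\<^esub> = x"
  and ract_ract [simp]: "\<lbrakk>x \<in> points X; g \<in> carrier G; g' \<in> carrier G\<rbrakk> \<Longrightarrow>
    ract X (ract X x g) g' = ract X x (g \<otimes>\<^bsub>G\<^esub> g')"
  and ract_lact [simp]: "\<lbrakk>x \<in> points X; h \<in> carrier H; g \<in> carrier G\<rbrakk> \<Longrightarrow>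
    ract X (lact X h x) g = lact X h (ract X x g)"
  using is_biset unfolding is_biset_def by simp_all

lemma lact_eq_iff:
  assumes "x \<in> points X" "y \<in> points X" "h \<in> carrier H"
  shows "lact X h x = y \<longleftrightarrow> x = lact X (inv\<^bsub>H\<^esub> h) y"
  using assms by auto

lemma ract_eq_iff:
  assumes "x \<in> points X" "y \<in> points X" "g \<in> carrier G"
  shows "ract X x g = y \<longleftrightarrow> x = ract X y (inv\<^bsub>G\<^esub> g)"
  using assms by auto

lemma lact_ract_eq_iff:
  assumes "x \<in> points X" "h \<in> carrier H" "h' \<in> carrier H" "g \<in> carrier G" "g' \<in> carrier G"
  shows "lact X h (ract X x g) = lact X h' (ract X x g') \<longleftrightarrow>
    lact X (inv\<^bsub>H\<^esub> h' \<otimes>\<^bsub>H\<^esub> h) x = ract X x (g' \<otimes>\<^bsub>G\<^esub> inv\<^bsub>G\<^esub> g)"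
proof -
  have "lact X h (ract X x g) = lact X h' (ract X x g') \<longleftrightarrow>
      lact X (inv\<^bsub>H\<^esub> h') (lact X h (ract X x g)) = ract X x g'"
    using assms by (subst lact_eq_iff) simp_all
  also have "\<dots> \<longleftrightarrow> ract X (lact X (inv\<^bsub>H\<^esub> h' \<otimes>\<^bsub>H\<^esub> h) x) g = ract X x g'"
    using assms by simp
  also have "\<dots> \<longleftrightarrow> lact X (inv\<^bsub>H\<^esub> h' \<otimes>\<^bsub>H\<^esub> h) x = ract X (ract X x g') (inv\<^bsub>G\<^esub> g)"
    using assms by (intro ract_eq_iff) simp_all
  also have "\<dots> \<longleftrightarrow> lact X (inv\<^bsub>H\<^esub> h' \<otimes>\<^bsub>H\<^esub> h) x = ract X x (g' \<otimes>\<^bsub>G\<^esub> inv\<^bsub>G\<^esub> g)"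
    using assms by simp
  finally show ?thesis .
qed

lemma fixed_points_translate:
  assumes x: "x \<in> fixed_points X P \<alpha> \<beta>"
    and maps: "\<alpha> \<in> P \<rightarrow> carrier G" "\<beta> \<in> P \<rightarrow> carrier H" and gh: "g \<in> carrier G" "h \<in> carrier H"
  shows "lact X h (ract X x (inv\<^bsub>G\<^esub> g)) \<in>
    fixed_points X P (\<lambda>q. conjugate G g (\<alpha> q)) (\<lambda>q. conjugate H h (\<beta> q))"
proof -
  have xX: "x \<in> points X"
    using x by (simp add: fixed_points_def)
  have "ract X (lact X h (ract X x (inv\<^bsub>G\<^esub> g))) (conjugate G g (\<alpha> q)) =
      lact X (conjugate H h (\<beta> q)) (lact X h (ract X x (inv\<^bsub>G\<^esub> g)))" if q: "q \<in> P" for q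
  proof -
    have \<alpha>\<beta>: "\<alpha> q \<in> carrier G" "\<beta> q \<in> carrier H"
      using maps q by auto
    have "ract X (lact X h (ract X x (inv\<^bsub>G\<^esub> g))) (conjugate G g (\<alpha> q)) =
        lact X h (ract X (ract X x (\<alpha> q)) (inv\<^bsub>G\<^esub> g))"
      using xX \<alpha>\<beta> gh by simp
    also have "\<dots> = lact X h (ract X (lact X (\<beta> q) x) (inv\<^bsub>G\<^esub> g))"
      using x q by (simp add: fixed_points_def)
    also have "\<dots> = lact X (conjugate H h (\<beta> q)) (lact X h (ract X x (inv\<^bsub>G\<^esub> g)))"
      using xX \<alpha>\<beta> gh by simp
    finally show ?thesis .
  qed
  then show ?thesis
    using xX gh by (simp add: fixed_points_def)
qed

lemma card_fixed_points_conjugate: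
  assumes maps: "\<alpha> \<in> P \<rightarrow> carrier G" "\<beta> \<in> P \<rightarrow> carrier H" and gh: "g \<in> carrier G" "h \<in> carrier H"
  shows "card (fixed_points X P (\<lambda>q. conjugate G g (\<alpha> q)) (\<lambda>q. conjugate H h (\<beta> q))) =
    card (fixed_points X P \<alpha> \<beta>)"
proof -
  let ?t = "\<lambda>x. lact X h (ract X x (inv\<^bsub>G\<^esub> g))" and ?s = "\<lambda>x. lact X (inv\<^bsub>H\<^esub> h) (ract X x g)"
  let ?A = "fixed_points X P \<alpha> \<beta>"
    and ?B = "fixed_points X P (\<lambda>q. conjugate G g (\<alpha> q)) (\<lambda>q. conjugate H h (\<beta> q))"
  have "?s x \<in> ?A" if "x \<in> ?B" for x
  proof -
    have "?s x \<in> fixed_points X P (\<lambda>q. conjugate G (inv\<^bsub>G\<^esub> g) (conjugate G g (\<alpha> q)))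
        (\<lambda>q. conjugate H (inv\<^bsub>H\<^esub> h) (conjugate H h (\<beta> q)))"
      using fixed_points_translate[OF that, of "inv\<^bsub>G\<^esub> g" "inv\<^bsub>H\<^esub> h"] maps gh by (simp add: Pi_iff)
    moreover have "fixed_points X P (\<lambda>q. conjugate G (inv\<^bsub>G\<^esub> g) (conjugate G g (\<alpha> q)))
        (\<lambda>q. conjugate H (inv\<^bsub>H\<^esub> h) (conjugate H h (\<beta> q))) = ?A"
      using maps gh by (intro fixed_points_cong) (simp_all add: Pi_iff)
    ultimately show ?thesis
      by simp
  qed
  moreover have "?t x \<in> ?B" if "x \<in> ?A" for x
    using that maps gh by (rule fixed_points_translate)
  moreover have "?s (?t x) = x \<and> ?t (?s x) = x" if "x \<in> ?A \<union> ?B" for x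
  proof -
    have "x \<in> points X"
      using that by (auto simp: fixed_points_def)
    then show ?thesis
      using gh by simp
  qed
  ultimately have "bij_betw ?t ?A ?B"
    by (intro bij_betw_byWitness[where f' = ?s] ballI image_subsetI) simp_all
  then show ?thesis
    by (rule bij_betw_same_card[symmetric])
qed

end

locale free_group_biset = group_biset G H X
  for G :: "('g, 'm) monoid_scheme" and H :: "('h, 'n) monoid_scheme"
    and X :: "('g, 'h, 'x) biset" +
  assumes finite_points [simp]: "finite (points X)"
    and lact_eq_self_imp_one: "\<lbrakk>x \<in> points X; h \<in> carrier H; lact X h x = x\<rbrakk> \<Longrightarrow> h = \<one>\<^bsub>H\<^esub>"
begin

lemma fin_free_biset: "fin_free_biset G H X"
  using is_biset finite_points lact_eq_self_imp_one unfolding fin_free_biset_def by blast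

lemma lact_cancel:
  assumes "x \<in> points X" "h \<in> carrier H" "h' \<in> carrier H" "lact X h x = lact X h' x"
  shows "h = h'"
proof -
  have "lact X (inv\<^bsub>H\<^esub> h' \<otimes>\<^bsub>H\<^esub> h) x = lact X (inv\<^bsub>H\<^esub> h') (lact X h x)"
    using assms(1-3) by simp
  also have "\<dots> = x"
    using assms by simp
  finally have "inv\<^bsub>H\<^esub> h' \<otimes>\<^bsub>H\<^esub> h = \<one>\<^bsub>H\<^esub>"
    using assms(1-3) by (intro lact_eq_self_imp_one) auto
  then show ?thesis
    using assms by (metis H.inv_closed H.inv_equality H.inv_inv)
qed

lemma fixed_points_twist_unique:
  assumes "x \<in> fixed_points X P \<alpha> \<eta>" "x \<in> fixed_points X P \<alpha> \<eta>'"
    and "\<eta> \<in> P \<rightarrow>\<^sub>E carrier H" "\<eta>' \<in> P \<rightarrow>\<^sub>E carrier H"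
  shows "\<eta> = \<eta>'"
  using assms(3,4)
proof (rule PiE_ext)
  show "\<eta> q = \<eta>' q" if "q \<in> P" for q
    using that assms by (intro lact_cancel[of x]) (auto simp: fixed_points_def)
qed

lemma ex1_fixed_points_twist:
  assumes "x \<in> points X" and "\<And>q. q \<in> P \<Longrightarrow> \<exists>h\<in>carrier H. ract X x (\<alpha> q) = lact X h x"
  shows "\<exists>!\<eta>. \<eta> \<in> P \<rightarrow>\<^sub>E carrier H \<and> x \<in> fixed_points X P \<alpha> \<eta>"
proof (rule ex_ex1I)
  obtain \<eta> where "\<And>q. q \<in> P \<Longrightarrow> \<eta> q \<in> carrier H \<and> ract X x (\<alpha> q) = lact X (\<eta> q) x"
    using assms(2) by metis
  then show "\<exists>\<eta>. \<eta> \<in> P \<rightarrow>\<^sub>E carrier H \<and> x \<in> fixed_points X P \<alpha> \<eta>"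
    using assms(1) by (intro exI[of _ "restrict \<eta> P"]) (auto simp: fixed_points_def)
qed (blast intro: fixed_points_twist_unique)

end

lemma (in group_pair) free_group_bisetI:
  "fin_free_biset G H X \<Longrightarrow> free_group_biset G H X"
  by unfold_locales (auto simp: fin_free_biset_def)

subsection \<open>Isomorphisms\<close>

lemma biset_isomorphicE:
  assumes "biset_isomorphic G H X Y"
  obtains f where "bij_betw f (points X) (points Y)"
    and "\<And>x h. \<lbrakk>x \<in> points X; h \<in> carrier H\<rbrakk> \<Longrightarrow> f (lact X h x) = lact Y h (f x)"
    and "\<And>x g. \<lbrakk>x \<in> points X; g \<in> carrier G\<rbrakk> \<Longrightarrow> f (ract X x g) = ract Y (f x) g"
  using assms unfolding biset_isomorphic_def by blast

lemma biset_isomorphicI: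
  assumes "bij_betw f (points X) (points Y)"
    and "\<And>x h. \<lbrakk>x \<in> points X; h \<in> carrier H\<rbrakk> \<Longrightarrow> f (lact X h x) = lact Y h (f x)"
    and "\<And>x g. \<lbrakk>x \<in> points X; g \<in> carrier G\<rbrakk> \<Longrightarrow> f (ract X x g) = ract Y (f x) g"
  shows "biset_isomorphic G H X Y"
  using assms unfolding biset_isomorphic_def by blast

lemma biset_isomorphic_trans:
  assumes "biset_isomorphic G H X Y" "biset_isomorphic G H Y Z"
  shows "biset_isomorphic G H X Z"
proof -
  obtain f where f: "bij_betw f (points X) (points Y)"
    "\<And>x h. \<lbrakk>x \<in> points X; h \<in> carrier H\<rbrakk> \<Longrightarrow> f (lact X h x) = lact Y h (f x)"
    "\<And>x g. \<lbrakk>x \<in> points X; g \<in> carrier G\<rbrakk> \<Longrightarrow> f (ract X x g) = ract Y (f x) g"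
    using assms(1) by (rule biset_isomorphicE) (rule that)
  obtain f' where f': "bij_betw f' (points Y) (points Z)"
    "\<And>x h. \<lbrakk>x \<in> points Y; h \<in> carrier H\<rbrakk> \<Longrightarrow> f' (lact Y h x) = lact Z h (f' x)"
    "\<And>x g. \<lbrakk>x \<in> points Y; g \<in> carrier G\<rbrakk> \<Longrightarrow> f' (ract Y x g) = ract Z (f' x) g"
    using assms(2) by (rule biset_isomorphicE) (rule that)
  have "f x \<in> points Y" if "x \<in> points X" for x
    using f(1) that by (rule bij_betwE[THEN bspec])
  then show ?thesis
    using f f' by (intro biset_isomorphicI[of "f' \<circ> f"] bij_betw_trans[OF f(1) f'(1)]) simp_all
qed

context group_biset
begin

lemma biset_isomorphic_sym:
  assumes "biset_isomorphic G H X Y"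
  shows "biset_isomorphic G H Y X"
proof -
  obtain f where f: "bij_betw f (points X) (points Y)"
    "\<And>x h. \<lbrakk>x \<in> points X; h \<in> carrier H\<rbrakk> \<Longrightarrow> f (lact X h x) = lact Y h (f x)"
    "\<And>x g. \<lbrakk>x \<in> points X; g \<in> carrier G\<rbrakk> \<Longrightarrow> f (ract X x g) = ract Y (f x) g"
    using assms by (rule biset_isomorphicE) (rule that)
  let ?f' = "inv_into (points X) f"
  have f'f: "?f' (f x) = x" if "x \<in> points X" for x
    using f(1) that by (simp add: bij_betw_def)
  have Y: "\<exists>x\<in>points X. y = f x" if "y \<in> points Y" for y
    using f(1) that by (auto simp: bij_betw_def)
  show ?thesis
  proof (rule biset_isomorphicI)
    show "bij_betw ?f' (points Y) (points X)"
      using f(1) by (rule bij_betw_inv_into)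
    show "?f' (lact Y h y) = lact X h (?f' y)" if "y \<in> points Y" "h \<in> carrier H" for y h
      using Y[OF that(1)] that(2) f(2) f'f lact_closed by metis
    show "?f' (ract Y y g) = ract X (?f' y) g" if "y \<in> points Y" "g \<in> carrier G" for y g
      using Y[OF that(1)] that(2) f(3) f'f ract_closed by metis
  qed
qed

lemma is_biset_isomorphic:
  assumes "biset_isomorphic G H X Y"
  shows "is_biset G H Y"
proof -
  obtain f where f: "bij_betw f (points X) (points Y)"
    "\<And>x h. \<lbrakk>x \<in> points X; h \<in> carrier H\<rbrakk> \<Longrightarrow> f (lact X h x) = lact Y h (f x)"
    "\<And>x g. \<lbrakk>x \<in> points X; g \<in> carrier G\<rbrakk> \<Longrightarrow> f (ract X x g) = ract Y (f x) g"
    using assms by (rule biset_isomorphicE) (rule that)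
  have "points Y = f ` points X"
    using f(1) by (simp add: bij_betw_def)
  then show ?thesis
    unfolding is_biset_def by (simp add: f(2,3)[symmetric])
qed

lemma card_fixed_points_isomorphic:
  assumes "biset_isomorphic G H X Y" and maps: "\<alpha> \<in> P \<rightarrow> carrier G" "\<beta> \<in> P \<rightarrow> carrier H"
  shows "card (fixed_points Y P \<alpha> \<beta>) = card (fixed_points X P \<alpha> \<beta>)"
proof -
  obtain f where f: "bij_betw f (points X) (points Y)"
    "\<And>x h. \<lbrakk>x \<in> points X; h \<in> carrier H\<rbrakk> \<Longrightarrow> f (lact X h x) = lact Y h (f x)"
    "\<And>x g. \<lbrakk>x \<in> points X; g \<in> carrier G\<rbrakk> \<Longrightarrow> f (ract X x g) = ract Y (f x) g"
    using assms(1) by (rule biset_isomorphicE) (rule that)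
  have inj: "inj_on f (points X)" and image: "points Y = f ` points X"
    using f(1) by (auto simp: bij_betw_def)
  have "ract Y (f x) (\<alpha> q) = lact Y (\<beta> q) (f x) \<longleftrightarrow> ract X x (\<alpha> q) = lact X (\<beta> q) x"
    if "x \<in> points X" "q \<in> P" for x q
  proof -
    have "\<alpha> q \<in> carrier G" "\<beta> q \<in> carrier H"
      using maps that by auto
    then show ?thesis
      using that(1) by (simp add: f(2,3)[symmetric] inj_on_eq_iff[OF inj])
  qed
  then have "fixed_points Y P \<alpha> \<beta> = f ` fixed_points X P \<alpha> \<beta>"
    unfolding fixed_points_def image by auto
  moreover have "inj_on f (fixed_points X P \<alpha> \<beta>)"
    using inj by (rule inj_on_subset) (auto simp: fixed_points_def)
  ultimately show ?thesis
    by (simp add: card_image)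
qed

lemma iso_class_eqI:
  assumes "biset_isomorphic G H X Y"
  shows "iso_class G H X = iso_class G H Y"
  using biset_isomorphic_trans[OF biset_isomorphic_sym[OF assms]] biset_isomorphic_trans[OF assms]
  unfolding iso_class_def by blast

end

context free_group_biset
begin

lemma fin_free_biset_isomorphic:
  assumes "biset_isomorphic G H X Y"
  shows "fin_free_biset G H Y"
proof -
  obtain f where f: "bij_betw f (points X) (points Y)"
    "\<And>x h. \<lbrakk>x \<in> points X; h \<in> carrier H\<rbrakk> \<Longrightarrow> f (lact X h x) = lact Y h (f x)"
    using assms by (rule biset_isomorphicE) (rule that)
  have inj: "inj_on f (points X)" and image: "points Y = f ` points X"
    using f(1) by (auto simp: bij_betw_def)
  have "lact X h x = x" if "x \<in> points X" "h \<in> carrier H" "lact Y h (f x) = f x" for x h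
    using that by (simp add: f(2)[symmetric] inj_on_eq_iff[OF inj])
  then show ?thesis
    using is_biset_isomorphic[OF assms] lact_eq_self_imp_one
    unfolding fin_free_biset_def image by auto
qed

lemma nat_representative:
  obtains Y :: "('g, 'h, nat) biset" where "fin_free_biset G H Y" "biset_isomorphic G H X Y"
proof -
  obtain f :: "'x \<Rightarrow> nat" where f: "bij_betw f (points X) {0..<card (points X)}"
    using ex_bij_betw_finite_nat[OF finite_points] by blast
  let ?f' = "inv_into (points X) f"
  have f'f: "?f' (f x) = x" if "x \<in> points X" for x
    using f that by (simp add: bij_betw_def)
  let ?Y = "\<lparr>points = f ` points X, lact = \<lambda>h y. f (lact X h (?f' y)),
    ract = \<lambda>y g. f (ract X (?f' y) g)\<rparr>"
  have "biset_isomorphic G H X ?Y"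
    using f by (intro biset_isomorphicI[of f]) (auto simp: bij_betw_def f'f)
  then show ?thesis
    using that fin_free_biset_isomorphic by blast
qed

lemma iso_class_nonempty: "iso_class G H X \<noteq> {}"
  using nat_representative unfolding iso_class_def by blast

lemma iso_class_in_iso_classes: "iso_class G H X \<in> iso_classes G H"
proof -
  obtain Y :: "('g, 'h, nat) biset" where "fin_free_biset G H Y" "biset_isomorphic G H X Y"
    by (rule nat_representative)
  then show ?thesis
    using iso_class_eqI unfolding iso_classes_def by blast
qed

end

lemma (in group_pair) iso_classesE:
  assumes "c \<in> iso_classes G H"
  obtains X :: "('g, 'h, nat) biset" where "free_group_biset G H X" "c = iso_class G H X"
  using assms free_group_bisetI unfolding iso_classes_def by blast

subsection \<open>Disjoint unions\<close>

lemma fin_free_biset_sum: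
  assumes "fin_free_biset G H X" "fin_free_biset G H Y"
  shows "fin_free_biset G H (biset_sum X Y)"
  using assms unfolding fin_free_biset_def is_biset_def biset_sum_def by auto

lemma biset_sum_isomorphic:
  assumes "biset_isomorphic G H X X'" "biset_isomorphic G H Y Y'"
  shows "biset_isomorphic G H (biset_sum X Y) (biset_sum X' Y')"
proof -
  obtain f where f: "bij_betw f (points X) (points X')"
    "\<And>x h. \<lbrakk>x \<in> points X; h \<in> carrier H\<rbrakk> \<Longrightarrow> f (lact X h x) = lact X' h (f x)"
    "\<And>x g. \<lbrakk>x \<in> points X; g \<in> carrier G\<rbrakk> \<Longrightarrow> f (ract X x g) = ract X' (f x) g"
    using assms(1) by (rule biset_isomorphicE) (rule that)
  obtain f' where f': "bij_betw f' (points Y) (points Y')"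
    "\<And>y h. \<lbrakk>y \<in> points Y; h \<in> carrier H\<rbrakk> \<Longrightarrow> f' (lact Y h y) = lact Y' h (f' y)"
    "\<And>y g. \<lbrakk>y \<in> points Y; g \<in> carrier G\<rbrakk> \<Longrightarrow> f' (ract Y y g) = ract Y' (f' y) g"
    using assms(2) by (rule biset_isomorphicE) (rule that)
  show ?thesis
  proof (rule biset_isomorphicI[of "map_sum f f'"])
    show "bij_betw (map_sum f f') (points (biset_sum X Y)) (points (biset_sum X' Y'))"
      unfolding bij_betw_def
    proof
      show "inj_on (map_sum f f') (points (biset_sum X Y))"
        using f(1) f'(1) by (auto simp: biset_sum_def bij_betw_def dest: inj_onD intro!: inj_onI)
      show "map_sum f f' ` points (biset_sum X Y) = points (biset_sum X' Y')"
        using bij_betw_imp_surj_on[OF f(1), symmetric] bij_betw_imp_surj_on[OF f'(1), symmetric]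
        by (simp add: biset_sum_def Plus_def image_Un image_image)
    qed
  qed (auto simp: biset_sum_def f f')
qed

lemma card_fixed_points_sum:
  assumes "finite (points X)" "finite (points Y)"
  shows "card (fixed_points (biset_sum X Y) P \<alpha> \<beta>) =
    card (fixed_points X P \<alpha> \<beta>) + card (fixed_points Y P \<alpha> \<beta>)"
proof -
  have "fixed_points (biset_sum X Y) P \<alpha> \<beta> = fixed_points X P \<alpha> \<beta> <+> fixed_points Y P \<alpha> \<beta>"
    by (auto simp: fixed_points_def biset_sum_def)
  then show ?thesis
    using assms by (simp add: card_Plus)
qed

subsection \<open>Orbits\<close>

abbreviation sub_biset :: "('g, 'h, 'x) biset \<Rightarrow> 'x set \<Rightarrow> ('g, 'h, 'x) biset"
  where "sub_biset X A \<equiv> X\<lparr>points := A\<rparr>"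

definition invariant_points ::
    "('g, 'm) monoid_scheme \<Rightarrow> ('h, 'n) monoid_scheme \<Rightarrow> ('g, 'h, 'x) biset \<Rightarrow> 'x set \<Rightarrow> bool"
  where "invariant_points G H X A \<longleftrightarrow> A \<subseteq> points X \<and>
    (\<forall>x\<in>A. (\<forall>h\<in>carrier H. lact X h x \<in> A) \<and> (\<forall>g\<in>carrier G. ract X x g \<in> A))"

definition biset_orbit ::
    "('g, 'm) monoid_scheme \<Rightarrow> ('h, 'n) monoid_scheme \<Rightarrow> ('g, 'h, 'x) biset \<Rightarrow> 'x \<Rightarrow> 'x set"
  where "biset_orbit G H X x = {lact X h (ract X x g) | h g. h \<in> carrier H \<and> g \<in> carrier G}"

text \<open>These are the points \<open>x\<close> whose left orbit \<open>H x\<close> is fixed by \<open>G\<close>.\<close>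

definition left_fixed_points ::
    "('g, 'm) monoid_scheme \<Rightarrow> ('h, 'n) monoid_scheme \<Rightarrow> ('g, 'h, 'x) biset \<Rightarrow> 'x set"
  where "left_fixed_points G H X =
    {x \<in> points X. \<forall>g\<in>carrier G. \<exists>h\<in>carrier H. ract X x g = lact X h x}"

definition left_orbit_stabilizer ::
    "('g, 'm) monoid_scheme \<Rightarrow> ('h, 'n) monoid_scheme \<Rightarrow> ('g, 'h, 'x) biset \<Rightarrow> 'x \<Rightarrow> 'g set"
  where "left_orbit_stabilizer G H X x = {g \<in> carrier G. \<exists>h\<in>carrier H. ract X x g = lact X h x}"

lemma left_fixed_points_iff:
  "x \<in> left_fixed_points G H X \<longleftrightarrow> x \<in> points X \<and> left_orbit_stabilizer G H X x = carrier G"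
  by (auto simp: left_fixed_points_def left_orbit_stabilizer_def)

context group_biset
begin

lemma invariant_points_Diff:
  assumes "invariant_points G H X A"
  shows "invariant_points G H X (points X - A)"
proof -
  have "x \<in> A" if "x \<in> points X" "h \<in> carrier H" "lact X h x \<in> A" for x h
  proof -
    have "lact X (inv\<^bsub>H\<^esub> h) (lact X h x) \<in> A"
      using assms that by (simp add: invariant_points_def del: lact_lact)
    then show ?thesis
      using that by simp
  qed
  moreover have "x \<in> A" if "x \<in> points X" "g \<in> carrier G" "ract X x g \<in> A" for x g
  proof -
    have "ract X (ract X x g) (inv\<^bsub>G\<^esub> g) \<in> A"
      using assms that by (simp add: invariant_points_def del: ract_ract)
    then show ?thesis
      using that by simp
  qed
  ultimately show ?thesis
    unfolding invariant_points_def by auto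
qed

lemma biset_isomorphic_split:
  assumes "invariant_points G H X A"
  shows "biset_isomorphic G H X (biset_sum (sub_biset X A) (sub_biset X (points X - A)))"
proof (rule biset_isomorphicI[of "\<lambda>x. if x \<in> A then Inl x else Inr x"])
  show "bij_betw (\<lambda>x. if x \<in> A then Inl x else Inr x) (points X)
      (points (biset_sum (sub_biset X A) (sub_biset X (points X - A))))"
    using assms
    by (auto simp: bij_betw_def inj_on_def biset_sum_def invariant_points_def
      image_iff split: if_splits)
qed (use assms invariant_points_Diff[OF assms] in \<open>auto simp: biset_sum_def invariant_points_def\<close>)

lemma mem_biset_orbit_self: "x \<in> points X \<Longrightarrow> x \<in> biset_orbit G H X x"
  unfolding biset_orbit_def by (intro CollectI exI[of _ "\<one>\<^bsub>H\<^esub>"] exI[of _ "\<one>\<^bsub>G\<^esub>"]) simp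

lemma biset_orbit_subset_invariant:
  "\<lbrakk>invariant_points G H X A; x \<in> A\<rbrakk> \<Longrightarrow> biset_orbit G H X x \<subseteq> A"
  by (auto simp: biset_orbit_def invariant_points_def)

lemma invariant_biset_orbit:
  assumes "x \<in> points X"
  shows "invariant_points G H X (biset_orbit G H X x)"
  unfolding invariant_points_def
proof (intro conjI ballI)
  show "biset_orbit G H X x \<subseteq> points X"
    using assms by (auto simp: biset_orbit_def)
  fix y assume "y \<in> biset_orbit G H X x"
  then obtain h g where y: "h \<in> carrier H" "g \<in> carrier G" "y = lact X h (ract X x g)"
    by (auto simp: biset_orbit_def)
  show "lact X h' y \<in> biset_orbit G H X x" if "h' \<in> carrier H" for h'
    unfolding biset_orbit_def using y that assms
    by (intro CollectI exI[of _ "h' \<otimes>\<^bsub>H\<^esub> h"] exI[of _ g]) simp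
  show "ract X y g' \<in> biset_orbit G H X x" if "g' \<in> carrier G" for g'
    unfolding biset_orbit_def using y that assms
    by (intro CollectI exI[of _ h] exI[of _ "g \<otimes>\<^bsub>G\<^esub> g'"]) simp
qed

lemma biset_orbit_eq:
  assumes "x \<in> points X" "y \<in> biset_orbit G H X x"
  shows "biset_orbit G H X y = biset_orbit G H X x"
proof
  show "biset_orbit G H X y \<subseteq> biset_orbit G H X x"
    using invariant_biset_orbit[OF assms(1)] assms(2) by (rule biset_orbit_subset_invariant)
  obtain h g where y: "h \<in> carrier H" "g \<in> carrier G" "y = lact X h (ract X x g)"
    using assms(2) by (auto simp: biset_orbit_def)
  have "x = lact X (inv\<^bsub>H\<^esub> h) (ract X y (inv\<^bsub>G\<^esub> g))"
    using y assms(1) by simp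
  then have "x \<in> biset_orbit G H X y"
    unfolding biset_orbit_def using y(1,2) by blast
  moreover have "y \<in> points X"
    using y assms(1) by simp
  ultimately show "biset_orbit G H X x \<subseteq> biset_orbit G H X y"
    using invariant_biset_orbit by (intro biset_orbit_subset_invariant)
qed

lemma dvd_card_invariant_points:
  assumes "finite A" "invariant_points G H X A" "\<And>x. x \<in> A \<Longrightarrow> d dvd card (biset_orbit G H X x)"
  shows "d dvd card A"
proof -
  have sub: "A \<subseteq> points X"
    using assms(2) by (simp add: invariant_points_def)
  have union: "\<Union> (biset_orbit G H X ` A) = A"
    using biset_orbit_subset_invariant[OF assms(2)] mem_biset_orbit_self sub by blast
  have "d dvd card (\<Union> (biset_orbit G H X ` A))"
  proof (rule dvd_partition)
    show "\<forall>O1\<in>biset_orbit G H X ` A. \<forall>O2\<in>biset_orbit G H X ` A. O1 \<noteq> O2 \<longrightarrow> O1 \<inter> O2 = {}"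
      using biset_orbit_eq sub by blast
  qed (use assms(1,3) union in auto)
  then show ?thesis
    by (simp only: union)
qed

lemma invariant_left_fixed_points: "invariant_points G H X (left_fixed_points G H X)"
  unfolding invariant_points_def
proof (intro conjI ballI)
  show "left_fixed_points G H X \<subseteq> points X"
    by (auto simp: left_fixed_points_def)
  fix x assume "x \<in> left_fixed_points G H X"
  then have x: "x \<in> points X" "\<And>g. g \<in> carrier G \<Longrightarrow> \<exists>v\<in>carrier H. ract X x g = lact X v x"
    by (auto simp: left_fixed_points_def)
  show "lact X h x \<in> left_fixed_points G H X" if h: "h \<in> carrier H" for h
  proof -
    have "\<exists>v\<in>carrier H. ract X (lact X h x) g = lact X v (lact X h x)" if g: "g \<in> carrier G" for g
    proof -
      obtain v where "v \<in> carrier H" "ract X x g = lact X v x"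
        using x(2)[OF g] by blast
      then show ?thesis
        using x(1) g h by (intro bexI[of _ "conjugate H h v"]) simp_all
    qed
    then show ?thesis
      using x(1) h by (simp add: left_fixed_points_def)
  qed
  show "ract X x g \<in> left_fixed_points G H X" if g: "g \<in> carrier G" for g
  proof -
    have "\<exists>v\<in>carrier H. ract X (ract X x g) g' = lact X v (ract X x g)" if g': "g' \<in> carrier G" for g'
    proof -
      obtain v where v: "v \<in> carrier H" "ract X x (conjugate G g g') = lact X v x"
        using x(2)[of "conjugate G g g'"] g g' by auto
      have "ract X (ract X x g) g' = ract X (ract X x (conjugate G g g')) g"
        using x(1) g g' by simp
      then show ?thesis
        using v x(1) g by (intro bexI[of _ v]) (simp_all only: ract_lact)
    qed
    then show ?thesis
      using x(1) g by (simp add: left_fixed_points_def)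
  qed
qed

end

context free_group_biset
begin

lemma fin_free_sub_biset:
  assumes "invariant_points G H X A"
  shows "fin_free_biset G H (sub_biset X A)"
proof -
  have "A \<subseteq> points X"
    using assms by (simp add: invariant_points_def)
  then have "finite A"
    using finite_points finite_subset by blast
  then show ?thesis
    using fin_free_biset assms unfolding fin_free_biset_def is_biset_def invariant_points_def
    by auto
qed

lemma sum_card_fixed_points:
  assumes "finite (carrier G)" "finite (carrier H)"
  shows "(\<Sum>\<eta>\<in>carrier G \<rightarrow>\<^sub>E carrier H. card (fixed_points X (carrier G) (\<lambda>g. g) \<eta>)) =
    card (left_fixed_points G H X)"
proof (rule sum_card_unique_cover)
  show "fixed_points X (carrier G) (\<lambda>g. g) \<eta> \<subseteq> left_fixed_points G H X"
    if "\<eta> \<in> carrier G \<rightarrow>\<^sub>E carrier H" for \<eta>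
    using that by (auto simp: fixed_points_def left_fixed_points_def)
  show "\<exists>!\<eta>. \<eta> \<in> carrier G \<rightarrow>\<^sub>E carrier H \<and> x \<in> fixed_points X (carrier G) (\<lambda>g. g) \<eta>"
    if "x \<in> left_fixed_points G H X" for x
    using that by (intro ex1_fixed_points_twist) (auto simp: left_fixed_points_def)
qed (use assms in \<open>simp_all add: left_fixed_points_def finite_PiE\<close>)

lemma subgroup_left_orbit_stabilizer:
  assumes "x \<in> points X"
  shows "subgroup (left_orbit_stabilizer G H X x) G"
proof (rule G.subgroupI)
  show "left_orbit_stabilizer G H X x \<noteq> {}"
    using assms by (auto simp: left_orbit_stabilizer_def intro!: exI[of _ "\<one>\<^bsub>G\<^esub>"] bexI[of _ "\<one>\<^bsub>H\<^esub>"])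
  fix a assume "a \<in> left_orbit_stabilizer G H X x"
  then obtain h where a: "a \<in> carrier G" "h \<in> carrier H" "ract X x a = lact X h x"
    by (auto simp: left_orbit_stabilizer_def)
  have "lact X (inv\<^bsub>H\<^esub> h) x = ract X (lact X (inv\<^bsub>H\<^esub> h) (ract X x a)) (inv\<^bsub>G\<^esub> a)"
    using a(1,2) assms by simp
  also have "\<dots> = ract X x (inv\<^bsub>G\<^esub> a)"
    unfolding a(3) using a(1,2) assms by simp
  finally show "inv\<^bsub>G\<^esub> a \<in> left_orbit_stabilizer G H X x"
    using a(1,2) by (auto simp: left_orbit_stabilizer_def intro!: bexI[of _ "inv\<^bsub>H\<^esub> h"])
  fix b assume "b \<in> left_orbit_stabilizer G H X x"
  then obtain k where b: "b \<in> carrier G" "k \<in> carrier H" "ract X x b = lact X k x"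
    by (auto simp: left_orbit_stabilizer_def)
  have "ract X x (a \<otimes>\<^bsub>G\<^esub> b) = ract X (ract X x a) b"
    using a(1) b(1) assms by simp
  also have "\<dots> = lact X (h \<otimes>\<^bsub>H\<^esub> k) x"
    using a b assms by simp
  finally show "a \<otimes>\<^bsub>G\<^esub> b \<in> left_orbit_stabilizer G H X x"
    using a(1,2) b(1,2) by (auto simp: left_orbit_stabilizer_def intro!: bexI[of _ "h \<otimes>\<^bsub>H\<^esub> k"])
qed (auto simp: left_orbit_stabilizer_def)

lemma hom_of_fixed_point:
  assumes K: "subgroup K G" and \<phi>: "\<phi> \<in> K \<rightarrow> carrier H" and x: "x \<in> fixed_points X K (\<lambda>k. k) \<phi>"
  shows "\<phi> \<in> hom (sub_group G K) H"
proof (rule homI)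
  have xX: "x \<in> points X" and act: "\<And>k. k \<in> K \<Longrightarrow> ract X x k = lact X (\<phi> k) x"
    using x by (auto simp: fixed_points_def)
  show "\<phi> k \<in> carrier H" if "k \<in> carrier (sub_group G K)" for k
    using \<phi> that by auto
  show "\<phi> (k \<otimes>\<^bsub>sub_group G K\<^esub> l) = \<phi> k \<otimes>\<^bsub>H\<^esub> \<phi> l"
    if "k \<in> carrier (sub_group G K)" "l \<in> carrier (sub_group G K)" for k l
  proof -
    have kl: "k \<in> K" "l \<in> K" "k \<otimes>\<^bsub>G\<^esub> l \<in> K" "k \<in> carrier G" "l \<in> carrier G"
      "\<phi> k \<in> carrier H" "\<phi> l \<in> carrier H" "\<phi> (k \<otimes>\<^bsub>G\<^esub> l) \<in> carrier H"
      using that K \<phi> subgroup.m_closed[OF K] subgroup.mem_carrier[OF K] by auto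
    have "lact X (\<phi> (k \<otimes>\<^bsub>G\<^esub> l)) x = ract X (ract X x k) l"
      using kl xX by (simp add: act[symmetric])
    also have "\<dots> = lact X (\<phi> k \<otimes>\<^bsub>H\<^esub> \<phi> l) x"
      using kl xX by (simp add: act)
    finally show ?thesis
      using lact_cancel[OF xX] kl by simp
  qed
qed

end

subsection \<open>Products\<close>

lemma card_quotient_classes:
  assumes "equiv A r" "finite A" "\<And>a. a \<in> A \<Longrightarrow> card (r `` {a}) = n"
  shows "card {a \<in> A. Q (r `` {a})} = n * card {C \<in> A // r. Q C}"
proof -
  have "(\<Sum>C\<in>{C \<in> A // r. Q C}. card C) = card {a \<in> A. Q (r `` {a})}"
  proof (rule sum_card_unique_cover)
    show "finite {C \<in> A // r. Q C}"
      using assms(1,2) by (simp add: finite_quotient equiv_def)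
    show "C \<subseteq> {a \<in> A. Q (r `` {a})}" if "C \<in> {C \<in> A // r. Q C}" for C
    proof
      fix a assume "a \<in> C"
      then have "a \<in> A" "C = r `` {a}"
        using that assms(1) by (auto elim!: quotientE simp: equiv_class_eq_iff)
      then show "a \<in> {a \<in> A. Q (r `` {a})}"
        using that by simp
    qed
    fix a assume "a \<in> {a \<in> A. Q (r `` {a})}"
    then have a: "a \<in> A" "Q (r `` {a})"
      by simp_all
    show "\<exists>!C. C \<in> {C \<in> A // r. Q C} \<and> a \<in> C"
    proof (rule ex1I[of _ "r `` {a}"])
      show "r `` {a} \<in> {C \<in> A // r. Q C} \<and> a \<in> r `` {a}"
        using a equiv_class_self[OF assms(1)] by (simp add: quotientI)
      show "C = r `` {a}" if "C \<in> {C \<in> A // r. Q C} \<and> a \<in> C" for C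
        using that assms(1) by (auto elim!: quotientE simp: equiv_class_eq_iff)
    qed
  qed (use assms(2) in simp)
  moreover have "card C = n" if "C \<in> A // r" for C
    using that assms(3) by (auto elim: quotientE)
  ultimately show ?thesis
    by (simp add: mult.commute)
qed

definition prod_rel :: "('h, 'm) monoid_scheme \<Rightarrow> ('h, 'k, 'x) biset \<Rightarrow>
  ('g, 'h, 'y) biset \<Rightarrow> ('x \<times> 'y) rel"
  where "prod_rel H X Y =
    {((ract X x h, y), (x, lact Y h y)) | x h y. x \<in> points X \<and> h \<in> carrier H \<and> y \<in> points Y}"

definition pair_class :: "('h, 'm) monoid_scheme \<Rightarrow> ('h, 'k, 'x) biset \<Rightarrow> ('g, 'h, 'y) biset \<Rightarrow>
    'x \<Rightarrow> 'y \<Rightarrow> ('x \<times> 'y) set"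
  where "pair_class H X Y x y = prod_rel H X Y `` {(x, y)}"

definition fixed_pairs :: "('h, 'm) monoid_scheme \<Rightarrow> ('h, 'k, 'x) biset \<Rightarrow> ('g, 'h, 'y) biset \<Rightarrow>
    'q set \<Rightarrow> ('q \<Rightarrow> 'g) \<Rightarrow> ('q \<Rightarrow> 'k) \<Rightarrow> ('x \<times> 'y) set"
  where "fixed_pairs H X Y P \<alpha> \<beta> = {(x, y). x \<in> points X \<and> y \<in> points Y \<and>
    (\<forall>q\<in>P. \<exists>h\<in>carrier H. ract Y y (\<alpha> q) = lact Y h y \<and> ract X x h = lact X (\<beta> q) x)}"

locale biset_product = X: free_group_biset H K X + Y: free_group_biset G H Y
  for G :: "('g, 'm) monoid_scheme" and H :: "('h, 'n) monoid_scheme" and K :: "('k, 'l) monoid_scheme"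
    and X :: "('h, 'k, 'x) biset" and Y :: "('g, 'h, 'y) biset" +
  assumes finite_H: "finite (carrier H)"
begin

lemma prod_rel_iff:
  "((x, y), (x', y')) \<in> prod_rel H X Y \<longleftrightarrow>
    x' \<in> points X \<and> y \<in> points Y \<and> (\<exists>h\<in>carrier H. x = ract X x' h \<and> y' = lact Y h y)"
  unfolding prod_rel_def by auto

lemma equiv_prod_rel: "equiv (points X \<times> points Y) (prod_rel H X Y)"
proof (rule equivI)
  show "prod_rel H X Y \<subseteq> (points X \<times> points Y) \<times> (points X \<times> points Y)"
    unfolding prod_rel_def by auto
  show "refl_on (points X \<times> points Y) (prod_rel H X Y)"
    by (rule refl_onI) (auto simp: prod_rel_iff intro!: bexI[of _ "\<one>\<^bsub>H\<^esub>"])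
  show "sym (prod_rel H X Y)"
  proof (rule symI, clarify)
    fix x y x' y' assume "((x, y), x', y') \<in> prod_rel H X Y"
    then show "((x', y'), x, y) \<in> prod_rel H X Y"
      by (auto simp: prod_rel_iff intro!: bexI[of _ "inv\<^bsub>H\<^esub> _"])
  qed
  show "trans (prod_rel H X Y)"
  proof (rule transI, clarify)
    fix x y x' y' x'' y''
    assume "((x, y), x', y') \<in> prod_rel H X Y" "((x', y'), x'', y'') \<in> prod_rel H X Y"
    then obtain h k where "y \<in> points Y" "h \<in> carrier H" "x = ract X x' h" "y' = lact Y h y"
      "x'' \<in> points X" "k \<in> carrier H" "x' = ract X x'' k" "y'' = lact Y k y'"
      by (auto simp: prod_rel_iff)
    then show "((x, y), x'', y'') \<in> prod_rel H X Y"
      by (auto simp: prod_rel_iff intro!: bexI[of _ "k \<otimes>\<^bsub>H\<^esub> h"])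
  qed
qed

lemma points_prod: "points (biset_prod H X Y) = (points X \<times> points Y) // prod_rel H X Y"
  unfolding biset_prod_def prod_rel_def by simp

lemma pair_class_in_points [simp]:
  "\<lbrakk>x \<in> points X; y \<in> points Y\<rbrakk> \<Longrightarrow> pair_class H X Y x y \<in> points (biset_prod H X Y)"
  unfolding points_prod pair_class_def by (auto intro: quotientI)

lemma points_prodE:
  assumes "C \<in> points (biset_prod H X Y)"
  obtains x y where "x \<in> points X" "y \<in> points Y" "C = pair_class H X Y x y"
  using assms unfolding points_prod pair_class_def by (auto elim!: quotientE)

lemma pair_class_eq_iff:
  assumes "x \<in> points X" "y \<in> points Y" "x' \<in> points X" "y' \<in> points Y"
  shows "pair_class H X Y x y = pair_class H X Y x' y' \<longleftrightarrow>
    (\<exists>h\<in>carrier H. x = ract X x' h \<and> y' = lact Y h y)"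
  unfolding pair_class_def
  using eq_equiv_class_iff[OF equiv_prod_rel, of "(x, y)" "(x', y')"] assms by (auto simp: prod_rel_iff)

lemma pair_class_eq_image:
  assumes "x \<in> points X" "y \<in> points Y"
  shows "pair_class H X Y x y = (\<lambda>h. (ract X x (inv\<^bsub>H\<^esub> h), lact Y h y)) ` carrier H"
proof (intro equalityI subrelI)
  show "(a, b) \<in> (\<lambda>h. (ract X x (inv\<^bsub>H\<^esub> h), lact Y h y)) ` carrier H"
    if "(a, b) \<in> pair_class H X Y x y" for a b
    using that by (auto simp: pair_class_def prod_rel_iff intro!: image_eqI)
  show "(a, b) \<in> pair_class H X Y x y"
    if "(a, b) \<in> (\<lambda>h. (ract X x (inv\<^bsub>H\<^esub> h), lact Y h y)) ` carrier H" for a b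
    using that assms by (force simp: pair_class_def prod_rel_iff)
qed

lemma card_pair_class:
  assumes "x \<in> points X" "y \<in> points Y"
  shows "card (pair_class H X Y x y) = card (carrier H)"
  unfolding pair_class_eq_image[OF assms]
  by (rule card_image) (auto simp: inj_on_def intro: Y.lact_cancel[OF assms(2)])

lemma lact_pair_class [simp]:
  assumes "x \<in> points X" "y \<in> points Y" "k \<in> carrier K"
  shows "lact (biset_prod H X Y) k (pair_class H X Y x y) = pair_class H X Y (lact X k x) y"
  using assms by (simp add: biset_prod_def pair_class_eq_image image_image)

lemma ract_pair_class [simp]:
  assumes "x \<in> points X" "y \<in> points Y" "g \<in> carrier G"
  shows "ract (biset_prod H X Y) (pair_class H X Y x y) g = pair_class H X Y x (ract Y y g)"
  using assms by (simp add: biset_prod_def pair_class_eq_image image_image)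

lemma is_biset_prod: "is_biset G K (biset_prod H X Y)"
  unfolding is_biset_def by (intro ballI; elim points_prodE) simp

lemma fin_free_biset_prod: "fin_free_biset G K (biset_prod H X Y)"
  unfolding fin_free_biset_def
proof (intro conjI ballI impI is_biset_prod)
  show "finite (points (biset_prod H X Y))"
    unfolding points_prod using equiv_prod_rel by (intro finite_quotient) (auto simp: equiv_def)
  fix C k assume C: "C \<in> points (biset_prod H X Y)" and k: "k \<in> carrier K"
    and fixed: "lact (biset_prod H X Y) k C = C"
  obtain x y where xy: "x \<in> points X" "y \<in> points Y" "C = pair_class H X Y x y"
    using C by (rule points_prodE)
  then obtain h where h: "h \<in> carrier H" "lact X k x = ract X x h" "y = lact Y h y"
    using pair_class_eq_iff[of "lact X k x" y x y] k fixed by auto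
  then have "h = \<one>\<^bsub>H\<^esub>"
    using Y.lact_eq_self_imp_one[OF xy(2)] by simp
  then have "lact X k x = x"
    using h(2) xy(1) by simp
  then show "k = \<one>\<^bsub>K\<^esub>"
    using X.lact_eq_self_imp_one[OF xy(1) k] by simp
qed

lemma pair_class_fixed_iff:
  assumes xy: "x \<in> points X" "y \<in> points Y" and maps: "\<alpha> \<in> P \<rightarrow> carrier G" "\<beta> \<in> P \<rightarrow> carrier K"
  shows "pair_class H X Y x y \<in> fixed_points (biset_prod H X Y) P \<alpha> \<beta>
    \<longleftrightarrow> (x, y) \<in> fixed_pairs H X Y P \<alpha> \<beta>"
proof -
  have "ract (biset_prod H X Y) (pair_class H X Y x y) (\<alpha> q) =
      lact (biset_prod H X Y) (\<beta> q) (pair_class H X Y x y) \<longleftrightarrow>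
    (\<exists>h\<in>carrier H. ract Y y (\<alpha> q) = lact Y h y \<and> ract X x h = lact X (\<beta> q) x)" if "q \<in> P" for q
  proof -
    have q: "\<alpha> q \<in> carrier G" "\<beta> q \<in> carrier K"
      using maps that by auto
    have "ract (biset_prod H X Y) (pair_class H X Y x y) (\<alpha> q) =
        lact (biset_prod H X Y) (\<beta> q) (pair_class H X Y x y) \<longleftrightarrow>
      pair_class H X Y (lact X (\<beta> q) x) y = pair_class H X Y x (ract Y y (\<alpha> q))"
      using q xy by auto
    also have "\<dots> \<longleftrightarrow> (\<exists>h\<in>carrier H. lact X (\<beta> q) x = ract X x h \<and> ract Y y (\<alpha> q) = lact Y h y)"
      using q xy by (intro pair_class_eq_iff) simp_all
    finally show ?thesis
      by metis
  qed
  then show ?thesis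
    using xy by (simp add: fixed_points_def fixed_pairs_def)
qed

lemma card_fixed_pairs:
  assumes "\<alpha> \<in> P \<rightarrow> carrier G" "\<beta> \<in> P \<rightarrow> carrier K"
  shows "card (fixed_pairs H X Y P \<alpha> \<beta>) =
    card (carrier H) * card (fixed_points (biset_prod H X Y) P \<alpha> \<beta>)"
proof -
  let ?fixed = "\<lambda>C. C \<in> fixed_points (biset_prod H X Y) P \<alpha> \<beta>"
  have "card {a \<in> points X \<times> points Y. ?fixed (prod_rel H X Y `` {a})} =
      card (carrier H) * card {C \<in> (points X \<times> points Y) // prod_rel H X Y. ?fixed C}"
    using card_pair_class by (intro card_quotient_classes equiv_prod_rel) (auto simp: pair_class_def)
  moreover have "{C \<in> (points X \<times> points Y) // prod_rel H X Y. ?fixed C} =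
    fixed_points (biset_prod H X Y) P \<alpha> \<beta>"
    by (auto simp: fixed_points_def points_prod[symmetric])
  moreover have "{a \<in> points X \<times> points Y. ?fixed (prod_rel H X Y `` {a})} = fixed_pairs H X Y P \<alpha> \<beta>"
    using pair_class_fixed_iff[OF _ _ assms] by (auto simp: pair_class_def fixed_pairs_def)
  ultimately show ?thesis
    by simp
qed

text \<open>For a fixed pair \<open>(x, y)\<close>, freeness of the left action on \<open>y\<close> makes \<open>h\<close> a function of \<open>q\<close>.\<close>

lemma card_fixed_points_prod:
  assumes P: "finite P" and maps: "\<alpha> \<in> P \<rightarrow> carrier G" "\<beta> \<in> P \<rightarrow> carrier K"
  shows "card (carrier H) * card (fixed_points (biset_prod H X Y) P \<alpha> \<beta>) =
    (\<Sum>\<eta>\<in>P \<rightarrow>\<^sub>E carrier H. card (fixed_points X P \<eta> \<beta>) * card (fixed_points Y P \<alpha> \<eta>))"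
proof -
  have "(\<Sum>\<eta>\<in>P \<rightarrow>\<^sub>E carrier H. card (fixed_points X P \<eta> \<beta> \<times> fixed_points Y P \<alpha> \<eta>)) =
      card (fixed_pairs H X Y P \<alpha> \<beta>)"
  proof (rule sum_card_unique_cover)
    show "finite (fixed_pairs H X Y P \<alpha> \<beta>)"
      by (rule finite_subset[of _ "points X \<times> points Y"]) (auto simp: fixed_pairs_def)
    show "finite (P \<rightarrow>\<^sub>E carrier H)"
      using P finite_H by (intro finite_PiE)
    show "fixed_points X P \<eta> \<beta> \<times> fixed_points Y P \<alpha> \<eta> \<subseteq> fixed_pairs H X Y P \<alpha> \<beta>"
      if "\<eta> \<in> P \<rightarrow>\<^sub>E carrier H" for \<eta>
      using that by (auto simp: fixed_points_def fixed_pairs_def)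
    fix z assume "z \<in> fixed_pairs H X Y P \<alpha> \<beta>"
    then obtain x y where z: "z = (x, y)" "x \<in> points X" "y \<in> points Y"
      "\<And>q. q \<in> P \<Longrightarrow> \<exists>h\<in>carrier H. ract Y y (\<alpha> q) = lact Y h y \<and> ract X x h = lact X (\<beta> q) x"
      by (auto simp: fixed_pairs_def)
    have "\<exists>!\<eta>. \<eta> \<in> P \<rightarrow>\<^sub>E carrier H \<and> y \<in> fixed_points Y P \<alpha> \<eta>"
      using z(3,4) by (intro Y.ex1_fixed_points_twist) auto
    moreover have "x \<in> fixed_points X P \<eta> \<beta>"
      if "\<eta> \<in> P \<rightarrow>\<^sub>E carrier H" "y \<in> fixed_points Y P \<alpha> \<eta>" for \<eta>
    proof -
      have "ract X x (\<eta> q) = lact X (\<beta> q) x" if "q \<in> P" for q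
      proof -
        obtain h where "h \<in> carrier H" "ract Y y (\<alpha> q) = lact Y h y" "ract X x h = lact X (\<beta> q) x"
          using z(4) \<open>q \<in> P\<close> by blast
        moreover have "ract Y y (\<alpha> q) = lact Y (\<eta> q) y" "\<eta> q \<in> carrier H"
          using \<open>\<eta> \<in> P \<rightarrow>\<^sub>E carrier H\<close> \<open>y \<in> fixed_points Y P \<alpha> \<eta>\<close> \<open>q \<in> P\<close>
          by (auto simp: fixed_points_def)
        ultimately show ?thesis
          using Y.lact_cancel[OF z(3)] by metis
      qed
      then show ?thesis
        using z(2) by (simp add: fixed_points_def)
    qed
    ultimately show "\<exists>!\<eta>. \<eta> \<in> P \<rightarrow>\<^sub>E carrier H \<and> z \<in> fixed_points X P \<eta> \<beta> \<times> fixed_points Y P \<alpha> \<eta>"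
      unfolding z(1) by (metis mem_Sigma_iff)
  qed
  then show ?thesis
    using card_fixed_pairs[OF maps] by (simp add: card_cartesian_product)
qed

end

locale biset_product_isomorphism =
  XY: biset_product G H K X Y + XY': biset_product G H K X' Y'
  for G :: "('g, 'm) monoid_scheme" and H :: "('h, 'n) monoid_scheme" and K :: "('k, 'l) monoid_scheme"
    and X :: "('h, 'k, 'x) biset" and Y :: "('g, 'h, 'y) biset"
    and X' :: "('h, 'k, 'u) biset" and Y' :: "('g, 'h, 'v) biset" +
  fixes f :: "'x \<Rightarrow> 'u" and f' :: "'y \<Rightarrow> 'v"
  assumes bij_f: "bij_betw f (points X) (points X')"
    and f_lact [simp]: "\<lbrakk>x \<in> points X; k \<in> carrier K\<rbrakk> \<Longrightarrow> f (lact X k x) = lact X' k (f x)"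
    and f_ract [simp]: "\<lbrakk>x \<in> points X; h \<in> carrier H\<rbrakk> \<Longrightarrow> f (ract X x h) = ract X' (f x) h"
    and bij_f': "bij_betw f' (points Y) (points Y')"
    and f'_lact [simp]: "\<lbrakk>y \<in> points Y; h \<in> carrier H\<rbrakk> \<Longrightarrow> f' (lact Y h y) = lact Y' h (f' y)"
    and f'_ract [simp]: "\<lbrakk>y \<in> points Y; g \<in> carrier G\<rbrakk> \<Longrightarrow> f' (ract Y y g) = ract Y' (f' y) g"
begin

lemma f_closed [simp]: "x \<in> points X \<Longrightarrow> f x \<in> points X'"
  and f'_closed [simp]: "y \<in> points Y \<Longrightarrow> f' y \<in> points Y'"
  using bij_f bij_f' by (auto simp: bij_betw_def)

lemma map_pair_class [simp]:
  "\<lbrakk>x \<in> points X; y \<in> points Y\<rbrakk> \<Longrightarrow>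
    map_prod f f' ` pair_class H X Y x y = pair_class H X' Y' (f x) (f' y)"
  by (simp add: XY.pair_class_eq_image XY'.pair_class_eq_image image_image)

lemma map_pair_class_eq_iff:
  assumes "x \<in> points X" "y \<in> points Y" "a \<in> points X" "b \<in> points Y"
  shows "pair_class H X' Y' (f x) (f' y) = pair_class H X' Y' (f a) (f' b) \<longleftrightarrow>
    pair_class H X Y x y = pair_class H X Y a b"
proof -
  have "f x = ract X' (f a) h \<and> f' b = lact Y' h (f' y) \<longleftrightarrow> x = ract X a h \<and> b = lact Y h y"
    if "h \<in> carrier H" for h
    using that assms
    by (simp flip: f_ract f'_lact
      add: inj_on_eq_iff[OF bij_betw_imp_inj_on[OF bij_f]]
        inj_on_eq_iff[OF bij_betw_imp_inj_on[OF bij_f']])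
  then show ?thesis
    using assms by (simp add: XY.pair_class_eq_iff XY'.pair_class_eq_iff)
qed

lemma bij_betw_map_points:
  "bij_betw (image (map_prod f f')) (points (biset_prod H X Y)) (points (biset_prod H X' Y'))"
  unfolding bij_betw_def
proof
  show "inj_on (image (map_prod f f')) (points (biset_prod H X Y))"
    by (rule inj_onI) (auto elim!: XY.points_prodE simp only: map_pair_class map_pair_class_eq_iff)
  show "image (map_prod f f') ` points (biset_prod H X Y) = points (biset_prod H X' Y')"
  proof (intro equalityI subsetI)
    show "C \<in> points (biset_prod H X' Y')"
      if "C \<in> image (map_prod f f') ` points (biset_prod H X Y)" for C
      using that by (auto elim!: XY.points_prodE)
    fix C assume "C \<in> points (biset_prod H X' Y')"
    then obtain a b where ab: "a \<in> points X'" "b \<in> points Y'" "C = pair_class H X' Y' a b"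
      by (rule XY'.points_prodE)
    then obtain x y where "x \<in> points X" "y \<in> points Y" "a = f x" "b = f' y"
      using bij_betw_imp_surj_on[OF bij_f] bij_betw_imp_surj_on[OF bij_f'] by blast
    then show "C \<in> image (map_prod f f') ` points (biset_prod H X Y)"
      using ab(3) by (metis XY.pair_class_in_points image_eqI map_pair_class)
  qed
qed

lemma biset_prod_isomorphic: "biset_isomorphic G K (biset_prod H X Y) (biset_prod H X' Y')"
  using bij_betw_map_points
  by (rule biset_isomorphicI) (elim XY.points_prodE; simp)+

end

lemma biset_prod_isomorphicI:
  assumes "biset_product G H K X Y" "biset_product G H K X' Y'"
    and "biset_isomorphic H K X X'" "biset_isomorphic G H Y Y'"
  shows "biset_isomorphic G K (biset_prod H X Y) (biset_prod H X' Y')"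
proof -
  obtain f where f: "bij_betw f (points X) (points X')"
    "\<And>x k. \<lbrakk>x \<in> points X; k \<in> carrier K\<rbrakk> \<Longrightarrow> f (lact X k x) = lact X' k (f x)"
    "\<And>x h. \<lbrakk>x \<in> points X; h \<in> carrier H\<rbrakk> \<Longrightarrow> f (ract X x h) = ract X' (f x) h"
    using assms(3) by (rule biset_isomorphicE) (rule that)
  obtain f' where f': "bij_betw f' (points Y) (points Y')"
    "\<And>y h. \<lbrakk>y \<in> points Y; h \<in> carrier H\<rbrakk> \<Longrightarrow> f' (lact Y h y) = lact Y' h (f' y)"
    "\<And>y g. \<lbrakk>y \<in> points Y; g \<in> carrier G\<rbrakk> \<Longrightarrow> f' (ract Y y g) = ract Y' (f' y) g"
    using assms(4) by (rule biset_isomorphicE) (rule that)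
  interpret biset_product_isomorphism G H K X Y X' Y' f f'
    using assms(1,2) f f'
    by (simp add: biset_product_isomorphism_def biset_product_isomorphism_axioms_def)
  show ?thesis
    by (rule biset_prod_isomorphic)
qed

subsection \<open>Transitive bisets\<close>

definition twisted_biset :: "('h, 'n) monoid_scheme \<Rightarrow> ('g \<Rightarrow> 'h) \<Rightarrow> ('g, 'h, 'h) biset"
  where "twisted_biset H \<phi> =
    \<lparr>points = carrier H, lact = (\<lambda>h x. h \<otimes>\<^bsub>H\<^esub> x), ract = (\<lambda>x k. x \<otimes>\<^bsub>H\<^esub> \<phi> k)\<rparr>"

definition std_point :: "('g, 'm) monoid_scheme \<Rightarrow> ('h, 'n) monoid_scheme \<Rightarrow> 'g set \<Rightarrow> ('g \<Rightarrow> 'h) \<Rightarrow>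
    'h \<Rightarrow> 'g \<Rightarrow> ('h \<times> 'g) set"
  where "std_point G H K \<phi> h g =
    pair_class (sub_group G K) (twisted_biset H \<phi>) (twisted_biset G (\<lambda>x. x)) h g"

definition subconjugate :: "('g, 'm) monoid_scheme \<Rightarrow> ('h, 'n) monoid_scheme \<Rightarrow>
    'g set \<Rightarrow> ('g \<Rightarrow> 'h) \<Rightarrow> 'g set \<Rightarrow> ('g \<Rightarrow> 'h) \<Rightarrow> bool"
  where "subconjugate G H P \<phi> Q \<psi> \<longleftrightarrow> (\<exists>h\<in>carrier H. \<exists>g\<in>carrier G. \<forall>q\<in>P.
    conjugate G g q \<in> Q \<and> \<phi> q = conjugate H h (\<psi> (conjugate G g q)))"

lemma subconjugateE:
  assumes "subconjugate G H P \<phi> Q \<psi>"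
  obtains h g where "h \<in> carrier H" "g \<in> carrier G" "\<And>q. q \<in> P \<Longrightarrow> conjugate G g q \<in> Q"
    and "\<And>q. q \<in> P \<Longrightarrow> \<phi> q = conjugate H h (\<psi> (conjugate G g q))"
  using assms unfolding subconjugate_def by blast

locale finite_group_pair = group_pair G H
  for G :: "('g, 'm) monoid_scheme" and H :: "('h, 'n) monoid_scheme" +
  assumes finite_G [simp]: "finite (carrier G)" and finite_H [simp]: "finite (carrier H)"

locale standard_biset = finite_group_pair G H
  for G :: "('g, 'm) monoid_scheme" and H :: "('h, 'n) monoid_scheme" +
  fixes K :: "'g set" and \<phi> :: "'g \<Rightarrow> 'h"
  assumes subgroup_K: "subgroup K G" and \<phi>_hom: "\<phi> \<in> hom (sub_group G K) H"
begin

sublocale \<phi>: group_hom "sub_group G K" H \<phi>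
  using subgroup_K \<phi>_hom
  by (simp add: group_hom_def group_hom_axioms_def G.subgroup_imp_group)

lemma mem_carrier_K [simp]: "k \<in> K \<Longrightarrow> k \<in> carrier G"
  using subgroup_K by (rule subgroup.mem_carrier)

lemma finite_K [simp]: "finite K"
  by (rule finite_subset[OF _ finite_G]) auto

lemma \<phi>_closed [simp]: "k \<in> K \<Longrightarrow> \<phi> k \<in> carrier H"
  using \<phi>.hom_closed by simp

lemma \<phi>_conjugate: "\<lbrakk>k \<in> K; x \<in> K\<rbrakk> \<Longrightarrow> \<phi> (conjugate G k x) = conjugate H (\<phi> k) (\<phi> x)"
  using \<phi>.hom_conjugate[of k x] by (simp add: G.conjugate_subgroup[OF subgroup_K])

sublocale twisted: biset_product G "sub_group G K" H "twisted_biset H \<phi>" "twisted_biset G (\<lambda>x. x)"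
proof unfold_locales
  show "is_biset (sub_group G K) H (twisted_biset H \<phi>)"
    using \<phi>.hom_mult \<phi>.hom_one by (simp add: is_biset_def twisted_biset_def H.m_assoc)
  show "is_biset G (sub_group G K) (twisted_biset G (\<lambda>x. x))"
    by (simp add: is_biset_def twisted_biset_def G.m_assoc)
qed (auto simp: twisted_biset_def)

lemma std_biset_eq_prod:
  "std_biset G H K \<phi> = biset_prod (sub_group G K) (twisted_biset H \<phi>) (twisted_biset G (\<lambda>x. x))"
proof -
  let ?r = "prod_rel (sub_group G K) (twisted_biset H \<phi>) (twisted_biset G (\<lambda>x. x))"
  have "{((h, k \<otimes>\<^bsub>G\<^esub> g), (h \<otimes>\<^bsub>H\<^esub> \<phi> k, g)) | h k g. h \<in> carrier H \<and> k \<in> K \<and> g \<in> carrier G} = ?r\<inverse>"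
    by (auto simp: prod_rel_def twisted_biset_def)
  also have "\<dots> = ?r"
    using twisted.equiv_prod_rel by (simp add: equiv_def sym_conv_converse_eq)
  finally show ?thesis
    by (simp add: std_biset_def biset_prod_def prod_rel_def twisted_biset_def)
qed

sublocale free_group_biset G H "std_biset G H K \<phi>"
  using twisted.fin_free_biset_prod std_biset_eq_prod by (intro free_group_bisetI) simp

lemma std_point_in_points [simp]:
  "\<lbrakk>h \<in> carrier H; g \<in> carrier G\<rbrakk> \<Longrightarrow> std_point G H K \<phi> h g \<in> points (std_biset G H K \<phi>)"
  using twisted.pair_class_in_points[of h g]
  by (simp add: std_biset_eq_prod std_point_def twisted_biset_def)

lemma std_pointE:
  assumes "x \<in> points (std_biset G H K \<phi>)"
  obtains h g where "h \<in> carrier H" "g \<in> carrier G" "x = std_point G H K \<phi> h g"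
  using assms unfolding std_biset_eq_prod std_point_def
  by (elim twisted.points_prodE) (simp add: twisted_biset_def)

lemma std_point_eq_iff:
  assumes "h \<in> carrier H" "g \<in> carrier G" "h' \<in> carrier H" "g' \<in> carrier G"
  shows "std_point G H K \<phi> h g = std_point G H K \<phi> h' g' \<longleftrightarrow>
    (\<exists>k\<in>K. h = h' \<otimes>\<^bsub>H\<^esub> \<phi> k \<and> g' = k \<otimes>\<^bsub>G\<^esub> g)"
  using twisted.pair_class_eq_iff[of h g h' g'] assms unfolding std_point_def
  by (simp add: twisted_biset_def)

lemma lact_std_point [simp]:
  "\<lbrakk>h \<in> carrier H; g \<in> carrier G; u \<in> carrier H\<rbrakk> \<Longrightarrow>
    lact (std_biset G H K \<phi>) u (std_point G H K \<phi> h g) = std_point G H K \<phi> (u \<otimes>\<^bsub>H\<^esub> h) g"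
  using twisted.lact_pair_class[of h g u]
  by (simp add: std_point_def std_biset_eq_prod twisted_biset_def)

lemma ract_std_point [simp]:
  "\<lbrakk>h \<in> carrier H; g \<in> carrier G; u \<in> carrier G\<rbrakk> \<Longrightarrow>
    ract (std_biset G H K \<phi>) (std_point G H K \<phi> h g) u = std_point G H K \<phi> h (g \<otimes>\<^bsub>G\<^esub> u)"
  using twisted.ract_pair_class[of h g u]
  by (simp add: std_point_def std_biset_eq_prod twisted_biset_def)

lemma card_points_std: "card (points (std_biset G H K \<phi>)) = card (carrier H) * card (rcosets\<^bsub>G\<^esub> K)"
proof -
  let ?pairs = "fixed_pairs (sub_group G K) (twisted_biset H \<phi>) (twisted_biset G (\<lambda>x. x)) {}"
  have "?pairs (\<lambda>x. x) (\<lambda>_. \<one>\<^bsub>H\<^esub>) = carrier H \<times> carrier G"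
    by (auto simp: fixed_pairs_def twisted_biset_def)
  then have "card K * card (points (std_biset G H K \<phi>)) = card (carrier H) * card (carrier G)"
    using twisted.card_fixed_pairs[of "\<lambda>x. x" "{}" "\<lambda>_. \<one>\<^bsub>H\<^esub>"]
    by (simp add: std_biset_eq_prod card_cartesian_product)
  also have "\<dots> = card K * (card (carrier H) * card (rcosets\<^bsub>G\<^esub> K))"
    using G.lagrange[OF subgroup_K] by (simp add: order_def algebra_simps)
  finally show ?thesis
    using subgroup.one_closed[OF subgroup_K] by auto
qed

lemma std_point_ract_eq_lact_iff:
  assumes "h \<in> carrier H" "g \<in> carrier G" "u \<in> carrier G" "v \<in> carrier H"
  shows "ract (std_biset G H K \<phi>) (std_point G H K \<phi> h g) u =
      lact (std_biset G H K \<phi>) v (std_point G H K \<phi> h g) \<longleftrightarrow>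
    conjugate G g u \<in> K \<and> v = conjugate H h (\<phi> (conjugate G g u))"
proof -
  have "ract (std_biset G H K \<phi>) (std_point G H K \<phi> h g) u =
      lact (std_biset G H K \<phi>) v (std_point G H K \<phi> h g) \<longleftrightarrow>
    std_point G H K \<phi> (v \<otimes>\<^bsub>H\<^esub> h) g = std_point G H K \<phi> h (g \<otimes>\<^bsub>G\<^esub> u)"
    using assms by auto
  also have "\<dots> \<longleftrightarrow> (\<exists>k\<in>K. v \<otimes>\<^bsub>H\<^esub> h = h \<otimes>\<^bsub>H\<^esub> \<phi> k \<and> g \<otimes>\<^bsub>G\<^esub> u = k \<otimes>\<^bsub>G\<^esub> g)"
    using assms by (intro std_point_eq_iff) auto
  also have "\<dots> \<longleftrightarrow> (\<exists>k\<in>K. conjugate H h (\<phi> k) = v \<and> conjugate G g u = k)"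
    using assms by (auto simp: G.conjugate_eq_iff_mult H.conjugate_eq_iff_mult intro!: bexI)
  finally show ?thesis
    by auto
qed

lemma std_point_fixed_iff:
  assumes "h \<in> carrier H" "g \<in> carrier G" "P \<subseteq> carrier G" "\<beta> \<in> P \<rightarrow> carrier H"
  shows "std_point G H K \<phi> h g \<in> fixed_points (std_biset G H K \<phi>) P (\<lambda>q. q) \<beta> \<longleftrightarrow>
    (\<forall>q\<in>P. conjugate G g q \<in> K \<and> \<beta> q = conjugate H h (\<phi> (conjugate G g q)))"
proof -
  have "ract (std_biset G H K \<phi>) (std_point G H K \<phi> h g) q =
      lact (std_biset G H K \<phi>) (\<beta> q) (std_point G H K \<phi> h g) \<longleftrightarrow>
    conjugate G g q \<in> K \<and> \<beta> q = conjugate H h (\<phi> (conjugate G g q))" if "q \<in> P" for q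
    using assms that by (intro std_point_ract_eq_lact_iff) auto
  then show ?thesis
    using assms(1,2) by (simp add: fixed_points_def)
qed

lemma fixed_points_nonempty_iff:
  assumes "P \<subseteq> carrier G" "\<beta> \<in> P \<rightarrow> carrier H"
  shows "fixed_points (std_biset G H K \<phi>) P (\<lambda>q. q) \<beta> \<noteq> {} \<longleftrightarrow> subconjugate G H P \<beta> K \<phi>"
proof
  assume "fixed_points (std_biset G H K \<phi>) P (\<lambda>q. q) \<beta> \<noteq> {}"
  then obtain x where x: "x \<in> fixed_points (std_biset G H K \<phi>) P (\<lambda>q. q) \<beta>"
    by blast
  then have "x \<in> points (std_biset G H K \<phi>)"
    by (simp add: fixed_points_def)
  then obtain h g where hg: "h \<in> carrier H" "g \<in> carrier G" "x = std_point G H K \<phi> h g"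
    by (rule std_pointE)
  then show "subconjugate G H P \<beta> K \<phi>"
    unfolding subconjugate_def using x std_point_fixed_iff[OF hg(1,2) assms] by blast
next
  assume "subconjugate G H P \<beta> K \<phi>"
  then show "fixed_points (std_biset G H K \<phi>) P (\<lambda>q. q) \<beta> \<noteq> {}"
    unfolding subconjugate_def using std_point_fixed_iff assms by blast
qed

lemma subconjugate_refl: "subconjugate G H K \<phi> K \<phi>"
  unfolding subconjugate_def by (intro bexI[of _ "\<one>\<^bsub>H\<^esub>"] bexI[of _ "\<one>\<^bsub>G\<^esub>"]) simp_all

lemma biset_orbit_std:
  assumes "x \<in> points (std_biset G H K \<phi>)"
  shows "biset_orbit G H (std_biset G H K \<phi>) x = points (std_biset G H K \<phi>)"
proof
  show "biset_orbit G H (std_biset G H K \<phi>) x \<subseteq> points (std_biset G H K \<phi>)"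
    using invariant_biset_orbit[OF assms] by (simp add: invariant_points_def)
  obtain h g where x: "h \<in> carrier H" "g \<in> carrier G" "x = std_point G H K \<phi> h g"
    using assms by (rule std_pointE)
  show "points (std_biset G H K \<phi>) \<subseteq> biset_orbit G H (std_biset G H K \<phi>) x"
  proof
    fix y assume "y \<in> points (std_biset G H K \<phi>)"
    then obtain h' g' where y: "h' \<in> carrier H" "g' \<in> carrier G" "y = std_point G H K \<phi> h' g'"
      by (rule std_pointE)
    have "y = lact (std_biset G H K \<phi>) (h' \<otimes>\<^bsub>H\<^esub> inv\<^bsub>H\<^esub> h)
      (ract (std_biset G H K \<phi>) x (inv\<^bsub>G\<^esub> g \<otimes>\<^bsub>G\<^esub> g'))"
      using x y by (simp add: H.m_assoc G.m_assoc[symmetric])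
    then show "y \<in> biset_orbit G H (std_biset G H K \<phi>) x"
      unfolding biset_orbit_def using x(1,2) y(1,2) by (auto intro!: exI)
  qed
qed

lemma card_left_orbit_stabilizer_std:
  assumes "x \<in> points (std_biset G H K \<phi>)"
  shows "card (left_orbit_stabilizer G H (std_biset G H K \<phi>) x) \<le> card K"
proof -
  obtain h g where x: "h \<in> carrier H" "g \<in> carrier G" "x = std_point G H K \<phi> h g"
    using assms by (rule std_pointE)
  have "inj_on (conjugate G g) (left_orbit_stabilizer G H (std_biset G H K \<phi>) x)"
    using G.inj_on_conjugate[OF x(2)] by (rule inj_on_subset) (auto simp: left_orbit_stabilizer_def)
  moreover have "conjugate G g ` left_orbit_stabilizer G H (std_biset G H K \<phi>) x \<subseteq> K"
    using x(1,2) std_point_ract_eq_lact_iff unfolding left_orbit_stabilizer_def x(3) by auto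
  ultimately show ?thesis
    using finite_K by (rule card_inj_on_le)
qed

end

locale standard_biset_orbit = standard_biset G H K \<phi> + X: free_group_biset G H X
  for G :: "('g, 'm) monoid_scheme" and H :: "('h, 'n) monoid_scheme" and K \<phi>
    and X :: "('g, 'h, 'x) biset" +
  fixes x :: 'x
  assumes x_fixed: "x \<in> fixed_points X K (\<lambda>k. k) \<phi>"
    and stabilizer_subset: "left_orbit_stabilizer G H X x \<subseteq> K"
begin

lemma x_in_points [simp]: "x \<in> points X"
  using x_fixed by (simp add: fixed_points_def)

lemma ract_eq_lact_iff:
  assumes "u \<in> carrier G" "v \<in> carrier H"
  shows "ract X x u = lact X v x \<longleftrightarrow> u \<in> K \<and> v = \<phi> u"
proof
  assume eq: "ract X x u = lact X v x"
  then have u: "u \<in> K"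
    using assms stabilizer_subset by (auto simp: left_orbit_stabilizer_def)
  then have "lact X v x = lact X (\<phi> u) x"
    using x_fixed eq by (simp add: fixed_points_def)
  then show "u \<in> K \<and> v = \<phi> u"
    using u X.lact_cancel[OF x_in_points assms(2)] by simp
next
  assume "u \<in> K \<and> v = \<phi> u"
  then show "ract X x u = lact X v x"
    using x_fixed by (simp add: fixed_points_def)
qed

lemma translate_eq_iff_std_point_eq:
  assumes "h \<in> carrier H" "g \<in> carrier G" "h' \<in> carrier H" "g' \<in> carrier G"
  shows "lact X h (ract X x g) = lact X h' (ract X x g') \<longleftrightarrow>
    std_point G H K \<phi> h g = std_point G H K \<phi> h' g'"
proof -
  have "lact X h (ract X x g) = lact X h' (ract X x g') \<longleftrightarrow>
      lact X (inv\<^bsub>H\<^esub> h' \<otimes>\<^bsub>H\<^esub> h) x = ract X x (g' \<otimes>\<^bsub>G\<^esub> inv\<^bsub>G\<^esub> g)"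
    using assms by (intro X.lact_ract_eq_iff) simp_all
  also have "\<dots> \<longleftrightarrow> g' \<otimes>\<^bsub>G\<^esub> inv\<^bsub>G\<^esub> g \<in> K \<and> inv\<^bsub>H\<^esub> h' \<otimes>\<^bsub>H\<^esub> h = \<phi> (g' \<otimes>\<^bsub>G\<^esub> inv\<^bsub>G\<^esub> g)"
    using assms ract_eq_lact_iff[of "g' \<otimes>\<^bsub>G\<^esub> inv\<^bsub>G\<^esub> g" "inv\<^bsub>H\<^esub> h' \<otimes>\<^bsub>H\<^esub> h"] by auto
  also have "\<dots> \<longleftrightarrow> (\<exists>k\<in>K. inv\<^bsub>H\<^esub> h' \<otimes>\<^bsub>H\<^esub> h = \<phi> k \<and> g' \<otimes>\<^bsub>G\<^esub> inv\<^bsub>G\<^esub> g = k)"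
    by auto
  also have "\<dots> \<longleftrightarrow> (\<exists>k\<in>K. h = h' \<otimes>\<^bsub>H\<^esub> \<phi> k \<and> g' = k \<otimes>\<^bsub>G\<^esub> g)"
    using assms by (intro bex_cong refl) (simp add: H.inv_solve_left' G.inv_solve_right')
  also have "\<dots> \<longleftrightarrow> std_point G H K \<phi> h g = std_point G H K \<phi> h' g'"
    using assms by (rule std_point_eq_iff[symmetric])
  finally show ?thesis .
qed

definition orbit_map :: "('h \<times> 'g) set \<Rightarrow> 'x"
  where "orbit_map C = (THE y. \<exists>h\<in>carrier H. \<exists>g\<in>carrier G.
    C = std_point G H K \<phi> h g \<and> y = lact X h (ract X x g))"

lemma orbit_map_std_point:
  assumes "h \<in> carrier H" "g \<in> carrier G"
  shows "orbit_map (std_point G H K \<phi> h g) = lact X h (ract X x g)"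
  unfolding orbit_map_def
proof (rule the_equality)
  show "\<exists>h'\<in>carrier H. \<exists>g'\<in>carrier G. std_point G H K \<phi> h g = std_point G H K \<phi> h' g' \<and>
      lact X h (ract X x g) = lact X h' (ract X x g')"
    using assms by blast
  show "y = lact X h (ract X x g)"
    if "\<exists>h'\<in>carrier H. \<exists>g'\<in>carrier G. std_point G H K \<phi> h g = std_point G H K \<phi> h' g' \<and>
      y = lact X h' (ract X x g')" for y
    using that assms translate_eq_iff_std_point_eq by metis
qed

lemma std_biset_isomorphic_orbit:
  "biset_isomorphic G H (std_biset G H K \<phi>) (sub_biset X (biset_orbit G H X x))"
proof (rule biset_isomorphicI[of orbit_map])
  show "bij_betw orbit_map (points (std_biset G H K \<phi>)) (points (sub_biset X (biset_orbit G H X x)))"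
    unfolding bij_betw_def
  proof
    show "inj_on orbit_map (points (std_biset G H K \<phi>))"
      by (rule inj_onI) (auto elim!: std_pointE simp: orbit_map_std_point translate_eq_iff_std_point_eq)
    show "orbit_map ` points (std_biset G H K \<phi>) = points (sub_biset X (biset_orbit G H X x))"
    proof
      show "orbit_map ` points (std_biset G H K \<phi>) \<subseteq> points (sub_biset X (biset_orbit G H X x))"
        by (auto 4 3 elim!: std_pointE simp: orbit_map_std_point biset_orbit_def)
      show "points (sub_biset X (biset_orbit G H X x)) \<subseteq> orbit_map ` points (std_biset G H K \<phi>)"
        by (auto simp: biset_orbit_def orbit_map_std_point[symmetric])
    qed
  qed
qed (auto elim!: std_pointE simp: orbit_map_std_point)

end

lemma (in finite_group_pair) standard_bisetI:
  "\<lbrakk>subgroup K G; \<phi> \<in> hom (sub_group G K) H\<rbrakk> \<Longrightarrow> standard_biset G H K \<phi>"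
  by (intro standard_biset.intro standard_biset_axioms.intro finite_group_pair_axioms)

lemma (in free_group_biset) biset_orbit_isomorphic_std:
  assumes "finite_group_pair G H" "x \<in> points X"
  obtains \<phi> where "standard_biset G H (left_orbit_stabilizer G H X x) \<phi>"
    and "biset_isomorphic G H (std_biset G H (left_orbit_stabilizer G H X x) \<phi>)
      (sub_biset X (biset_orbit G H X x))"
proof -
  let ?K = "left_orbit_stabilizer G H X x"
  obtain \<phi> where \<phi>: "\<phi> \<in> ?K \<rightarrow>\<^sub>E carrier H" "x \<in> fixed_points X ?K (\<lambda>k. k) \<phi>"
    using ex1_fixed_points_twist[OF assms(2), of ?K "\<lambda>k. k"] by (auto simp: left_orbit_stabilizer_def)
  interpret finite_group_pair G H by fact
  interpret standard_biset G H ?K \<phi>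
    using subgroup_left_orbit_stabilizer[OF assms(2)] \<phi>
    by (intro standard_bisetI hom_of_fixed_point[of ?K \<phi> x]) auto
  interpret standard_biset_orbit G H ?K \<phi> X x
    using \<phi>(2) by unfold_locales simp_all
  show ?thesis
    using that standard_biset_axioms std_biset_isomorphic_orbit by blast
qed

lemma (in free_group_biset) card_biset_orbit:
  assumes "finite_group_pair G H" "x \<in> points X"
  shows "card (biset_orbit G H X x) =
    card (carrier H) * card (rcosets\<^bsub>G\<^esub> (left_orbit_stabilizer G H X x))"
proof -
  obtain \<phi> where \<phi>: "standard_biset G H (left_orbit_stabilizer G H X x) \<phi>"
    "biset_isomorphic G H (std_biset G H (left_orbit_stabilizer G H X x) \<phi>)
      (sub_biset X (biset_orbit G H X x))"
    using assms by (rule biset_orbit_isomorphic_std)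
  then have "card (points (std_biset G H (left_orbit_stabilizer G H X x) \<phi>)) =
    card (biset_orbit G H X x)"
    by (auto simp: biset_isomorphic_def dest: bij_betw_same_card)
  then show ?thesis
    using standard_biset.card_points_std[OF \<phi>(1)] by simp
qed

lemma (in free_group_biset) card_left_dvd_card_points:
  assumes "finite_group_pair G H"
  shows "card (carrier H) dvd card (points X)"
proof (rule dvd_card_invariant_points)
  show "invariant_points G H X (points X)"
    by (simp add: invariant_points_def)
  show "card (carrier H) dvd card (biset_orbit G H X x)" if "x \<in> points X" for x
    using card_biset_orbit[OF assms that] by simp
qed simp

text \<open>The fixed point congruence for the action of the \<open>p\<close>-group \<open>G\<close> on the left orbits.\<close>

lemma (in free_group_biset) card_not_left_fixed_dvd:
  assumes "finite_group_pair G H" "prime p" "card (carrier G) = p ^ n"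
  shows "p * card (carrier H) dvd card (points X - left_fixed_points G H X)"
proof (rule dvd_card_invariant_points)
  show "invariant_points G H X (points X - left_fixed_points G H X)"
    using invariant_left_fixed_points by (rule invariant_points_Diff)
  fix x assume "x \<in> points X - left_fixed_points G H X"
  then have x: "x \<in> points X" and proper: "left_orbit_stabilizer G H X x \<noteq> carrier G"
    by (auto simp: left_fixed_points_iff)
  let ?K = "left_orbit_stabilizer G H X x"
  have K: "subgroup ?K G"
    using x by (rule subgroup_left_orbit_stabilizer)
  have index: "card (rcosets\<^bsub>G\<^esub> ?K) * card ?K = p ^ n"
    using G.lagrange[OF K] assms(3) by (simp add: order_def)
  then obtain j where j: "card (rcosets\<^bsub>G\<^esub> ?K) = p ^ j"
    using assms(2) by (metis divides_primepow_nat dvd_triv_left)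
  have "j \<noteq> 0"
  proof
    assume "j = 0"
    then have "card ?K = card (carrier G)"
      using index j assms(3) by simp
    then have "?K = carrier G"
      using subgroup.subset[OF K] finite_group_pair.finite_G[OF assms(1)] by (intro card_subset_eq)
    then show False
      using proper by simp
  qed
  then have "p dvd card (rcosets\<^bsub>G\<^esub> ?K)"
    using j by simp
  then show "p * card (carrier H) dvd card (biset_orbit G H X x)"
    using card_biset_orbit[OF assms(1) x] by (simp add: mult.commute[of p] mult_dvd_mono)
qed simp

lemma std_biset_isomorphic_of_subconjugate:
  assumes "standard_biset G H P \<phi>" "standard_biset G H Q \<psi>"
    and "subconjugate G H P \<phi> Q \<psi>" "card Q \<le> card P"
  shows "biset_isomorphic G H (std_biset G H P \<phi>) (std_biset G H Q \<psi>)"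
proof -
  interpret P: standard_biset G H P \<phi> by fact
  interpret Q: standard_biset G H Q \<psi> by fact
  let ?X = "std_biset G H Q \<psi>"
  obtain x where x: "x \<in> fixed_points ?X P (\<lambda>k. k) \<phi>"
    using assms(3) Q.fixed_points_nonempty_iff[of P \<phi>] by (auto simp: subset_iff)
  then have xX: "x \<in> points ?X"
    by (simp add: fixed_points_def)
  have "P \<subseteq> left_orbit_stabilizer G H ?X x"
    using x by (auto simp: fixed_points_def left_orbit_stabilizer_def)
  moreover have "card (left_orbit_stabilizer G H ?X x) \<le> card P"
    using Q.card_left_orbit_stabilizer_std[OF xX] assms(4) by simp
  ultimately have "P = left_orbit_stabilizer G H ?X x"
    using P.finite_G by (intro card_seteq) (auto simp: left_orbit_stabilizer_def)
  then interpret orbit: standard_biset_orbit G H P \<phi> ?X x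
    using x by unfold_locales auto
  show ?thesis
    using orbit.std_biset_isomorphic_orbit by (simp add: Q.biset_orbit_std[OF xX])
qed

section \<open>Burnside modules\<close>

subsection \<open>Linear extension to formal combinations\<close>

definition lin_ext :: "('c \<Rightarrow> rat) \<Rightarrow> ('c \<Rightarrow>\<^sub>0 rat) \<Rightarrow> rat"
  where "lin_ext f x = (\<Sum>c\<in>Poly_Mapping.keys x. Poly_Mapping.lookup x c * f c)"

lemma lin_ext_superset:
  assumes "finite A" "Poly_Mapping.keys x \<subseteq> A"
  shows "lin_ext f x = (\<Sum>c\<in>A. Poly_Mapping.lookup x c * f c)"
  unfolding lin_ext_def using assms by (intro sum.mono_neutral_left) (auto simp: in_keys_iff)

lemma lin_ext_zero [simp]: "lin_ext f 0 = 0"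
  by (simp add: lin_ext_def)

lemma lin_ext_single [simp]: "lin_ext f (Poly_Mapping.single c r) = r * f c"
  by (simp add: lin_ext_def)

lemma lin_ext_add: "lin_ext f (x + y) = lin_ext f x + lin_ext f y"
proof -
  let ?A = "Poly_Mapping.keys x \<union> Poly_Mapping.keys y"
  have "lin_ext f (x + y) = (\<Sum>c\<in>?A. Poly_Mapping.lookup (x + y) c * f c)"
    using keys_add[of x y] by (intro lin_ext_superset) auto
  then show ?thesis
    by (simp add: lin_ext_superset[of ?A x] lin_ext_superset[of ?A y]
      lookup_add distrib_right sum.distrib)
qed

lemma lin_ext_diff: "lin_ext f (x - y) = lin_ext f x - lin_ext f y"
  using lin_ext_add[of f "x - y" y] by simp

lemma lin_ext_sum: "lin_ext f (\<Sum>i\<in>I. x i) = (\<Sum>i\<in>I. lin_ext f (x i))"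
  by (induction I rule: infinite_finite_induct) (auto simp: lin_ext_add)

lemma lookup_scale [simp]: "Poly_Mapping.lookup (Poly_Mapping.map ((*) r) x) c =
  r * Poly_Mapping.lookup x c"
  for r :: rat
  by (cases "Poly_Mapping.lookup x c = 0") (simp_all add: Poly_Mapping.map.rep_eq)

lemma keys_scale: "Poly_Mapping.keys (Poly_Mapping.map ((*) r) x) \<subseteq> Poly_Mapping.keys x"
  for r :: rat
  by (auto simp: in_keys_iff)

lemma lin_ext_scale: "lin_ext f (Poly_Mapping.map ((*) r) x) = r * lin_ext f x"
  using lin_ext_superset[OF _ keys_scale, of x f r]
  by (simp add: sum_distrib_left mult.assoc lin_ext_def)

lemma lin_ext_cong: "(\<And>c. c \<in> Poly_Mapping.keys x \<Longrightarrow> f c = g c) \<Longrightarrow> lin_ext f x = lin_ext g x"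
  by (simp add: lin_ext_def)

lemma lin_ext_fun_add: "lin_ext (\<lambda>c. f c + g c) x = lin_ext f x + lin_ext g x"
  by (simp add: lin_ext_def distrib_left sum.distrib)

lemma lin_ext_fun_sum: "lin_ext (\<lambda>c. \<Sum>i\<in>I. f i c) x = (\<Sum>i\<in>I. lin_ext (f i) x)"
  unfolding lin_ext_def sum_distrib_left by (rule sum.swap)

lemma lin_ext_fun_mult_left: "lin_ext (\<lambda>c. a * f c) x = a * lin_ext f x"
  by (simp add: lin_ext_def sum_distrib_left mult.left_commute)

lemma lin_ext_fun_mult_right: "lin_ext (\<lambda>c. f c * a) x = lin_ext f x * a"
  by (simp add: lin_ext_def sum_distrib_right mult.assoc)

subsection \<open>Local integers\<close>

context
  fixes p :: nat
  assumes p: "prime p"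
begin

lemma Z_loc_of_int: "of_int a \<in> Z_loc p"
proof -
  have "\<not> int p dvd 1"
    using p not_prime_1 by auto
  then have "of_int a / of_int 1 \<in> Z_loc p"
    unfolding Z_loc_def by blast
  then show ?thesis
    by simp
qed

lemma Z_loc_of_nat: "of_nat a \<in> Z_loc p"
  using Z_loc_of_int[of "int a"] by simp

lemma Z_loc_0: "0 \<in> Z_loc p" and Z_loc_1: "1 \<in> Z_loc p"
  using Z_loc_of_int[of 0] Z_loc_of_int[of 1] by simp_all

lemma
  assumes "x \<in> Z_loc p" "y \<in> Z_loc p"
  shows Z_loc_add: "x + y \<in> Z_loc p" and Z_loc_mult: "x * y \<in> Z_loc p"
proof -
  obtain a b c d where x: "x = of_int a / of_int b" "\<not> int p dvd b"
    and y: "y = of_int c / of_int d" "\<not> int p dvd d"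
    using assms unfolding Z_loc_def by auto
  have "\<not> int p dvd b * d"
    using p x(2) y(2) by (simp add: prime_dvd_mult_iff)
  moreover have "b \<noteq> 0" "d \<noteq> 0"
    using x(2) y(2) by auto
  then have "x + y = of_int (a * d + c * b) / of_int (b * d)" "x * y = of_int (a * c) / of_int (b * d)"
    using x(1) y(1) by (simp_all add: field_simps)
  ultimately show "x + y \<in> Z_loc p" "x * y \<in> Z_loc p"
    unfolding Z_loc_def by blast+
qed

lemma Z_loc_uminus: "x \<in> Z_loc p \<Longrightarrow> - x \<in> Z_loc p"
  using Z_loc_mult[OF Z_loc_of_int[of "-1"]] by simp

lemma Z_loc_sum: "(\<And>i. i \<in> I \<Longrightarrow> f i \<in> Z_loc p) \<Longrightarrow> sum f I \<in> Z_loc p"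
  by (induction I rule: infinite_finite_induct) (auto simp: Z_loc_0 intro: Z_loc_add)

end

subsection \<open>Additive invariants and marks\<close>

definition additive_on ::
    "('g, 'm) monoid_scheme \<Rightarrow> ('h, 'n) monoid_scheme \<Rightarrow> (('g, 'h) biset_class \<Rightarrow> rat) \<Rightarrow> bool"
  where "additive_on G H f \<longleftrightarrow> (\<forall>(X :: ('g, 'h, nat) biset) (Y :: ('g, 'h, nat) biset).
    fin_free_biset G H X \<longrightarrow> fin_free_biset G H Y \<longrightarrow>
    f (iso_class G H (biset_sum X Y)) = f (iso_class G H X) + f (iso_class G H Y))"

definition mark :: "('g, 'h) biset_class \<Rightarrow> 'q set \<Rightarrow> ('q \<Rightarrow> 'g) \<Rightarrow> ('q \<Rightarrow> 'h) \<Rightarrow> rat"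
  where "mark c P \<alpha> \<beta> = of_nat (card (fixed_points (SOME Y. Y \<in> c) P \<alpha> \<beta>))"

lemma mark_cong:
  "\<lbrakk>\<And>q. q \<in> P \<Longrightarrow> \<alpha> q = \<alpha>' q; \<And>q. q \<in> P \<Longrightarrow> \<beta> q = \<beta>' q\<rbrakk> \<Longrightarrow> mark c P \<alpha> \<beta> = mark c P \<alpha>' \<beta>'"
  unfolding mark_def
  by (intro arg_cong[where f = of_nat] arg_cong[where f = card] fixed_points_cong)

lemma (in free_group_biset) mark_iso_class:
  assumes "\<alpha> \<in> P \<rightarrow> carrier G" "\<beta> \<in> P \<rightarrow> carrier H"
  shows "mark (iso_class G H X) P \<alpha> \<beta> = of_nat (card (fixed_points X P \<alpha> \<beta>))"
proof -
  have "(SOME Y. Y \<in> iso_class G H X) \<in> iso_class G H X"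
    using iso_class_nonempty by (simp add: some_in_eq)
  then have "biset_isomorphic G H X (SOME Y. Y \<in> iso_class G H X)"
    by (simp add: iso_class_def)
  from card_fixed_points_isomorphic[OF this assms] show ?thesis
    by (simp add: mark_def)
qed

context group_pair
begin

lemma additive_onD:
  fixes X :: "('g, 'h, 'x) biset" and Y :: "('g, 'h, 'y) biset"
  assumes f: "additive_on G H f" and "free_group_biset G H X" "free_group_biset G H Y"
  shows "f (iso_class G H (biset_sum X Y)) = f (iso_class G H X) + f (iso_class G H Y)"
proof -
  interpret X: free_group_biset G H X by fact
  interpret Y: free_group_biset G H Y by fact
  obtain X' :: "('g, 'h, nat) biset" where X': "fin_free_biset G H X'" "biset_isomorphic G H X X'"
    by (rule X.nat_representative)
  obtain Y' :: "('g, 'h, nat) biset" where Y': "fin_free_biset G H Y'" "biset_isomorphic G H Y Y'"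
    by (rule Y.nat_representative)
  interpret XY: free_group_biset G H "biset_sum X Y"
    by (intro free_group_bisetI fin_free_biset_sum X.fin_free_biset Y.fin_free_biset)
  have "f (iso_class G H (biset_sum X' Y')) = f (iso_class G H X') + f (iso_class G H Y')"
    using f X'(1) Y'(1) by (simp add: additive_on_def)
  then show ?thesis
    using X.iso_class_eqI[OF X'(2)] Y.iso_class_eqI[OF Y'(2)]
      XY.iso_class_eqI[OF biset_sum_isomorphic[OF X'(2) Y'(2)]] by simp
qed

lemma additive_on_empty:
  assumes f: "additive_on G H f" and "free_group_biset G H X" "points X = {}"
  shows "f (iso_class G H X) = 0"
proof -
  interpret free_group_biset G H X by fact
  have "biset_isomorphic G H X (biset_sum X X)"
    using assms(3) by (intro biset_isomorphicI[of Inl]) (auto simp: bij_betw_def biset_sum_def)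
  then show ?thesis
    using additive_onD[OF f assms(2,2)] iso_class_eqI[of "biset_sum X X"] by simp
qed

lemma additive_on_split:
  assumes f: "additive_on G H f" and X: "free_group_biset G H X" and A: "invariant_points G H X A"
  shows "f (iso_class G H X) =
    f (iso_class G H (sub_biset X A)) + f (iso_class G H (sub_biset X (points X - A)))"
proof -
  interpret free_group_biset G H X by fact
  have "free_group_biset G H (sub_biset X A)" "free_group_biset G H (sub_biset X (points X - A))"
    using A invariant_points_Diff[OF A] by (simp_all add: free_group_bisetI fin_free_sub_biset)
  then show ?thesis
    using additive_onD[OF f] iso_class_eqI[OF biset_isomorphic_split[OF A]] by simp
qed

lemma additive_on_mark:
  assumes "\<alpha> \<in> P \<rightarrow> carrier G" "\<beta> \<in> P \<rightarrow> carrier H"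
  shows "additive_on G H (\<lambda>c. mark c P \<alpha> \<beta>)"
  unfolding additive_on_def
proof (intro allI impI)
  fix X Y :: "('g, 'h, nat) biset"
  assume "fin_free_biset G H X" "fin_free_biset G H Y"
  then interpret X: free_group_biset G H X + Y: free_group_biset G H Y
    + XY: free_group_biset G H "biset_sum X Y"
    by (simp_all add: free_group_bisetI fin_free_biset_sum)
  show "mark (iso_class G H (biset_sum X Y)) P \<alpha> \<beta> =
      mark (iso_class G H X) P \<alpha> \<beta> + mark (iso_class G H Y) P \<alpha> \<beta>"
    using assms by (simp add: X.mark_iso_class Y.mark_iso_class XY.mark_iso_class card_fixed_points_sum)
qed

lemma mark_conjugate:
  assumes "c \<in> iso_classes G H" and maps: "\<alpha> \<in> P \<rightarrow> carrier G" "\<beta> \<in> P \<rightarrow> carrier H"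
    and gh: "g \<in> carrier G" "h \<in> carrier H"
  shows "mark c P (\<lambda>q. conjugate G g (\<alpha> q)) (\<lambda>q. conjugate H h (\<beta> q)) = mark c P \<alpha> \<beta>"
proof -
  obtain X :: "('g, 'h, nat) biset" where X: "free_group_biset G H X" "c = iso_class G H X"
    using assms(1) by (rule iso_classesE)
  interpret free_group_biset G H X by fact
  have "(\<lambda>q. conjugate G g (\<alpha> q)) \<in> P \<rightarrow> carrier G" "(\<lambda>q. conjugate H h (\<beta> q)) \<in> P \<rightarrow> carrier H"
    using maps gh by (simp_all add: Pi_iff)
  then show ?thesis
    using maps gh by (simp add: X(2) mark_iso_class card_fixed_points_conjugate)
qed

end

lemma (in finite_group_pair) additive_on_eqI:
  assumes f: "additive_on G H f" and f': "additive_on G H f'"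
    and std: "\<And>K \<phi>. standard_biset G H K \<phi> \<Longrightarrow>
      f (iso_class G H (std_biset G H K \<phi>)) = f' (iso_class G H (std_biset G H K \<phi>))"
    and "c \<in> iso_classes G H"
  shows "f c = f' c"
proof -
  have "f (iso_class G H X) = f' (iso_class G H X)" if "free_group_biset G H X"
    for X :: "('g, 'h, nat) biset"
    using that
  proof (induction "card (points X)" arbitrary: X rule: less_induct)
    case less
    interpret free_group_biset G H X by fact
    show ?case
    proof (cases "points X = {}")
      case True
      then show ?thesis
        using additive_on_empty[OF f less.prems] additive_on_empty[OF f' less.prems] by simp
    next
      case False
      then obtain x where x: "x \<in> points X"
        by blast
      let ?O = "biset_orbit G H X x"
      let ?R = "sub_biset X (points X - ?O)"
      note orbit = invariant_biset_orbit[OF x]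
      obtain \<phi> where \<phi>: "standard_biset G H (left_orbit_stabilizer G H X x) \<phi>"
        "biset_isomorphic G H (std_biset G H (left_orbit_stabilizer G H X x) \<phi>) (sub_biset X ?O)"
        using finite_group_pair_axioms x by (rule biset_orbit_isomorphic_std)
      interpret K: standard_biset G H "left_orbit_stabilizer G H X x" \<phi>
        by (rule \<phi>(1))
      have "f (iso_class G H (sub_biset X ?O)) = f' (iso_class G H (sub_biset X ?O))"
        using std[OF \<phi>(1)] K.iso_class_eqI[OF \<phi>(2)] by simp
      moreover have "card (points ?R) < card (points X)"
        using x mem_biset_orbit_self[OF x] by (auto intro: psubset_card_mono)
      then have "f (iso_class G H ?R) = f' (iso_class G H ?R)"
        using invariant_points_Diff[OF orbit]
        by (intro less.hyps free_group_bisetI fin_free_sub_biset)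
      ultimately show ?thesis
        using additive_on_split[OF f less.prems orbit] additive_on_split[OF f' less.prems orbit] by simp
    qed
  qed
  then show ?thesis
    using assms(4) iso_classesE by metis
qed

subsection \<open>The module\<close>

locale burnside_module = group_pair G H
  for G :: "('g, 'm) monoid_scheme" and H :: "('h, 'n) monoid_scheme" +
  fixes p :: nat
  assumes p: "prime p"
begin

lemma formal_combs_zero [simp]: "0 \<in> formal_combs p G H"
  by (simp add: formal_combs_def Z_loc_0[OF p])

lemma formal_combs_single:
  "\<lbrakk>c \<in> iso_classes G H; r \<in> Z_loc p\<rbrakk> \<Longrightarrow> Poly_Mapping.single c r \<in> formal_combs p G H"
  by (simp add: formal_combs_def lookup_single when_def Z_loc_0[OF p])

lemma formal_combs_add:
  "\<lbrakk>x \<in> formal_combs p G H; y \<in> formal_combs p G H\<rbrakk> \<Longrightarrow> x + y \<in> formal_combs p G H"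
  using keys_add[of x y] by (auto simp: formal_combs_def lookup_add Z_loc_add[OF p])

lemma formal_combs_scale:
  "\<lbrakk>x \<in> formal_combs p G H; r \<in> Z_loc p\<rbrakk> \<Longrightarrow> Poly_Mapping.map ((*) r) x \<in> formal_combs p G H"
  using keys_scale[of r x] by (auto simp: formal_combs_def Z_loc_mult[OF p])

lemma formal_combs_sum:
  "(\<And>i. i \<in> I \<Longrightarrow> x i \<in> formal_combs p G H) \<Longrightarrow> (\<Sum>i\<in>I. x i) \<in> formal_combs p G H"
  by (induction I rule: infinite_finite_induct) (auto simp: formal_combs_add)

lemma sum_relations_add:
  assumes "z \<in> sum_relations p G H" "z' \<in> sum_relations p G H"
  shows "z + z' \<in> sum_relations p G H"
  using assms(2)
proof induction
  case (add z'' r X Y)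
  from sum_relations.add[OF add.IH add.hyps(2-4)] show ?case
    by (simp only: add.assoc)
qed (simp add: assms(1))

lemma sum_relations_scale:
  assumes "z \<in> sum_relations p G H" "r \<in> Z_loc p"
  shows "Poly_Mapping.map ((*) r) z \<in> sum_relations p G H"
  using assms(1)
proof induction
  case zero
  have "Poly_Mapping.map ((*) r) 0 = (0 :: ('g, 'h) biset_class \<Rightarrow>\<^sub>0 rat)"
    by (rule poly_mapping_eqI) simp
  then show ?case
    by (simp add: sum_relations.zero)
next
  case (add z s X Y)
  have "Poly_Mapping.map ((*) r) (z + (Poly_Mapping.single (iso_class G H (biset_sum X Y)) s
      - Poly_Mapping.single (iso_class G H X) s - Poly_Mapping.single (iso_class G H Y) s)) =
    Poly_Mapping.map ((*) r) z + (Poly_Mapping.single (iso_class G H (biset_sum X Y)) (r * s)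
      - Poly_Mapping.single (iso_class G H X) (r * s) - Poly_Mapping.single (iso_class G H Y) (r * s))"
    by (rule poly_mapping_eqI) (simp add: lookup_add lookup_minus lookup_single when_def algebra_simps)
  then show ?case
    using sum_relations.add[OF add.IH Z_loc_mult[OF p assms(2) add.hyps(2)] add.hyps(3,4)] by simp
qed

lemma equiv_burnside_rel: "equiv (formal_combs p G H) (burnside_rel p G H)"
proof (rule equivI)
  show "burnside_rel p G H \<subseteq> formal_combs p G H \<times> formal_combs p G H"
    by (auto simp: burnside_rel_def)
  show "refl_on (formal_combs p G H) (burnside_rel p G H)"
    by (rule refl_onI) (simp add: burnside_rel_def sum_relations.zero)
  show "sym (burnside_rel p G H)"
  proof (rule symI)
    fix x y assume xy: "(x, y) \<in> burnside_rel p G H"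
    have "Poly_Mapping.map ((*) (- 1)) (x - y) = y - x"
      by (rule poly_mapping_eqI) (simp add: lookup_minus)
    then have "y - x \<in> sum_relations p G H"
      using xy sum_relations_scale[of "x - y" "- 1"] Z_loc_uminus[OF p Z_loc_1[OF p]]
      by (simp add: burnside_rel_def)
    then show "(y, x) \<in> burnside_rel p G H"
      using xy by (simp add: burnside_rel_def)
  qed
  show "trans (burnside_rel p G H)"
  proof (rule transI)
    fix x y z assume "(x, y) \<in> burnside_rel p G H" "(y, z) \<in> burnside_rel p G H"
    then show "(x, z) \<in> burnside_rel p G H"
      using sum_relations_add[of "x - y" "y - z"] by (simp add: burnside_rel_def)
  qed
qed

lemma b_class_eqI:
  "\<lbrakk>x \<in> formal_combs p G H; y \<in> formal_combs p G H; x - y \<in> sum_relations p G H\<rbrakk> \<Longrightarrow>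
    b_class p G H x = b_class p G H y"
  unfolding b_class_def
  by (rule equiv_class_eq[OF equiv_burnside_rel]) (simp add: burnside_rel_def)

lemma b_class_self: "x \<in> formal_combs p G H \<Longrightarrow> x \<in> b_class p G H x"
  unfolding b_class_def by (rule equiv_class_self[OF equiv_burnside_rel])

lemma b_class_in_burnside: "x \<in> formal_combs p G H \<Longrightarrow> b_class p G H x \<in> burnside p G H"
  unfolding burnside_def b_class_def by (rule quotientI)

lemma burnsideE:
  assumes "X \<in> burnside p G H"
  obtains x where "x \<in> formal_combs p G H" "X = b_class p G H x"
  using assms unfolding burnside_def b_class_def by (elim quotientE)

lemma burnside_nonempty: "X \<in> burnside p G H \<Longrightarrow> X \<noteq> {}"
  using b_class_self by (auto elim!: burnsideE)

lemma burnside_formal_combs: "\<lbrakk>X \<in> burnside p G H; x \<in> X\<rbrakk> \<Longrightarrow> x \<in> formal_combs p G H"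
  by (auto elim!: burnsideE simp: b_class_def burnside_rel_def)

lemma keys_burnside: "\<lbrakk>X \<in> burnside p G H; x \<in> X\<rbrakk> \<Longrightarrow> Poly_Mapping.keys x \<subseteq> iso_classes G H"
  by (drule (1) burnside_formal_combs) (simp add: formal_combs_def)

lemma b_add_b_class:
  assumes "x \<in> formal_combs p G H" "y \<in> formal_combs p G H"
  shows "b_add p G H (b_class p G H x) (b_class p G H y) = b_class p G H (x + y)"
proof -
  have "(\<lambda>x y. b_class p G H (x + y)) respects2 burnside_rel p G H"
  proof (rule congruent2I')
    fix x x' y y' assume "(x, x') \<in> burnside_rel p G H" "(y, y') \<in> burnside_rel p G H"
    then show "b_class p G H (x + y) = b_class p G H (x' + y')"
      using sum_relations_add[of "x - x'" "y - y'"]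
      by (intro b_class_eqI) (auto simp: burnside_rel_def formal_combs_add algebra_simps)
  qed
  then show ?thesis
    unfolding b_add_def using UN_equiv_class2[OF equiv_burnside_rel equiv_burnside_rel _ assms]
    by (simp add: b_class_def)
qed

lemma b_smult_b_class:
  assumes "x \<in> formal_combs p G H" "r \<in> Z_loc p"
  shows "b_smult p G H r (b_class p G H x) = b_class p G H (Poly_Mapping.map ((*) r) x)"
proof -
  have "(\<lambda>x. b_class p G H (Poly_Mapping.map ((*) r) x)) respects burnside_rel p G H"
  proof (rule congruentI)
    fix x x' assume xx': "(x, x') \<in> burnside_rel p G H"
    have "Poly_Mapping.map ((*) r) (x - x') = Poly_Mapping.map ((*) r) x - Poly_Mapping.map ((*) r) x'"
      by (rule poly_mapping_eqI) (simp add: lookup_minus algebra_simps)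
    then show "b_class p G H (Poly_Mapping.map ((*) r) x) = b_class p G H (Poly_Mapping.map ((*) r) x')"
      using xx' sum_relations_scale[of "x - x'", OF _ assms(2)] assms(2)
      by (intro b_class_eqI) (auto simp: burnside_rel_def formal_combs_scale)
  qed
  then show ?thesis
    unfolding b_smult_def using UN_equiv_class[OF equiv_burnside_rel _ assms(1)]
    by (simp add: b_class_def)
qed

lemma lin_ext_sum_relations:
  assumes "additive_on G H f" "z \<in> sum_relations p G H"
  shows "lin_ext f z = 0"
  using assms(2)
proof induction
  case (add z r X Y)
  then have "f (iso_class G H (biset_sum X Y)) = f (iso_class G H X) + f (iso_class G H Y)"
    using assms(1) unfolding additive_on_def by blast
  then show ?case
    using add.IH by (simp add: lin_ext_add lin_ext_diff distrib_left)
qed simp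

lemma lin_ext_b_class:
  assumes "additive_on G H f" "y \<in> b_class p G H x"
  shows "lin_ext f y = lin_ext f x"
  using lin_ext_sum_relations[OF assms(1), of "x - y"] assms(2)
  by (simp add: b_class_def burnside_rel_def lin_ext_diff)

end

definition b_lin_ext :: "(('g, 'h) biset_class \<Rightarrow> rat) \<Rightarrow> ('g, 'h) burnside_elt \<Rightarrow> rat"
  where "b_lin_ext f X = lin_ext f (SOME x. x \<in> X)"

abbreviation b_mark :: "('g, 'h) burnside_elt \<Rightarrow> 'q set \<Rightarrow> ('q \<Rightarrow> 'g) \<Rightarrow> ('q \<Rightarrow> 'h) \<Rightarrow> rat"
  where "b_mark X P \<alpha> \<beta> \<equiv> b_lin_ext (\<lambda>c. mark c P \<alpha> \<beta>) X"

lemma b_mark_cong: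
  "\<lbrakk>\<And>q. q \<in> P \<Longrightarrow> \<alpha> q = \<alpha>' q; \<And>q. q \<in> P \<Longrightarrow> \<beta> q = \<beta>' q\<rbrakk> \<Longrightarrow> b_mark X P \<alpha> \<beta> = b_mark X P \<alpha>' \<beta>'"
  using mark_cong[of P \<alpha> \<alpha>' \<beta> \<beta>'] by simp

context burnside_module
begin

lemma b_lin_ext_eq:
  assumes "additive_on G H f" "X \<in> burnside p G H" "x \<in> X"
  shows "b_lin_ext f X = lin_ext f x"
proof -
  obtain y where y: "y \<in> formal_combs p G H" "X = b_class p G H y"
    using assms(2) by (rule burnsideE)
  have "(SOME x. x \<in> X) \<in> X"
    using assms(3) by (rule someI)
  then show ?thesis
    using lin_ext_b_class[OF assms(1)] assms(3) y(2) by (simp add: b_lin_ext_def)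
qed

lemma b_lin_ext_b_class:
  "\<lbrakk>additive_on G H f; x \<in> formal_combs p G H\<rbrakk> \<Longrightarrow> b_lin_ext f (b_class p G H x) = lin_ext f x"
  using b_lin_ext_eq b_class_in_burnside b_class_self by blast

lemma b_lin_ext_cong:
  assumes "X \<in> burnside p G H" "\<And>c. c \<in> iso_classes G H \<Longrightarrow> f c = g c"
  shows "b_lin_ext f X = b_lin_ext g X"
proof -
  have "(SOME x. x \<in> X) \<in> X"
    using burnside_nonempty[OF assms(1)] by (simp add: some_in_eq)
  then show ?thesis
    unfolding b_lin_ext_def using keys_burnside[OF assms(1)] assms(2) by (intro lin_ext_cong) auto
qed

lemma b_mark_conjugate_right:
  assumes X: "X \<in> burnside p G H" and maps: "\<alpha> \<in> P \<rightarrow> carrier G" "\<beta> \<in> P \<rightarrow> carrier H"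
    and g: "g \<in> carrier G"
  shows "b_mark X P (\<lambda>q\<in>P. conjugate G g (\<alpha> q)) \<beta> = b_mark X P \<alpha> \<beta>"
proof -
  have "b_mark X P (\<lambda>q\<in>P. conjugate G g (\<alpha> q)) \<beta> =
      b_mark X P (\<lambda>q. conjugate G g (\<alpha> q)) (\<lambda>q. conjugate H \<one>\<^bsub>H\<^esub> (\<beta> q))"
    using maps(2) by (intro b_mark_cong) (auto simp: Pi_iff)
  also have "\<dots> = b_mark X P \<alpha> \<beta>"
    using X by (rule b_lin_ext_cong) (rule mark_conjugate[OF _ maps g H.one_closed])
  finally show ?thesis .
qed

lemma b_mark_conjugate_left:
  assumes X: "X \<in> burnside p G H" and maps: "\<alpha> \<in> P \<rightarrow> carrier G" "\<beta> \<in> P \<rightarrow> carrier H"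
    and h: "h \<in> carrier H"
  shows "b_mark X P \<alpha> (\<lambda>q\<in>P. conjugate H h (\<beta> q)) = b_mark X P \<alpha> \<beta>"
proof -
  have "b_mark X P \<alpha> (\<lambda>q\<in>P. conjugate H h (\<beta> q)) =
      b_mark X P (\<lambda>q. conjugate G \<one>\<^bsub>G\<^esub> (\<alpha> q)) (\<lambda>q. conjugate H h (\<beta> q))"
    using maps(1) by (intro b_mark_cong) (auto simp: Pi_iff)
  also have "\<dots> = b_mark X P \<alpha> \<beta>"
    using X by (rule b_lin_ext_cong) (rule mark_conjugate[OF _ maps G.one_closed h])
  finally show ?thesis .
qed

lemma single_formal_combs:
  "free_group_biset G H X \<Longrightarrow> Poly_Mapping.single (iso_class G H X) 1 \<in> formal_combs p G H"
  by (simp add: formal_combs_single free_group_biset.iso_class_in_iso_classes Z_loc_1[OF p])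

lemma bracket_in_burnside:
  assumes "standard_biset G H K \<phi>"
  shows "bracket p G H K \<phi> \<in> burnside p G H"
proof -
  interpret standard_biset G H K \<phi> by fact
  show ?thesis
    unfolding bracket_def using free_group_biset_axioms
      by (intro b_class_in_burnside single_formal_combs)
qed

lemma b_lin_ext_bracket:
  assumes "additive_on G H f" "standard_biset G H K \<phi>"
  shows "b_lin_ext f (bracket p G H K \<phi>) = f (iso_class G H (std_biset G H K \<phi>))"
proof -
  interpret standard_biset G H K \<phi> by fact
  show ?thesis
    unfolding bracket_def
    using b_lin_ext_b_class[OF assms(1) single_formal_combs[OF free_group_biset_axioms]] by simp
qed

end

subsection \<open>Composition\<close>

definition comp_comb :: "('g, 'm) monoid_scheme \<Rightarrow> ('h, 'n) monoid_scheme \<Rightarrow> ('k, 'l) monoid_scheme \<Rightarrow>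
    (('h, 'k) biset_class \<Rightarrow>\<^sub>0 rat) \<Rightarrow> (('g, 'h) biset_class \<Rightarrow>\<^sub>0 rat) \<Rightarrow> (('g, 'k) biset_class \<Rightarrow>\<^sub>0 rat)"
  where "comp_comb G H K x y = (\<Sum>c\<in>Poly_Mapping.keys x. \<Sum>d\<in>Poly_Mapping.keys y.
    Poly_Mapping.single (class_prod G H K c d) (Poly_Mapping.lookup x c * Poly_Mapping.lookup y d))"

lemma lin_ext_comp_comb:
  "lin_ext f (comp_comb G H K x y) = lin_ext (\<lambda>c. lin_ext (\<lambda>d. f (class_prod G H K c d)) y) x"
  unfolding comp_comb_def lin_ext_sum lin_ext_single
  by (simp add: lin_ext_def sum_distrib_left mult.assoc)

lemma class_prod_iso_class:
  assumes "biset_product G H K X Y"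
  shows "class_prod G H K (iso_class H K X) (iso_class G H Y) = iso_class G K (biset_prod H X Y)"
proof -
  interpret biset_product G H K X Y by fact
  interpret prod: free_group_biset G K "biset_prod H X Y"
    using fin_free_biset_prod X.H.group_axioms Y.G.group_axioms
    by (intro group_pair.free_group_bisetI group_pair.intro)
  have "iso_class G K (biset_prod H X' Y') = iso_class G K (biset_prod H X Y)"
    if "X' \<in> iso_class H K X" "Y' \<in> iso_class G H Y" for X' Y'
  proof (rule prod.iso_class_eqI[symmetric])
    have "biset_product G H K X' Y'"
      using that finite_H X.free_group_bisetI Y.free_group_bisetI
      by (auto simp: biset_product_def biset_product_axioms_def iso_class_def)
    then show "biset_isomorphic G K (biset_prod H X Y) (biset_prod H X' Y')"
      using that by (intro biset_prod_isomorphicI[OF assms]) (simp_all add: iso_class_def)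
  qed
  then show ?thesis
    unfolding class_prod_def using X.iso_class_nonempty Y.iso_class_nonempty by (simp cong: SUP_cong)
qed

locale burnside_composition = GH: burnside_module G H p + HK: burnside_module H K p
  for G :: "('g, 'm) monoid_scheme" and H :: "('h, 'n) monoid_scheme"
    and K :: "('k, 'l) monoid_scheme" and p :: nat +
  assumes finite_H [simp]: "finite (carrier H)"
begin

sublocale GK: burnside_module G K p
  using GH.p by unfold_locales

lemma iso_classes_prodE:
  assumes "c \<in> iso_classes H K" "d \<in> iso_classes G H"
  obtains X :: "('h, 'k, nat) biset" and Y :: "('g, 'h, nat) biset"
  where "biset_product G H K X Y" "c = iso_class H K X" "d = iso_class G H Y"
proof -
  obtain X :: "('h, 'k, nat) biset" where X: "free_group_biset H K X" "c = iso_class H K X"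
    using assms(1) by (rule HK.iso_classesE)
  obtain Y :: "('g, 'h, nat) biset" where Y: "free_group_biset G H Y" "d = iso_class G H Y"
    using assms(2) by (rule GH.iso_classesE)
  show ?thesis
    using that X Y finite_H by (simp add: biset_product_def biset_product_axioms_def)
qed

lemma class_prod_in_iso_classes:
  assumes "c \<in> iso_classes H K" "d \<in> iso_classes G H"
  shows "class_prod G H K c d \<in> iso_classes G K"
proof -
  obtain X :: "('h, 'k, nat) biset" and Y :: "('g, 'h, nat) biset"
    where XY: "biset_product G H K X Y" "c = iso_class H K X" "d = iso_class G H Y"
    using assms by (rule iso_classes_prodE)
  have "free_group_biset G K (biset_prod H X Y)"
    using biset_product.fin_free_biset_prod[OF XY(1)] by (rule GK.free_group_bisetI)
  then show ?thesis
    unfolding XY(2,3) class_prod_iso_class[OF XY(1)] by (rule free_group_biset.iso_class_in_iso_classes)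
qed

lemma comp_comb_formal_combs:
  assumes "x \<in> formal_combs p H K" "y \<in> formal_combs p G H"
  shows "comp_comb G H K x y \<in> formal_combs p G K"
  unfolding comp_comb_def using assms
  by (intro GK.formal_combs_sum GK.formal_combs_single class_prod_in_iso_classes Z_loc_mult[OF GH.p])
     (auto simp: formal_combs_def)

lemma mark_class_prod:
  assumes cd: "c \<in> iso_classes H K" "d \<in> iso_classes G H"
    and P: "finite P" and maps: "\<alpha> \<in> P \<rightarrow> carrier G" "\<beta> \<in> P \<rightarrow> carrier K"
  shows "of_nat (card (carrier H)) * mark (class_prod G H K c d) P \<alpha> \<beta> =
    (\<Sum>\<eta>\<in>P \<rightarrow>\<^sub>E carrier H. mark c P \<eta> \<beta> * mark d P \<alpha> \<eta>)"
proof -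
  obtain X :: "('h, 'k, nat) biset" and Y :: "('g, 'h, nat) biset"
    where XY: "biset_product G H K X Y" "c = iso_class H K X" "d = iso_class G H Y"
    using cd by (rule iso_classes_prodE)
  interpret biset_product G H K X Y by fact
  interpret prod: free_group_biset G K "biset_prod H X Y"
    using fin_free_biset_prod by (rule GK.free_group_bisetI)
  have "mark (class_prod G H K c d) P \<alpha> \<beta> = of_nat (card (fixed_points (biset_prod H X Y) P \<alpha> \<beta>))"
    unfolding XY(2,3) class_prod_iso_class[OF XY(1)] using maps by (rule prod.mark_iso_class)
  moreover have "mark c P \<eta> \<beta> * mark d P \<alpha> \<eta> =
      of_nat (card (fixed_points X P \<eta> \<beta>) * card (fixed_points Y P \<alpha> \<eta>))"
    if "\<eta> \<in> P \<rightarrow>\<^sub>E carrier H" for \<eta>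
  proof -
    have "\<eta> \<in> P \<rightarrow> carrier H"
      using that by auto
    then show ?thesis
      using maps by (simp add: XY(2,3) X.mark_iso_class Y.mark_iso_class)
  qed
  ultimately show ?thesis
    using arg_cong[OF card_fixed_points_prod[OF P maps], of "of_nat :: nat \<Rightarrow> rat"] by simp
qed

theorem b_mark_comp:
  assumes X: "X \<in> burnside p H K" and Y: "Y \<in> burnside p G H"
    and P: "finite P" and maps: "\<alpha> \<in> P \<rightarrow> carrier G" "\<beta> \<in> P \<rightarrow> carrier K"
  shows "of_nat (card (carrier H)) * b_mark (b_comp p G H K X Y) P \<alpha> \<beta> =
    (\<Sum>\<eta>\<in>P \<rightarrow>\<^sub>E carrier H. b_mark X P \<eta> \<beta> * b_mark Y P \<alpha> \<eta>)"
proof -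
  have comp: "b_comp p G H K X Y = (\<Union>x\<in>X. \<Union>y\<in>Y. b_class p G K (comp_comb G H K x y))"
    by (simp add: b_comp_def comp_comb_def)
  have "b_comp p G H K X Y \<noteq> {}"
    unfolding comp
    using HK.burnside_nonempty[OF X] GH.burnside_nonempty[OF Y] GK.b_class_self
      comp_comb_formal_combs[OF HK.burnside_formal_combs[OF X] GH.burnside_formal_combs[OF Y]] by blast
  then have "(SOME z. z \<in> b_comp p G H K X Y) \<in> b_comp p G H K X Y"
    by (simp add: some_in_eq)
  then obtain x y where xy: "x \<in> X" "y \<in> Y"
    "(SOME z. z \<in> b_comp p G H K X Y) \<in> b_class p G K (comp_comb G H K x y)"
    unfolding comp by blast
  have keys: "Poly_Mapping.keys x \<subseteq> iso_classes H K" "Poly_Mapping.keys y \<subseteq> iso_classes G H"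
    using HK.keys_burnside[OF X xy(1)] GH.keys_burnside[OF Y xy(2)] by auto
  let ?h = "of_nat (card (carrier H)) :: rat"
  have "?h * b_mark (b_comp p G H K X Y) P \<alpha> \<beta> =
      ?h * lin_ext (\<lambda>c. mark c P \<alpha> \<beta>) (comp_comb G H K x y)"
    using GK.lin_ext_b_class[OF GK.additive_on_mark[OF maps] xy(3)] by (simp add: b_lin_ext_def)
  also have "\<dots> = lin_ext (\<lambda>c. lin_ext (\<lambda>d. ?h * mark (class_prod G H K c d) P \<alpha> \<beta>) y) x"
    by (simp add: lin_ext_comp_comb lin_ext_fun_mult_left)
  also have "\<dots> = lin_ext (\<lambda>c. lin_ext (\<lambda>d. \<Sum>\<eta>\<in>P \<rightarrow>\<^sub>E carrier H. mark c P \<eta> \<beta> * mark d P \<alpha> \<eta>) y) x"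
    using keys by (intro lin_ext_cong mark_class_prod P maps) auto
  also have "\<dots> = (\<Sum>\<eta>\<in>P \<rightarrow>\<^sub>E carrier H. lin_ext (\<lambda>c. mark c P \<eta> \<beta>) x * lin_ext (\<lambda>d. mark d P \<alpha> \<eta>) y)"
    by (simp add: lin_ext_fun_sum lin_ext_fun_mult_left lin_ext_fun_mult_right)
  also have "\<dots> = (\<Sum>\<eta>\<in>P \<rightarrow>\<^sub>E carrier H. b_mark X P \<eta> \<beta> * b_mark Y P \<alpha> \<eta>)"
  proof (intro sum.cong refl)
    fix \<eta> assume "\<eta> \<in> P \<rightarrow>\<^sub>E carrier H"
    then have "\<eta> \<in> P \<rightarrow> carrier H"
      by auto
    then show "lin_ext (\<lambda>c. mark c P \<eta> \<beta>) x * lin_ext (\<lambda>d. mark d P \<alpha> \<eta>) y =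
      b_mark X P \<eta> \<beta> * b_mark Y P \<alpha> \<eta>"
      using HK.b_lin_ext_eq[OF HK.additive_on_mark X xy(1)]
        GH.b_lin_ext_eq[OF GH.additive_on_mark Y xy(2)] maps by metis
  qed
  finally show ?thesis .
qed

end

text \<open>Composing with \<open>[G, \<phi>]\<close> on the right or with \<open>[\<phi>(K), \<phi>\<^sup>-\<^sup>1]\<close> on the left restricts along \<open>\<phi>\<close>: each
  point of these bisets is fixed by exactly one twist, which is a conjugate of \<open>\<phi>\<close>.\<close>

lemma (in standard_biset) b_mark_bracket:
  assumes "burnside_module G H p" "\<alpha> \<in> P \<rightarrow> carrier G" "\<beta> \<in> P \<rightarrow> carrier H"
  shows "b_mark (bracket p G H K \<phi>) P \<alpha> \<beta> = of_nat (card (fixed_points (std_biset G H K \<phi>) P \<alpha> \<beta>))"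
proof -
  interpret burnside_module G H p by fact
  show ?thesis
    using assms(2,3) by (simp add: b_lin_ext_bracket additive_on_mark
      standard_biset_axioms mark_iso_class)
qed

lemma inv_map_apply [simp]: "\<lbrakk>inj_on \<phi> P; q \<in> P\<rbrakk> \<Longrightarrow> inv_map P \<phi> (\<phi> q) = q"
  by (simp add: inv_map_def)

context finite_group_pair
begin

lemma standard_biset_hom: "\<phi> \<in> hom G H \<Longrightarrow> standard_biset G H (carrier G) \<phi>"
  using G.subgroup_self by (intro standard_bisetI) simp_all

lemma ract_eq_lact_hom_conjugate:
  assumes "\<phi> \<in> hom G H" and x: "x \<in> points (std_biset G H (carrier G) \<phi>)"
  shows "\<exists>t\<in>carrier H. \<forall>g\<in>carrier G. \<forall>v\<in>carrier H.
    ract (std_biset G H (carrier G) \<phi>) x g = lact (std_biset G H (carrier G) \<phi>) v x \<longleftrightarrow>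
      v = conjugate H t (\<phi> g)"
proof -
  interpret standard_biset G H "carrier G" \<phi>
    using assms(1) by (rule standard_biset_hom)
  obtain h a where "h \<in> carrier H" "a \<in> carrier G" "x = std_point G H (carrier G) \<phi> h a"
    using x by (rule std_pointE)
  then show ?thesis
    by (intro bexI[of _ "h \<otimes>\<^bsub>H\<^esub> \<phi> a"] ballI)
      (simp_all add: std_point_ract_eq_lact_iff \<phi>_conjugate H.conjugate_conjugate
        del: lact_std_point ract_std_point)
qed

lemma standard_biset_inv_map:
  assumes "\<phi> \<in> mon H G"
  shows "standard_biset G H (\<phi> ` carrier H) (inv_map (carrier H) \<phi>)"
proof -
  interpret \<phi>: group_hom H G \<phi>
    using assms by unfold_locales (simp add: mon_def)
  have inj: "inj_on \<phi> (carrier H)"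
    using assms by (simp add: mon_def)
  have "inv_map (carrier H) \<phi> \<in> hom (sub_group G (\<phi> ` carrier H)) H"
  proof (rule homI)
    fix a b assume "a \<in> carrier (sub_group G (\<phi> ` carrier H))"
      "b \<in> carrier (sub_group G (\<phi> ` carrier H))"
    then obtain h k where "h \<in> carrier H" "k \<in> carrier H" "a = \<phi> h" "b = \<phi> k"
      by auto
    then show "inv_map (carrier H) \<phi> (a \<otimes>\<^bsub>sub_group G (\<phi> ` carrier H)\<^esub> b) =
        inv_map (carrier H) \<phi> a \<otimes>\<^bsub>H\<^esub> inv_map (carrier H) \<phi> b"
      using inj by (simp flip: \<phi>.hom_mult)
  qed (use inj in auto)
  then show ?thesis
    using \<phi>.img_is_subgroup by (intro standard_bisetI)
qed

lemma ract_eq_lact_inv_map_conjugate: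
  assumes \<phi>: "\<phi> \<in> mon H G" and x: "x \<in> points (std_biset G H (\<phi> ` carrier H) (inv_map (carrier H) \<phi>))"
  shows "\<exists>t\<in>carrier G. \<forall>h\<in>carrier H. \<forall>u\<in>carrier G.
    ract (std_biset G H (\<phi> ` carrier H) (inv_map (carrier H) \<phi>)) x u =
      lact (std_biset G H (\<phi> ` carrier H) (inv_map (carrier H) \<phi>)) h x \<longleftrightarrow> u = conjugate G t (\<phi> h)"
proof -
  let ?B = "std_biset G H (\<phi> ` carrier H) (inv_map (carrier H) \<phi>)"
  interpret standard_biset G H "\<phi> ` carrier H" "inv_map (carrier H) \<phi>"
    using \<phi> by (rule standard_biset_inv_map)
  interpret \<phi>: group_hom H G \<phi>
    using \<phi> by unfold_locales (simp add: mon_def)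
  have inj: "inj_on \<phi> (carrier H)"
    using \<phi> by (simp add: mon_def)
  obtain a g where x: "a \<in> carrier H" "g \<in> carrier G"
    "x = std_point G H (\<phi> ` carrier H) (inv_map (carrier H) \<phi>) a g"
    using x by (rule std_pointE)
  show ?thesis
  proof (intro bexI[of _ "inv\<^bsub>G\<^esub> g \<otimes>\<^bsub>G\<^esub> \<phi> (inv\<^bsub>H\<^esub> a)"] ballI)
    fix h u assume h: "h \<in> carrier H" and u: "u \<in> carrier G"
    have "ract ?B x u = lact ?B h x \<longleftrightarrow>
        conjugate G g u \<in> \<phi> ` carrier H \<and> h = conjugate H a (inv_map (carrier H) \<phi> (conjugate G g u))"
      unfolding x(3) using x(1,2) u h by (rule std_point_ract_eq_lact_iff)
    also have "\<dots> \<longleftrightarrow> (\<exists>k\<in>carrier H. conjugate G g u = \<phi> k \<and> h = conjugate H a k)"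
      using inj by auto
    also have "\<dots> \<longleftrightarrow> (\<exists>k\<in>carrier H. conjugate G g u = \<phi> k \<and> k = conjugate H (inv\<^bsub>H\<^esub> a) h)"
      using x(1) h by (auto simp: H.conjugate_eq_iff)
    also have "\<dots> \<longleftrightarrow> conjugate G g u = \<phi> (conjugate H (inv\<^bsub>H\<^esub> a) h)"
      using x(1) h by auto
    also have "\<dots> \<longleftrightarrow> u = conjugate G (inv\<^bsub>G\<^esub> g) (conjugate G (\<phi> (inv\<^bsub>H\<^esub> a)) (\<phi> h))"
      using x(1,2) u h by (simp add: G.conjugate_eq_iff \<phi>.hom_conjugate)
    also have "\<dots> \<longleftrightarrow> u = conjugate G (inv\<^bsub>G\<^esub> g \<otimes>\<^bsub>G\<^esub> \<phi> (inv\<^bsub>H\<^esub> a)) (\<phi> h)"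
      using x(1,2) h by (simp add: G.conjugate_conjugate)
    finally show "ract ?B x u = lact ?B h x \<longleftrightarrow> u = conjugate G (inv\<^bsub>G\<^esub> g \<otimes>\<^bsub>G\<^esub> \<phi> (inv\<^bsub>H\<^esub> a)) (\<phi> h)" .
  qed (use x(1,2) in simp)
qed

end

context burnside_composition
begin

lemma b_mark_comp_hom:
  assumes X: "X \<in> burnside p H K" and G: "finite (carrier G)" and \<phi>: "\<phi> \<in> hom G H"
    and \<beta>: "\<beta> \<in> carrier G \<rightarrow> carrier K"
  shows "b_mark (b_comp p G H K X (bracket p G H (carrier G) \<phi>)) (carrier G) (\<lambda>g. g) \<beta> =
    b_mark X (carrier G) \<phi> \<beta>"
proof -
  let ?G = "carrier G" and ?B = "std_biset G H (carrier G) \<phi>"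
  interpret finite_group_pair G H
    using G by unfold_locales simp_all
  interpret B: standard_biset G H ?G \<phi>
    using \<phi> by (rule standard_biset_hom)
  have "of_nat (card (carrier H)) *
      b_mark (b_comp p G H K X (bracket p G H ?G \<phi>)) ?G (\<lambda>g. g) \<beta> =
    (\<Sum>\<eta>\<in>?G \<rightarrow>\<^sub>E carrier H. b_mark X ?G \<eta> \<beta> * b_mark (bracket p G H ?G \<phi>) ?G (\<lambda>g. g) \<eta>)"
    using \<beta> by (intro b_mark_comp X GH.bracket_in_burnside B.standard_biset_axioms G) simp_all
  also have "\<dots> = (\<Sum>\<eta>\<in>?G \<rightarrow>\<^sub>E carrier H. b_mark X ?G \<eta> \<beta> *
      of_nat (card {x \<in> points ?B. \<forall>g\<in>?G. ract ?B x g = lact ?B (\<eta> g) x}))"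
  proof (intro sum.cong refl arg_cong[where f = "(*) _"])
    fix \<eta> assume "\<eta> \<in> ?G \<rightarrow>\<^sub>E carrier H"
    then show "b_mark (bracket p G H ?G \<phi>) ?G (\<lambda>g. g) \<eta> =
        of_nat (card {x \<in> points ?B. \<forall>g\<in>?G. ract ?B x g = lact ?B (\<eta> g) x})"
      unfolding fixed_points_def[symmetric]
      by (intro B.b_mark_bracket GH.burnside_module_axioms) auto
  qed
  also have "\<dots> = b_mark X ?G \<phi> \<beta> * of_nat (card (points ?B))"
  proof (rule GH.H.sum_card_conjugate_twists[where \<phi> = \<phi>])
    show "b_mark X ?G (\<lambda>g\<in>?G. conjugate H t (\<phi> g)) \<beta> = b_mark X ?G \<phi> \<beta>" if "t \<in> carrier H" for t
      using \<beta> that by (intro HK.b_mark_conjugate_right X) auto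
    show "\<exists>t\<in>carrier H. \<forall>g\<in>?G. \<forall>v\<in>carrier H. ract ?B x g = lact ?B v x \<longleftrightarrow> v = conjugate H t (\<phi> g)"
      if "x \<in> points ?B" for x
      using \<phi> that by (rule ract_eq_lact_hom_conjugate)
  qed (use G in auto)
  also have "card (points ?B) = card (carrier H)"
    using B.card_points_std GH.G.lagrange[OF GH.G.subgroup_self] G GH.G.one_closed
    by (auto simp: order_def)
  finally show ?thesis
    using finite_H GH.H.one_closed by auto
qed

lemma b_mark_mon_inv_comp:
  assumes Y: "Y \<in> burnside p G H" and K: "finite (carrier K)" and \<phi>: "\<phi> \<in> mon K H"
    and \<alpha>: "\<alpha> \<in> carrier K \<rightarrow> carrier G"
  shows "b_mark (b_comp p G H K (bracket p H K (\<phi> ` carrier K) (inv_map (carrier K) \<phi>)) Y)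
      (carrier K) \<alpha> (\<lambda>k. k) = b_mark Y (carrier K) \<alpha> \<phi>"
proof -
  let ?K = "carrier K" and ?B = "std_biset H K (\<phi> ` carrier K) (inv_map (carrier K) \<phi>)"
  interpret finite_group_pair H K
    using K by unfold_locales simp_all
  interpret B: standard_biset H K "\<phi> ` ?K" "inv_map ?K \<phi>"
    using \<phi> by (rule standard_biset_inv_map)
  have "of_nat (card (carrier H)) *
      b_mark (b_comp p G H K (bracket p H K (\<phi> ` ?K) (inv_map ?K \<phi>)) Y) ?K \<alpha> (\<lambda>k. k) =
    (\<Sum>\<eta>\<in>?K \<rightarrow>\<^sub>E carrier H. b_mark (bracket p H K (\<phi> ` ?K) (inv_map ?K \<phi>)) ?K \<eta> (\<lambda>k. k) *
      b_mark Y ?K \<alpha> \<eta>)"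
    using \<alpha> by (intro b_mark_comp Y HK.bracket_in_burnside B.standard_biset_axioms K) simp_all
  also have "\<dots> = (\<Sum>\<eta>\<in>?K \<rightarrow>\<^sub>E carrier H. b_mark Y ?K \<alpha> \<eta> *
      of_nat (card {x \<in> points ?B. \<forall>k\<in>?K. ract ?B x (\<eta> k) = lact ?B k x}))"
  proof (intro sum.cong refl, subst mult.commute, intro arg_cong[where f = "(*) _"])
    fix \<eta> assume "\<eta> \<in> ?K \<rightarrow>\<^sub>E carrier H"
    then show "b_mark (bracket p H K (\<phi> ` ?K) (inv_map ?K \<phi>)) ?K \<eta> (\<lambda>k. k) =
        of_nat (card {x \<in> points ?B. \<forall>k\<in>?K. ract ?B x (\<eta> k) = lact ?B k x})"
      unfolding fixed_points_def[symmetric]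
      by (intro B.b_mark_bracket HK.burnside_module_axioms) auto
  qed
  also have "\<dots> = b_mark Y ?K \<alpha> \<phi> * of_nat (card (points ?B))"
  proof (rule GH.H.sum_card_conjugate_twists[where \<phi> = \<phi>])
    show "b_mark Y ?K \<alpha> (\<lambda>k\<in>?K. conjugate H t (\<phi> k)) = b_mark Y ?K \<alpha> \<phi>" if "t \<in> carrier H" for t
      using \<alpha> \<phi> that by (intro GH.b_mark_conjugate_left Y) (auto simp: mon_def hom_def)
    show "\<exists>t\<in>carrier H. \<forall>k\<in>?K. \<forall>u\<in>carrier H. ract ?B x u = lact ?B k x \<longleftrightarrow> u = conjugate H t (\<phi> k)"
      if "x \<in> points ?B" for x
      using \<phi> that by (rule ract_eq_lact_inv_map_conjugate)
  qed (use K \<phi> in \<open>auto simp: mon_def hom_def\<close>)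
  also have "card (points ?B) = card (carrier H)"
    using B.card_points_std GH.H.lagrange[OF B.subgroup_K] \<phi>
    by (simp add: order_def mon_def card_image mult.commute)
  finally show ?thesis
    using finite_H GH.H.one_closed by auto
qed

end

subsection \<open>The augmentation\<close>

text \<open>The mark at the empty set counts all points.\<close>

definition degree_class ::
    "('g, 'm) monoid_scheme \<Rightarrow> ('h, 'n) monoid_scheme \<Rightarrow> ('g, 'h) biset_class \<Rightarrow> rat"
  where "degree_class G H c = mark c {} (\<lambda>g. g) (\<lambda>_. \<one>\<^bsub>H\<^esub>) / of_nat (card (carrier H))"

lemma (in free_group_biset) degree_iso_class:
  "degree_class G H (iso_class G H X) = of_nat (card (points X)) / of_nat (card (carrier H))"
  by (simp add: degree_class_def mark_iso_class)

lemma (in group_pair) additive_on_degree: "additive_on G H (degree_class G H)"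
  using additive_on_mark[of "\<lambda>g. g" "{}" "\<lambda>_. \<one>\<^bsub>H\<^esub>"]
  by (simp add: additive_on_def degree_class_def add_divide_distrib)

lemma (in standard_biset) degree_std:
  "degree_class G H (iso_class G H (std_biset G H K \<phi>)) = of_nat (card (rcosets\<^bsub>G\<^esub> K))"
  using H.one_closed by (auto simp: degree_iso_class card_points_std)

lemma (in finite_group_pair) degree_class_nat:
  assumes "c \<in> iso_classes G H"
  obtains n :: nat where "degree_class G H c = of_nat n"
proof -
  obtain X :: "('g, 'h, nat) biset" where X: "free_group_biset G H X" "c = iso_class G H X"
    using assms by (rule iso_classesE)
  interpret free_group_biset G H X by fact
  obtain n where "card (points X) = card (carrier H) * n"
    using card_left_dvd_card_points[OF finite_group_pair_axioms] by blast
  then have "degree_class G H c = of_nat n"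
    using H.one_closed by (auto simp: X(2) degree_iso_class)
  then show ?thesis
    by (rule that)
qed

definition b_linear :: "nat \<Rightarrow> ('g, 'm) monoid_scheme \<Rightarrow> ('h, 'n) monoid_scheme \<Rightarrow>
    (('g, 'h) burnside_elt \<Rightarrow> rat) \<Rightarrow> bool"
  where "b_linear p G H e \<longleftrightarrow>
    (\<forall>X\<in>burnside p G H. \<forall>Y\<in>burnside p G H. e (b_add p G H X Y) = e X + e Y) \<and>
    (\<forall>r\<in>Z_loc p. \<forall>X\<in>burnside p G H. e (b_smult p G H r X) = r * e X)"

context burnside_module
begin

lemma b_linear_b_class_add:
  "\<lbrakk>b_linear p G H e; x \<in> formal_combs p G H; y \<in> formal_combs p G H\<rbrakk> \<Longrightarrow>
    e (b_class p G H (x + y)) = e (b_class p G H x) + e (b_class p G H y)"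
  by (simp add: b_linear_def b_class_in_burnside flip: b_add_b_class)

lemma b_linear_b_class_scale:
  "\<lbrakk>b_linear p G H e; x \<in> formal_combs p G H; r \<in> Z_loc p\<rbrakk> \<Longrightarrow>
    e (b_class p G H (Poly_Mapping.map ((*) r) x)) = r * e (b_class p G H x)"
  by (simp add: b_linear_def b_class_in_burnside flip: b_smult_b_class)

lemma b_linear_b_class_sum:
  assumes e: "b_linear p G H e" and "\<And>i. i \<in> I \<Longrightarrow> x i \<in> formal_combs p G H"
  shows "e (b_class p G H (\<Sum>i\<in>I. x i)) = (\<Sum>i\<in>I. e (b_class p G H (x i)))"
proof -
  have zero: "e (b_class p G H 0) = 0"
    using b_linear_b_class_add[OF e, of 0 0] by simp
  show ?thesis
    using assms(2)
  proof (induction I rule: infinite_finite_induct)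
    case (insert i I)
    have "(\<Sum>j\<in>I. x j) \<in> formal_combs p G H"
      using insert.prems by (intro formal_combs_sum) simp
    then show ?case
      using insert by (simp add: b_linear_b_class_add[OF e])
  qed (simp_all add: zero)
qed

lemma b_linear_b_class:
  assumes e: "b_linear p G H e" and x: "x \<in> formal_combs p G H"
  shows "e (b_class p G H x) = lin_ext (\<lambda>c. e (b_class p G H (Poly_Mapping.single c 1))) x"
proof -
  let ?term = "\<lambda>c. Poly_Mapping.map ((*) (Poly_Mapping.lookup x c)) (Poly_Mapping.single c 1)"
  have expand: "x = (\<Sum>c\<in>Poly_Mapping.keys x. ?term c)"
    by (rule poly_mapping_eqI) (simp add: lookup_sum lookup_single when_def in_keys_iff)
  have comb: "Poly_Mapping.single c 1 \<in> formal_combs p G H" "Poly_Mapping.lookup x c \<in> Z_loc p"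
    if "c \<in> Poly_Mapping.keys x" for c
    using x that by (auto simp: formal_combs_def Z_loc_1[OF p] Z_loc_0[OF p] lookup_single when_def)
  have "e (b_class p G H x) = (\<Sum>c\<in>Poly_Mapping.keys x. e (b_class p G H (?term c)))"
    using comb by (subst expand, intro b_linear_b_class_sum[OF e] formal_combs_scale) auto
  also have "\<dots> = lin_ext (\<lambda>c. e (b_class p G H (Poly_Mapping.single c 1))) x"
    unfolding lin_ext_def using comb by (intro sum.cong refl b_linear_b_class_scale[OF e])
  finally show ?thesis .
qed

lemma b_class_single_sum:
  fixes X Y :: "('g, 'h, nat) biset"
  assumes X: "fin_free_biset G H X" and Y: "fin_free_biset G H Y"
  shows "b_class p G H (Poly_Mapping.single (iso_class G H (biset_sum X Y)) 1) =
    b_class p G H (Poly_Mapping.single (iso_class G H X) 1 + Poly_Mapping.single (iso_class G H Y) 1)"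
proof -
  have "Poly_Mapping.single (iso_class G H (biset_sum X Y)) 1 -
      (Poly_Mapping.single (iso_class G H X) 1 + Poly_Mapping.single (iso_class G H Y) 1)
    \<in> sum_relations p G H"
    using sum_relations.add[OF sum_relations.zero Z_loc_1[OF p] X Y] by (simp only: add_0 diff_diff_eq)
  then show ?thesis
    using X Y by (intro b_class_eqI formal_combs_add single_formal_combs
      free_group_bisetI fin_free_biset_sum)
qed

lemma b_linear_additive_on:
  assumes e: "b_linear p G H e"
  shows "additive_on G H (\<lambda>c. e (b_class p G H (Poly_Mapping.single c 1)))"
  unfolding additive_on_def
  by (simp add: b_class_single_sum b_linear_b_class_add[OF e] single_formal_combs free_group_bisetI)

lemma b_linear_b_lin_ext:
  assumes f: "additive_on G H f"
  shows "b_linear p G H (b_lin_ext f)"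
  unfolding b_linear_def
proof (intro conjI ballI)
  show "b_lin_ext f (b_add p G H X Y) = b_lin_ext f X + b_lin_ext f Y"
    if "X \<in> burnside p G H" "Y \<in> burnside p G H" for X Y
    using that
    by (elim burnsideE) (simp add: b_add_b_class b_lin_ext_b_class[OF f] formal_combs_add lin_ext_add)
  show "b_lin_ext f (b_smult p G H r X) = r * b_lin_ext f X"
    if "r \<in> Z_loc p" "X \<in> burnside p G H" for r X
    using that
    by (elim burnsideE) (simp add: b_smult_b_class b_lin_ext_b_class[OF f]
      formal_combs_scale lin_ext_scale)
qed

end

locale finite_burnside_module = burnside_module G H p + finite_group_pair G H
  for G :: "('g, 'm) monoid_scheme" and H :: "('h, 'n) monoid_scheme" and p :: nat
begin

lemma b_linear_eqI:
  assumes e: "b_linear p G H e" and e': "b_linear p G H e'"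
    and bracket: "\<And>K \<phi>. standard_biset G H K \<phi> \<Longrightarrow> e (bracket p G H K \<phi>) = e' (bracket p G H K \<phi>)"
    and X: "X \<in> burnside p G H"
  shows "e X = e' X"
proof -
  obtain x where x: "x \<in> formal_combs p G H" "X = b_class p G H x"
    using X by (rule burnsideE)
  have "e (b_class p G H (Poly_Mapping.single c 1)) = e' (b_class p G H (Poly_Mapping.single c 1))"
    if "c \<in> iso_classes G H" for c
    using b_linear_additive_on[OF e] b_linear_additive_on[OF e'] bracket that
    unfolding bracket_def by (rule additive_on_eqI)
  then show ?thesis
    unfolding x(2) b_linear_b_class[OF e x(1)] b_linear_b_class[OF e' x(1)]
    using x(1) by (intro lin_ext_cong) (auto simp: formal_combs_def)
qed

lemma b_lin_ext_degree_in_Z_loc: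
  assumes X: "X \<in> burnside p G H"
  shows "b_lin_ext (degree_class G H) X \<in> Z_loc p"
proof -
  obtain x where x: "x \<in> X"
    using burnside_nonempty[OF X] by blast
  have "Poly_Mapping.lookup x c * degree_class G H c \<in> Z_loc p" if "c \<in> Poly_Mapping.keys x" for c
  proof -
    have "c \<in> iso_classes G H" "Poly_Mapping.lookup x c \<in> Z_loc p"
      using burnside_formal_combs[OF X x] that by (auto simp: formal_combs_def)
    then show ?thesis
      using Z_loc_mult[OF p] Z_loc_of_nat[OF p] by (metis degree_class_nat)
  qed
  then show ?thesis
    unfolding b_lin_ext_eq[OF additive_on_degree X x] lin_ext_def by (rule Z_loc_sum[OF p])
qed

end

theorem augmentation_eq_degree:
  fixes S :: "('a, 'm) monoid_scheme"
  assumes "finite_burnside_module S S p" and X: "X \<in> burnside p S S"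
  shows "augmentation p S X = b_lin_ext (degree_class S S) X"
proof -
  interpret finite_burnside_module S S p by fact
  let ?d = "b_lin_ext (degree_class S S)" and ?A = "burnside p S S"
  let ?is_aug = "\<lambda>e. e \<in> ?A \<rightarrow>\<^sub>E Z_loc p \<and>
    (\<forall>X\<in>?A. \<forall>Y\<in>?A. e (b_add p S S X Y) = e X + e Y) \<and>
    (\<forall>r\<in>Z_loc p. \<forall>X\<in>?A. e (b_smult p S S r X) = r * e X) \<and>
    (\<forall>P \<phi>. subgroup P S \<and> \<phi> \<in> hom (sub_group S P) S \<longrightarrow>
      e (bracket p S S P \<phi>) = of_nat (card (rcosets\<^bsub>S\<^esub> P)))"
  have bracket: "?d (bracket p S S P \<phi>) = of_nat (card (rcosets\<^bsub>S\<^esub> P))"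
    if "standard_biset S S P \<phi>" for P \<phi>
    using that by (simp add: b_lin_ext_bracket additive_on_degree standard_biset.degree_std)
  have unique: "e X = ?d X" if e: "?is_aug e" and X: "X \<in> ?A" for e X
  proof (rule b_linear_eqI[OF _ b_linear_b_lin_ext[OF additive_on_degree] _ X])
    show "b_linear p S S e"
      using e by (simp add: b_linear_def)
    show "e (bracket p S S P \<phi>) = ?d (bracket p S S P \<phi>)" if "standard_biset S S P \<phi>" for P \<phi>
      using e bracket[OF that] standard_biset.subgroup_K[OF that] standard_biset.\<phi>_hom[OF that] by simp
  qed
  have add: "b_add p S S X Y \<in> ?A" if "X \<in> ?A" "Y \<in> ?A" for X Y
    using that by (elim burnsideE) (simp add: b_add_b_class b_class_in_burnside formal_combs_add)
  have smult: "b_smult p S S r X \<in> ?A" if "r \<in> Z_loc p" "X \<in> ?A" for r X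
    using that by (elim burnsideE) (simp add: b_smult_b_class b_class_in_burnside formal_combs_scale)
  have "?is_aug (restrict ?d ?A)"
    using b_linear_b_lin_ext[OF additive_on_degree] bracket standard_bisetI
    by (auto simp: b_linear_def add smult bracket_in_burnside b_lin_ext_degree_in_Z_loc)
  moreover have "e = restrict ?d ?A" if "?is_aug e" for e
  proof (rule extensionalityI[of _ ?A])
    show "e \<in> extensional ?A"
      using that by (simp add: PiE_def)
  qed (use unique[OF that] in auto)
  ultimately have "augmentation p S = restrict ?d ?A"
    unfolding augmentation_def by (rule the_equality)
  then show ?thesis
    using X by simp
qed

subsection \<open>Marks separate formal combinations of transitive bisets\<close>

context standard_biset
begin

lemma mark_nonzero_iff:
  assumes "P \<subseteq> carrier G" "\<beta> \<in> P \<rightarrow> carrier H"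
  shows "mark (iso_class G H (std_biset G H K \<phi>)) P (\<lambda>q. q) \<beta> \<noteq> 0 \<longleftrightarrow> subconjugate G H P \<beta> K \<phi>"
proof -
  have "(\<lambda>q. q) \<in> P \<rightarrow> carrier G"
    using assms(1) by auto
  then show ?thesis
    using assms by (simp add: mark_iso_class fixed_points_nonempty_iff[symmetric])
qed

lemma mark_self_nonzero: "mark (iso_class G H (std_biset G H K \<phi>)) K (\<lambda>k. k) \<phi> \<noteq> 0"
  using subconjugate_refl by (subst mark_nonzero_iff) auto

lemma mark_std_eq_zero:
  assumes "standard_biset G H K' \<phi>'" "card K' \<le> card K"
    and "iso_class G H (std_biset G H K' \<phi>') \<noteq> iso_class G H (std_biset G H K \<phi>)"
  shows "mark (iso_class G H (std_biset G H K' \<phi>')) K (\<lambda>k. k) \<phi> = 0"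
proof (rule ccontr)
  assume nonzero: "mark (iso_class G H (std_biset G H K' \<phi>')) K (\<lambda>k. k) \<phi> \<noteq> 0"
  have "K \<subseteq> carrier G" "\<phi> \<in> K \<rightarrow> carrier H"
    by auto
  then have "subconjugate G H K \<phi> K' \<phi>'"
    using nonzero by (simp add: standard_biset.mark_nonzero_iff[OF assms(1)])
  then have "biset_isomorphic G H (std_biset G H K \<phi>) (std_biset G H K' \<phi>')"
    using standard_biset_axioms assms(1,2) by (intro std_biset_isomorphic_of_subconjugate)
  then show False
    using iso_class_eqI[of "std_biset G H K' \<phi>'"] assms(3) by simp
qed

end

context finite_group_pair
begin

text \<open>A pair \<open>(K, \<phi>)\<close> with \<open>K\<close> of maximal order detects its own coefficient.\<close>

lemma ex_mark_nonzero:
  assumes "d \<noteq> 0"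
    and keys: "Poly_Mapping.keys d \<subseteq> {iso_class G H (std_biset G H K \<phi>) | K \<phi>. R K \<phi>}"
    and R: "\<And>K \<phi>. R K \<phi> \<Longrightarrow> standard_biset G H K \<phi>"
  obtains K \<phi> where "R K \<phi>" "lin_ext (\<lambda>c. mark c K (\<lambda>k. k) \<phi>) d \<noteq> 0"
proof -
  let ?cls = "\<lambda>K \<phi>. iso_class G H (std_biset G H K \<phi>)"
  let ?N = "{card K | K. \<exists>\<phi>. R K \<phi> \<and> ?cls K \<phi> \<in> Poly_Mapping.keys d}"
  have "?N \<subseteq> {..card (carrier G)}"
    using R by (auto intro!: card_mono dest!: standard_biset.subgroup_K[THEN subgroup.subset])
  then have fin: "finite ?N"
    by (rule finite_subset) simp
  moreover have "?N \<noteq> {}"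
    using assms(1) keys by (auto simp: keys_eq_empty[symmetric] simp del: keys_eq_empty)
  ultimately have "Max ?N \<in> ?N"
    by (rule Max_in)
  then obtain K \<phi> where K: "R K \<phi>" "?cls K \<phi> \<in> Poly_Mapping.keys d" "card K = Max ?N"
    by auto
  interpret standard_biset G H K \<phi>
    using K(1) by (rule R)
  have "mark c K (\<lambda>k. k) \<phi> = 0" if "c \<in> Poly_Mapping.keys d" "c \<noteq> ?cls K \<phi>" for c
  proof -
    from keys that(1) obtain K' \<phi>' where K': "R K' \<phi>'" "c = ?cls K' \<phi>'"
      by blast
    then have "card K' \<in> ?N"
      using that(1) by blast
    then have "card K' \<le> card K"
      unfolding K(3) by (rule Max_ge[OF fin])
    then show ?thesis
      using that(2) R[OF K'(1)] unfolding K'(2) by (intro mark_std_eq_zero)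
  qed
  then have "lin_ext (\<lambda>c. mark c K (\<lambda>k. k) \<phi>) d =
      (\<Sum>c\<in>{?cls K \<phi>}. Poly_Mapping.lookup d c * mark c K (\<lambda>k. k) \<phi>)"
    unfolding lin_ext_def using K(2) by (intro sum.mono_neutral_right) auto
  also have "\<dots> \<noteq> 0"
    using K(2) mark_self_nonzero by (simp add: in_keys_iff)
  finally show ?thesis
    using that K(1) by blast
qed

end

definition std_expansion :: "('g, 'm) monoid_scheme \<Rightarrow> ('h, 'n) monoid_scheme \<Rightarrow>
    ('g, 'h) burnside_elt \<Rightarrow> (('g, 'h) biset_class \<Rightarrow>\<^sub>0 rat)"
  where "std_expansion G H X = (THE x. x \<in> X \<and> Poly_Mapping.keys x \<subseteq> std_classes G H)"

lemma chi_eq_lookup: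
  "chi G H K \<phi> X = Poly_Mapping.lookup (std_expansion G H X) (iso_class G H (std_biset G H K \<phi>))"
  by (simp add: chi_def std_expansion_def)

context finite_burnside_module
begin

lemma std_expansion_unique:
  assumes X: "X \<in> burnside p G H" "x \<in> X" "y \<in> X"
    and keys: "Poly_Mapping.keys x \<subseteq> std_classes G H" "Poly_Mapping.keys y \<subseteq> std_classes G H"
  shows "x = y"
proof (rule ccontr)
  assume "x \<noteq> y"
  then have "x - y \<noteq> 0"
    by simp
  moreover have "Poly_Mapping.keys (x - y) \<subseteq>
      {iso_class G H (std_biset G H K \<phi>) | K \<phi>. standard_biset G H K \<phi>}"
  proof
    fix c assume "c \<in> Poly_Mapping.keys (x - y)"
    then have "c \<in> std_classes G H"
      using keys keys_diff[of x y] by blast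
    then show "c \<in> {iso_class G H (std_biset G H K \<phi>) | K \<phi>. standard_biset G H K \<phi>}"
      unfolding std_classes_def using standard_bisetI by blast
  qed
  ultimately obtain K \<phi> where K: "standard_biset G H K \<phi>" "lin_ext (\<lambda>c. mark c K (\<lambda>k. k) \<phi>) (x - y) \<noteq> 0"
    by (rule ex_mark_nonzero) blast+
  interpret standard_biset G H K \<phi> by (rule K(1))
  have "additive_on G H (\<lambda>c. mark c K (\<lambda>k. k) \<phi>)"
    by (intro additive_on_mark) auto
  then have "lin_ext (\<lambda>c. mark c K (\<lambda>k. k) \<phi>) x = lin_ext (\<lambda>c. mark c K (\<lambda>k. k) \<phi>) y"
    using b_lin_ext_eq[OF _ X(1,2)] b_lin_ext_eq[OF _ X(1,3)] by metis
  then show False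
    using K(2) by (simp add: lin_ext_diff)
qed

lemma std_expansion_eqI:
  "\<lbrakk>X \<in> burnside p G H; x \<in> X; Poly_Mapping.keys x \<subseteq> std_classes G H\<rbrakk> \<Longrightarrow> std_expansion G H X = x"
  unfolding std_expansion_def using std_expansion_unique by (intro the_equality) auto

end

subsection \<open>Restriction to a subgroup\<close>

text \<open>The total mark over all \<open>\<eta>\<close> counts the points fixed by \<open>P\<close> up to the left action.\<close>

lemma (in finite_group_pair) degree_class_congruence:
  assumes p: "prime p" and P: "subgroup P G" "card P = p ^ n" and c: "c \<in> iso_classes G H"
  shows "\<exists>k :: nat. degree_class G H c =
    (\<Sum>\<eta>\<in>P \<rightarrow>\<^sub>E carrier H. mark c P (\<lambda>q. q) \<eta>) / of_nat (card (carrier H)) + of_nat p * of_nat k"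
proof -
  obtain X :: "('g, 'h, nat) biset" where X: "free_group_biset G H X" "c = iso_class G H X"
    using c by (rule iso_classesE)
  interpret X: free_group_biset G H X by fact
  let ?P = "sub_group G P"
  note mem = subgroup.mem_carrier[OF P(1)]
  have fin: "finite P"
    using subgroup.subset[OF P(1)] finite_G by (rule finite_subset)
  interpret PH: finite_group_pair ?P H
    using G.subgroup_imp_group[OF P(1)] H.group_axioms fin
    by (intro finite_group_pair.intro group_pair.intro finite_group_pair_axioms.intro) simp_all
  interpret res: free_group_biset ?P H X
    using X.fin_free_biset mem
    by (intro PH.free_group_bisetI) (simp add: fin_free_biset_def is_biset_def)
  have "card (left_fixed_points ?P H X) = (\<Sum>\<eta>\<in>P \<rightarrow>\<^sub>E carrier H. card (fixed_points X P (\<lambda>q. q) \<eta>))"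
    using res.sum_card_fixed_points fin by simp
  moreover have "mark c P (\<lambda>q. q) \<eta> = of_nat (card (fixed_points X P (\<lambda>q. q) \<eta>))"
    if "\<eta> \<in> P \<rightarrow>\<^sub>E carrier H" for \<eta>
    using that mem unfolding X(2) by (intro X.mark_iso_class) auto
  ultimately have fixed: "(\<Sum>\<eta>\<in>P \<rightarrow>\<^sub>E carrier H. mark c P (\<lambda>q. q) \<eta>) =
    of_nat (card (left_fixed_points ?P H X))"
    by simp
  obtain k where k: "card (points X - left_fixed_points ?P H X) = p * card (carrier H) * k"
    using res.card_not_left_fixed_dvd[OF PH.finite_group_pair_axioms p, of n] P(2) by auto
  have "left_fixed_points ?P H X \<subseteq> points X"
    by (auto simp: left_fixed_points_def)
  then have "card (points X) = card (left_fixed_points ?P H X) + p * card (carrier H) * k"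
    using k by (metis X.finite_points card_Diff_subset card_mono finite_subset le_add_diff_inverse)
  then have "degree_class G H c =
      (\<Sum>\<eta>\<in>P \<rightarrow>\<^sub>E carrier H. mark c P (\<lambda>q. q) \<eta>) / of_nat (card (carrier H)) + of_nat p * of_nat k"
    using H.one_closed finite_H
    by (auto simp: fixed X.degree_iso_class[folded X(2)] add_divide_distrib)
  then show ?thesis
    by blast
qed

lemma (in finite_burnside_module) degree_congruence:
  assumes P: "subgroup P G" "card P = p ^ n" and X: "X \<in> burnside p G H"
  obtains z where "z \<in> Z_loc p" "b_lin_ext (degree_class G H) X =
    (\<Sum>\<eta>\<in>P \<rightarrow>\<^sub>E carrier H. b_mark X P (\<lambda>q. q) \<eta>) / of_nat (card (carrier H)) + of_nat p * z"
proof -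
  obtain x where x: "x \<in> X"
    using burnside_nonempty[OF X] by blast
  have comb: "c \<in> iso_classes G H" "Poly_Mapping.lookup x c \<in> Z_loc p"
    if "c \<in> Poly_Mapping.keys x" for c
    using burnside_formal_combs[OF X x] that by (auto simp: formal_combs_def)
  let ?total = "\<lambda>c. \<Sum>\<eta>\<in>P \<rightarrow>\<^sub>E carrier H. mark c P (\<lambda>q. q) \<eta>"
  obtain k :: "('g, 'h) biset_class \<Rightarrow> nat" where k: "\<And>c. c \<in> iso_classes G H \<Longrightarrow>
      degree_class G H c = ?total c / of_nat (card (carrier H)) + of_nat p * of_nat (k c)"
    using degree_class_congruence[OF p P] by (metis (no_types))
  have "b_lin_ext (degree_class G H) X = lin_ext (degree_class G H) x"
    using additive_on_degree X x by (rule b_lin_ext_eq)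
  also have "\<dots> = lin_ext (\<lambda>c. ?total c * (1 / of_nat (card (carrier H))) + of_nat p * of_nat (k c)) x"
    using comb(1) by (intro lin_ext_cong) (simp add: k)
  also have "\<dots> = lin_ext ?total x / of_nat (card (carrier H)) + of_nat p * lin_ext (\<lambda>c. of_nat (k c)) x"
    unfolding lin_ext_fun_add lin_ext_fun_mult_right lin_ext_fun_mult_left by simp
  also have "lin_ext ?total x = (\<Sum>\<eta>\<in>P \<rightarrow>\<^sub>E carrier H. b_mark X P (\<lambda>q. q) \<eta>)"
    unfolding lin_ext_fun_sum
  proof (intro sum.cong refl b_lin_ext_eq[OF _ X x, symmetric] additive_on_mark)
    show "(\<lambda>q. q) \<in> P \<rightarrow> carrier G"
      using subgroup.mem_carrier[OF P(1)] by auto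
  qed auto
  finally have "b_lin_ext (degree_class G H) X = (\<Sum>\<eta>\<in>P \<rightarrow>\<^sub>E carrier H. b_mark X P (\<lambda>q. q) \<eta>) /
      of_nat (card (carrier H)) + of_nat p * lin_ext (\<lambda>c. of_nat (k c)) x" .
  moreover have "lin_ext (\<lambda>c. of_nat (k c)) x \<in> Z_loc p"
    unfolding lin_ext_def using comb(2)
    by (intro Z_loc_sum[OF p] Z_loc_mult[OF p] Z_loc_of_nat[OF p])
  ultimately show ?thesis
    by (intro that)
qed

section \<open>Fusion systems\<close>

locale finite_fusion_system = group S for S :: "('a, 'm) monoid_scheme" (structure) +
  fixes F :: "'a homsets"
  assumes finite_S: "finite (carrier S)" and fusion_system: "fusion_system S F"
begin

sublocale SS: finite_group_pair S S
  using finite_S by unfold_locales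

abbreviation std_class :: "'a set \<Rightarrow> ('a \<Rightarrow> 'a) \<Rightarrow> ('a, 'a) biset_class"
  where "std_class P \<phi> \<equiv> iso_class S S (std_biset S S P \<phi>)"

lemma F_subgroup:
  assumes "\<phi> \<in> F P Q"
  shows "subgroup P S" "subgroup Q S"
  using assms fusion_system unfolding fusion_system_def by blast+

lemma F_Inj: "\<phi> \<in> F P Q \<Longrightarrow> \<phi> \<in> Inj S P Q"
  using fusion_system F_subgroup unfolding fusion_system_def by blast

lemma F_extensional: "\<phi> \<in> F P Q \<Longrightarrow> \<phi> \<in> extensional P"
  and F_inj_on: "\<phi> \<in> F P Q \<Longrightarrow> inj_on \<phi> P"
  and F_closed: "\<lbrakk>\<phi> \<in> F P Q; q \<in> P\<rbrakk> \<Longrightarrow> \<phi> q \<in> Q"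
  and F_mult: "\<lbrakk>\<phi> \<in> F P Q; q \<in> P; r \<in> P\<rbrakk> \<Longrightarrow> \<phi> (q \<otimes> r) = \<phi> q \<otimes> \<phi> r"
  by (auto dest!: F_Inj simp: Inj_def mon_def hom_def)

lemma F_hom: "\<phi> \<in> F P (carrier S) \<Longrightarrow> \<phi> \<in> hom (sub_group S P) S"
  by (simp add: hom_def F_closed F_mult)

lemma F_Homs: "\<phi> \<in> F P (carrier S) \<Longrightarrow> \<phi> \<in> Homs S P (carrier S)"
  by (simp add: Homs_def hom_def F_closed F_mult F_extensional)

lemma F_PiE: "\<phi> \<in> F P (carrier S) \<Longrightarrow> \<phi> \<in> P \<rightarrow>\<^sub>E carrier S"
  by (simp add: PiE_def F_closed F_extensional)

lemma F_standard_biset: "\<phi> \<in> F P (carrier S) \<Longrightarrow> standard_biset S S P \<phi>"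
  by (intro SS.standard_bisetI F_subgroup(1) F_hom)

lemma subgroup_finite: "subgroup P S \<Longrightarrow> finite P"
  using finite_S subgroup.subset finite_subset by metis

lemma finite_F: "finite (F P (carrier S))"
proof (cases "F P (carrier S) = {}")
  case False
  then have "finite P"
    using F_subgroup(1) subgroup_finite by blast
  then have "finite (P \<rightarrow>\<^sub>E carrier S)"
    using finite_S by (intro finite_PiE)
  moreover have "F P (carrier S) \<subseteq> P \<rightarrow>\<^sub>E carrier S"
    using F_PiE by (rule subsetI)
  ultimately show ?thesis
    by (rule rev_finite_subset)
qed simp

lemma F_compose: "\<lbrakk>\<phi> \<in> F P Q; \<psi> \<in> F Q R\<rbrakk> \<Longrightarrow> compose P \<psi> \<phi> \<in> F P R"
  using fusion_system unfolding fusion_system_def by blast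

lemma F_image: "\<phi> \<in> F P Q \<Longrightarrow> \<phi> \<in> F P (\<phi> ` P)"
  and F_inv_map: "\<phi> \<in> F P Q \<Longrightarrow> inv_map P \<phi> \<in> F (\<phi> ` P) P"
  using fusion_system unfolding fusion_system_def by blast+

lemma F_conj_map:
  assumes "subgroup P S" "subgroup Q S" "g \<in> carrier S" "\<And>x. x \<in> P \<Longrightarrow> conjugate S g x \<in> Q"
  shows "(\<lambda>x\<in>P. conjugate S g x) \<in> F P Q"
proof -
  have "conj_map S P g \<in> Hom_conj S P Q"
    unfolding Hom_conj_def using assms(3,4) by (auto simp: conj_map_eq_conjugate)
  then show ?thesis
    using fusion_system assms(1,2) unfolding fusion_system_def conj_map_eq_conjugate by blast
qed

lemma F_inclusion:
  assumes "subgroup P S" "subgroup Q S" "P \<subseteq> Q"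
  shows "(\<lambda>x\<in>P. x) \<in> F P Q"
proof -
  have "(\<lambda>x\<in>P. conjugate S \<one> x) \<in> F P Q"
    using assms subgroup.mem_carrier[OF assms(1)] by (intro F_conj_map) auto
  moreover have "(\<lambda>x\<in>P. conjugate S \<one> x) = (\<lambda>x\<in>P. x)"
    using subgroup.mem_carrier[OF assms(1)] by (intro restrict_ext) simp
  ultimately show ?thesis
    by simp
qed

lemma F_codomain:
  assumes "\<phi> \<in> F P Q" "subgroup R S" "\<phi> ` P \<subseteq> R"
  shows "\<phi> \<in> F P R"
proof -
  have "compose P (\<lambda>x\<in>\<phi> ` P. x) \<phi> \<in> F P R"
    using F_image[OF assms(1)] F_subgroup assms(2,3) by (intro F_compose[of _ P "\<phi> ` P"]
      F_inclusion) blast+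
  moreover have "compose P (\<lambda>x\<in>\<phi> ` P. x) \<phi> = \<phi>"
    using F_extensional[OF assms(1)] by (intro extensionalityI[of _ P]) (auto simp: compose_def)
  ultimately show ?thesis
    by simp
qed

lemma F_into_carrier:
  assumes "\<phi> \<in> F P Q"
  shows "\<phi> \<in> F P (carrier S)"
  using assms subgroup_self
proof (rule F_codomain)
  show "\<phi> ` P \<subseteq> carrier S"
    using F_closed[OF assms] subgroup.mem_carrier[OF F_subgroup(2)[OF assms]] by blast
qed

lemma F_restrict:
  assumes "\<phi> \<in> F P Q" "subgroup P' S" "P' \<subseteq> P"
  shows "restrict \<phi> P' \<in> F P' Q"
proof -
  have "compose P' \<phi> (\<lambda>x\<in>P'. x) \<in> F P' Q"
    using assms F_subgroup by (intro F_compose[of _ P' P] F_inclusion) auto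
  moreover have "compose P' \<phi> (\<lambda>x\<in>P'. x) = restrict \<phi> P'"
    by (auto simp: compose_def fun_eq_iff)
  ultimately show ?thesis
    by simp
qed

lemma F_twist:
  assumes \<psi>: "\<psi> \<in> F Q (carrier S)" and hg: "h \<in> carrier S" "g \<in> carrier S"
    and P: "subgroup P S" "\<And>q. q \<in> P \<Longrightarrow> conjugate S g q \<in> Q"
  shows "(\<lambda>q\<in>P. conjugate S h (\<psi> (conjugate S g q))) \<in> F P (carrier S)"
proof -
  have "(\<lambda>q\<in>P. conjugate S g q) \<in> F P Q"
    using F_subgroup(1)[OF \<psi>] hg P by (intro F_conj_map)
  moreover have "(\<lambda>x\<in>carrier S. conjugate S h x) \<in> F (carrier S) (carrier S)"
    using hg by (intro F_conj_map subgroup_self) simp_all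
  ultimately have "compose P (\<lambda>x\<in>carrier S. conjugate S h x) (compose P \<psi> (\<lambda>q\<in>P. conjugate S g q))
      \<in> F P (carrier S)"
    using \<psi> F_compose by blast
  moreover have "compose P (\<lambda>x\<in>carrier S. conjugate S h x) (compose P \<psi> (\<lambda>q\<in>P. conjugate S g q)) =
      (\<lambda>q\<in>P. conjugate S h (\<psi> (conjugate S g q)))"
    using P(2) F_closed[OF \<psi>] by (auto simp: compose_def fun_eq_iff)
  ultimately show ?thesis
    by simp
qed

lemma F_subconjugate:
  assumes "\<psi> \<in> F Q (carrier S)" "subgroup P S" "\<phi> \<in> extensional P" "subconjugate S S P \<phi> Q \<psi>"
  shows "\<phi> \<in> F P (carrier S)"
proof -
  obtain h g where hg: "h \<in> carrier S" "g \<in> carrier S" "\<And>q. q \<in> P \<Longrightarrow> conjugate S g q \<in> Q"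
    "\<And>q. q \<in> P \<Longrightarrow> \<phi> q = conjugate S h (\<psi> (conjugate S g q))"
    using assms(4) by (rule subconjugateE) (rule that)
  have "\<phi> = (\<lambda>q\<in>P. conjugate S h (\<psi> (conjugate S g q)))"
    using hg(4) assms(3) by (intro extensionalityI[of _ P]) auto
  then show ?thesis
    using F_twist[OF assms(1) hg(1,2) assms(2) hg(3)] by simp
qed

lemma mark_std_nonzero_iff:
  assumes "standard_biset S S Q \<psi>" "subgroup P S" "\<phi> \<in> P \<rightarrow> carrier S"
  shows "mark (std_class Q \<psi>) P (\<lambda>q. q) \<phi> \<noteq> 0 \<longleftrightarrow> subconjugate S S P \<phi> Q \<psi>"
  using assms(1) subgroup.subset[OF assms(2)] assms(3) by (rule standard_biset.mark_nonzero_iff)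

lemma mark_nonzero_imp_F:
  assumes "\<psi> \<in> F Q (carrier S)" "subgroup P S" "\<phi> \<in> P \<rightarrow>\<^sub>E carrier S"
    and "mark (std_class Q \<psi>) P (\<lambda>q. q) \<phi> \<noteq> 0"
  shows "\<phi> \<in> F P (carrier S)"
  using assms mark_std_nonzero_iff[OF F_standard_biset[OF assms(1)] assms(2)]
  by (intro F_subconjugate[OF assms(1,2)]) (auto simp: PiE_def)

end

section \<open>Marks of a characteristic idempotent\<close>

locale char_idempotent = finite_fusion_system S F + finite_burnside_module S S p
  for S :: "('a, 'm) monoid_scheme" (structure) and F :: "'a homsets" and p :: nat +
  fixes \<omega> :: "('a, 'a) burnside_elt"
  assumes p_group: "p_group p S" and char: "characteristic_idempotent p S F \<omega>"
begin

abbreviation \<Phi> :: "'a set \<Rightarrow> ('a \<Rightarrow> 'a) \<Rightarrow> rat"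
  where "\<Phi> P \<phi> \<equiv> b_mark \<omega> P (\<lambda>q. q) \<phi>"

lemma \<omega>_in_burnside: "\<omega> \<in> burnside p S S"
  using char by (simp add: characteristic_idempotent_def)

lemma expansion_in_\<omega>: "std_expansion S S \<omega> \<in> \<omega>"
  and keys_expansion: "Poly_Mapping.keys (std_expansion S S \<omega>) \<subseteq>
    {std_class Q \<psi> | Q \<psi>. \<psi> \<in> F Q (carrier S)}"
proof -
  have "subgroup Q S \<and> \<psi> \<in> F Q (carrier S) \<longleftrightarrow> \<psi> \<in> F Q (carrier S)" for Q \<psi>
    using F_subgroup(1) by blast
  then obtain x where x: "x \<in> \<omega>" "Poly_Mapping.keys x \<subseteq> {std_class Q \<psi> | Q \<psi>. \<psi> \<in> F Q (carrier S)}"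
    using char by (auto simp: characteristic_idempotent_def generated_def)
  have "std_class Q \<psi> \<in> std_classes S S" if "\<psi> \<in> F Q (carrier S)" for Q \<psi>
    unfolding std_classes_def using F_subgroup(1)[OF that] F_hom[OF that] by blast
  then have "{std_class Q \<psi> | Q \<psi>. \<psi> \<in> F Q (carrier S)} \<subseteq> std_classes S S"
    by blast
  with x(2) have "Poly_Mapping.keys x \<subseteq> std_classes S S"
    by (rule subset_trans)
  then have "std_expansion S S \<omega> = x"
    by (rule std_expansion_eqI[OF \<omega>_in_burnside x(1)])
  then show "std_expansion S S \<omega> \<in> \<omega>"
    "Poly_Mapping.keys (std_expansion S S \<omega>) \<subseteq> {std_class Q \<psi> | Q \<psi>. \<psi> \<in> F Q (carrier S)}"
    using x by simp_all
qed

lemma keys_expansionE: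
  assumes "c \<in> Poly_Mapping.keys (std_expansion S S \<omega>)"
  obtains Q \<psi> where "\<psi> \<in> F Q (carrier S)" "c = std_class Q \<psi>"
  using assms keys_expansion by blast

lemma chi_nonzero_iff:
  "chi S S Q \<psi> \<omega> \<noteq> 0 \<longleftrightarrow> std_class Q \<psi> \<in> Poly_Mapping.keys (std_expansion S S \<omega>)"
  by (simp add: chi_eq_lookup in_keys_iff)

lemma \<Phi>_eq_lin_ext:
  assumes "subgroup P S" "\<phi> \<in> P \<rightarrow> carrier S"
  shows "\<Phi> P \<phi> = lin_ext (\<lambda>c. mark c P (\<lambda>q. q) \<phi>) (std_expansion S S \<omega>)"
proof -
  have "(\<lambda>q. q) \<in> P \<rightarrow> carrier S"
    using subgroup.mem_carrier[OF assms(1)] by auto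
  then show ?thesis
    using assms(2) by (intro b_lin_ext_eq SS.additive_on_mark \<omega>_in_burnside expansion_in_\<omega>)
qed

lemma \<Phi>_nonzeroE:
  assumes "subgroup P S" "\<phi> \<in> P \<rightarrow> carrier S" "\<Phi> P \<phi> \<noteq> 0"
  obtains Q \<psi> where "\<psi> \<in> F Q (carrier S)" "chi S S Q \<psi> \<omega> \<noteq> 0" "subconjugate S S P \<phi> Q \<psi>"
proof -
  obtain c where c: "c \<in> Poly_Mapping.keys (std_expansion S S \<omega>)" "mark c P (\<lambda>q. q) \<phi> \<noteq> 0"
    using assms(3) unfolding \<Phi>_eq_lin_ext[OF assms(1,2)] lin_ext_def
    by (metis (no_types, lifting) mult_eq_0_iff sum.neutral)
  obtain Q \<psi> where Q: "\<psi> \<in> F Q (carrier S)" "c = std_class Q \<psi>"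
    using c(1) by (rule keys_expansionE)
  then show ?thesis
    using that c mark_std_nonzero_iff[OF F_standard_biset[OF Q(1)] assms(1,2)] chi_nonzero_iff by simp
qed

lemma \<Phi>_outside_F:
  assumes "subgroup P S" "\<phi> \<in> P \<rightarrow>\<^sub>E carrier S" "\<phi> \<notin> F P (carrier S)"
  shows "\<Phi> P \<phi> = 0"
proof (rule ccontr)
  assume "\<Phi> P \<phi> \<noteq> 0"
  moreover have "\<phi> \<in> P \<rightarrow> carrier S"
    using assms(2) by auto
  ultimately obtain Q \<psi> where "\<psi> \<in> F Q (carrier S)" "subconjugate S S P \<phi> Q \<psi>"
    using assms(1) by (elim \<Phi>_nonzeroE)
  then show False
    using F_subconjugate[OF _ assms(1)] assms(2,3) by (auto simp: PiE_def)
qed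

lemma subgroup_burnside_composition:
  assumes "subgroup P S"
  shows "burnside_composition (sub_group S P) S S p" "burnside_composition S S (sub_group S P) p"
  using subgroup_imp_group[OF assms] p finite_S group_axioms
  by (simp_all add: burnside_composition_def burnside_composition_axioms_def burnside_module_def
    burnside_module_axioms_def group_pair_def)

lemma b_mark_right_stable:
  assumes \<phi>: "\<phi> \<in> F P (carrier S)" and \<chi>: "\<chi> \<in> P \<rightarrow> carrier S"
  shows "b_mark \<omega> P \<phi> \<chi> = \<Phi> P \<chi>"
proof -
  note P = F_subgroup(1)[OF \<phi>]
  interpret burnside_composition "sub_group S P" S S p
    using P by (rule subgroup_burnside_composition)
  have comp: "b_mark (b_comp p (sub_group S P) S S \<omega> (bracket p (sub_group S P) S P \<psi>)) P (\<lambda>q. q) \<chi> =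
      b_mark \<omega> P \<psi> \<chi>" if "\<psi> \<in> F P (carrier S)" for \<psi>
    using b_mark_comp_hom[OF \<omega>_in_burnside, of \<psi> \<chi>] subgroup_finite[OF P] F_hom[OF that] \<chi> by simp
  have incl: "(\<lambda>x\<in>P. x) \<in> F P (carrier S)"
    using P subgroup.subset[OF P] by (intro F_inclusion subgroup_self)
  have "b_comp p (sub_group S P) S S \<omega> (bracket p (sub_group S P) S P \<phi>) =
      b_comp p (sub_group S P) S S \<omega> (bracket p (sub_group S P) S P (\<lambda>x\<in>P. x))"
    using char \<phi> P unfolding characteristic_idempotent_def right_stable_def by blast
  then have "b_mark \<omega> P \<phi> \<chi> = b_mark \<omega> P (\<lambda>x\<in>P. x) \<chi>"
    using comp[OF \<phi>] comp[OF incl] by simp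
  also have "\<dots> = \<Phi> P \<chi>"
    by (intro b_mark_cong) simp_all
  finally show ?thesis .
qed

lemma \<Phi>_left_stable:
  assumes \<phi>: "\<phi> \<in> F P (carrier S)"
  shows "\<Phi> P \<phi> = \<Phi> P (\<lambda>x\<in>P. x)"
proof -
  note P = F_subgroup(1)[OF \<phi>]
  interpret burnside_composition S S "sub_group S P" p
    using P by (rule subgroup_burnside_composition)
  have comp: "b_mark (b_comp p S S (sub_group S P)
      (bracket p S (sub_group S P) (\<psi> ` P) (inv_map P \<psi>)) \<omega>) P (\<lambda>q. q) (\<lambda>q. q) = \<Phi> P \<psi>"
    if "\<psi> \<in> F P (carrier S)" for \<psi>
    using b_mark_mon_inv_comp[OF \<omega>_in_burnside, of \<psi> "\<lambda>q. q"] subgroup_finite[OF P]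
      F_hom[OF that] F_inj_on[OF that] subgroup.mem_carrier[OF P] by (simp add: mon_def)
  have incl: "(\<lambda>x\<in>P. x) \<in> F P (carrier S)"
    using P subgroup.subset[OF P] by (intro F_inclusion subgroup_self)
  have "inv_map P (\<lambda>x\<in>P. x) = (\<lambda>x\<in>P. x)"
    using inv_map_apply[of "\<lambda>x\<in>P. x" P] by (auto simp: fun_eq_iff inj_on_def inv_map_def)
  then have "b_comp p S S (sub_group S P) (bracket p S (sub_group S P) (\<phi> ` P) (inv_map P \<phi>)) \<omega> =
      b_comp p S S (sub_group S P)
        (bracket p S (sub_group S P) ((\<lambda>x\<in>P. x) ` P) (inv_map P (\<lambda>x\<in>P. x))) \<omega>"
    using char \<phi> P unfolding characteristic_idempotent_def left_stable_def by auto
  then show ?thesis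
    using comp[OF \<phi>] comp[OF incl] by simp
qed

lemma sum_\<Phi>:
  assumes "subgroup P S"
  shows "(\<Sum>\<eta>\<in>P \<rightarrow>\<^sub>E carrier S. \<Phi> P \<eta>) = of_nat (card (F P (carrier S))) * \<Phi> P (\<lambda>x\<in>P. x)"
proof -
  have "(\<Sum>\<eta>\<in>P \<rightarrow>\<^sub>E carrier S. \<Phi> P \<eta>) = (\<Sum>\<eta>\<in>F P (carrier S). \<Phi> P \<eta>)"
    using F_PiE \<Phi>_outside_F[OF assms] subgroup_finite[OF assms] finite_S
    by (intro sum.mono_neutral_right finite_PiE) auto
  also have "\<dots> = (\<Sum>\<eta>\<in>F P (carrier S). \<Phi> P (\<lambda>x\<in>P. x))"
    by (intro sum.cong refl \<Phi>_left_stable)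
  finally show ?thesis
    by simp
qed

lemma sum_\<Phi>_nonzero:
  assumes P: "subgroup P S"
  shows "(\<Sum>\<eta>\<in>P \<rightarrow>\<^sub>E carrier S. \<Phi> P \<eta>) \<noteq> 0"
proof
  assume zero: "(\<Sum>\<eta>\<in>P \<rightarrow>\<^sub>E carrier S. \<Phi> P \<eta>) = 0"
  obtain n where "card P dvd p ^ n"
    using lagrange[OF P] p_group unfolding p_group_def by (metis dvd_triv_right)
  then obtain m where "card P = p ^ m"
    using p by (meson divides_primepow_nat)
  then obtain z where z: "z \<in> Z_loc p" "b_lin_ext (degree_class S S) \<omega> = of_nat p * z"
    using degree_congruence[OF P _ \<omega>_in_burnside] zero by auto
  have "augmentation p S \<omega> = of_nat p * z"
    unfolding z(2)[symmetric] using finite_burnside_module_axioms \<omega>_in_burnside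
    by (rule augmentation_eq_degree)
  then show False
    using char z(1) by (auto simp: characteristic_idempotent_def)
qed

lemma \<Phi>_idempotent:
  assumes P: "subgroup P S" and \<chi>: "\<chi> \<in> P \<rightarrow> carrier S"
  shows "of_nat (card (carrier S)) * \<Phi> P \<chi> = \<Phi> P \<chi> * (\<Sum>\<eta>\<in>P \<rightarrow>\<^sub>E carrier S. \<Phi> P \<eta>)"
proof -
  interpret burnside_composition S S S p
    using finite_S by unfold_locales
  have id: "(\<lambda>q. q) \<in> P \<rightarrow> carrier S"
    using subgroup.mem_carrier[OF P] by auto
  have "b_comp p S S S \<omega> \<omega> = \<omega>"
    using char by (simp add: characteristic_idempotent_def)
  then have "of_nat (card (carrier S)) * \<Phi> P \<chi> = (\<Sum>\<eta>\<in>P \<rightarrow>\<^sub>E carrier S. b_mark \<omega> P \<eta> \<chi> * \<Phi> P \<eta>)"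
    using b_mark_comp[OF \<omega>_in_burnside \<omega>_in_burnside subgroup_finite[OF P] id \<chi>] by simp
  also have "\<dots> = (\<Sum>\<eta>\<in>P \<rightarrow>\<^sub>E carrier S. \<Phi> P \<chi> * \<Phi> P \<eta>)"
    using b_mark_right_stable[OF _ \<chi>] \<Phi>_outside_F[OF P] by (intro sum.cong refl) (metis mult_zero_right)
  finally show ?thesis
    by (simp add: sum_distrib_left)
qed

theorem \<Phi>_eq:
  assumes \<phi>: "\<phi> \<in> F P (carrier S)"
  shows "\<Phi> P \<phi> = of_nat (card (carrier S)) / of_nat (card (F P (carrier S)))"
proof -
  note P = F_subgroup(1)[OF \<phi>]
  let ?i = "\<lambda>x\<in>P. x"
  have "?i \<in> P \<rightarrow> carrier S"
    using subgroup.mem_carrier[OF P] by auto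
  then have "of_nat (card (carrier S)) * \<Phi> P ?i = \<Phi> P ?i * (of_nat (card (F P (carrier S))) * \<Phi> P ?i)"
    using \<Phi>_idempotent[OF P] sum_\<Phi>[OF P] by simp
  moreover have "of_nat (card (F P (carrier S))) * \<Phi> P ?i \<noteq> 0"
    using sum_\<Phi>_nonzero[OF P] sum_\<Phi>[OF P] by simp
  ultimately show ?thesis
    by (simp add: \<Phi>_left_stable[OF \<phi>] field_simps)
qed

lemma \<Phi>_nonzero:
  assumes "\<phi> \<in> F P (carrier S)"
  shows "\<Phi> P \<phi> \<noteq> 0"
proof -
  have "F P (carrier S) \<noteq> {}" "carrier S \<noteq> {}"
    using assms one_closed by blast+
  then show ?thesis
    by (simp add: \<Phi>_eq[OF assms] finite_F finite_S)
qed

end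

section \<open>Normal subgroups of a fusion system\<close>

context group
begin

lemma normal_of_normalizer_eq_carrier:
  assumes "subgroup U G" "normalizer G U = carrier G"
  shows "U \<lhd> G"
  using subgroup_in_normalizer[OF assms(1)] assms(2) by simp

lemma
  assumes "U \<lhd> G" "subgroup P G"
  shows subgroup_set_mult_normal: "subgroup (P <#> U) G"
    and subset_set_mult_normal: "P \<subseteq> P <#> U"
    and normal_subset_set_mult: "U \<subseteq> P <#> U"
proof -
  note U = normal_imp_subgroup[OF assms(1)]
  show "subgroup (P <#> U) G"
    using mult_norm_subgroup[OF assms] commut_normal[OF assms(2,1)] by simp
  show "P \<subseteq> P <#> U"
    using subgroup.one_closed[OF U] subgroup.mem_carrier[OF assms(2)]
    by (force simp: set_mult_def)
  show "U \<subseteq> P <#> U"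
    using subgroup.one_closed[OF assms(2)] subgroup.mem_carrier[OF U]
    by (force simp: set_mult_def)
qed

end

context finite_fusion_system
begin

lemma F_image_set_mult:
  assumes "\<theta> \<in> F T (carrier S)" "I \<subseteq> T" "J \<subseteq> T"
  shows "\<theta> ` (I <#> J) = (\<theta> ` I) <#> (\<theta> ` J)"
  using set_mult_hom[OF F_hom[OF assms(1)], of I J] assms(2,3) by simp

lemma normalizer_systemD:
  assumes "\<phi> \<in> normalizer_system S F U P Q"
  shows "\<phi> \<in> F P Q" and "P \<subseteq> normalizer S U" and "U \<subseteq> P \<Longrightarrow> \<phi> ` U = U"
    and "\<exists>\<theta>\<in>F (P <#> U) (Q <#> U). restrict \<theta> P = \<phi> \<and> \<theta> ` U = U"
proof -
  have P: "subgroup P (sub_group S (normalizer S U))" and \<phi>: "\<phi> \<in> F P Q"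
    and ext: "\<exists>\<theta>\<in>F (P <#> U) (Q <#> U). restrict \<theta> P = \<phi> \<and> \<theta> ` U = U"
    using assms by (auto simp: normalizer_system_def split: if_splits)
  show "\<phi> \<in> F P Q" "\<exists>\<theta>\<in>F (P <#> U) (Q <#> U). restrict \<theta> P = \<phi> \<and> \<theta> ` U = U"
    by fact+
  show "P \<subseteq> normalizer S U"
    using subgroup.subset[OF P] by simp
  obtain \<theta> where \<theta>: "restrict \<theta> P = \<phi>" "\<theta> ` U = U"
    using ext by blast
  show "\<phi> ` U = U" if "U \<subseteq> P"
  proof -
    have "\<phi> ` U = \<theta> ` U"
      using that unfolding \<theta>(1)[symmetric] by (intro image_cong) auto
    then show ?thesis
      using \<theta>(2) by simp
  qed
qed

end

subsection \<open>A basis supported on the normalizer system\<close>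

locale supported_idempotent = char_idempotent S F p \<omega>
  for S :: "('a, 'm) monoid_scheme" (structure) and F :: "'a homsets" and p \<omega> +
  fixes U :: "'a set"
  assumes subgroup_U: "subgroup U S"
    and support: "\<lbrakk>\<psi> \<in> F Q (carrier S); chi S S Q \<psi> \<omega> \<noteq> 0\<rbrakk> \<Longrightarrow>
      U \<subseteq> Q \<and> (\<exists>R. \<psi> \<in> normalizer_system S F U Q R)"
begin

lemma F_subconjugateE:
  assumes "\<phi> \<in> F P (carrier S)"
  obtains Q \<psi> where "\<psi> \<in> F Q (carrier S)" "subconjugate S S P \<phi> Q \<psi>"
    and "U \<subseteq> Q" "\<psi> ` U = U" "Q \<subseteq> normalizer S U"
proof -
  have "\<phi> \<in> P \<rightarrow> carrier S"
    using F_closed[OF assms] by auto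
  then obtain Q \<psi> where Q: "\<psi> \<in> F Q (carrier S)" "chi S S Q \<psi> \<omega> \<noteq> 0" "subconjugate S S P \<phi> Q \<psi>"
    using F_subgroup(1)[OF assms] \<Phi>_nonzero[OF assms] by (elim \<Phi>_nonzeroE)
  then show ?thesis
    using that support normalizer_systemD(2,3) by meson
qed

lemma normalizer_U: "normalizer S U = carrier S"
proof
  show "normalizer S U \<subseteq> carrier S"
    by (auto simp: normalizer_def stabilizer_def)
  have "(\<lambda>x\<in>carrier S. x) \<in> F (carrier S) (carrier S)"
    by (intro F_inclusion subgroup_self) simp
  then obtain Q \<psi> where Q: "subconjugate S S (carrier S) (\<lambda>x\<in>carrier S. x) Q \<psi>" "Q \<subseteq> normalizer S U"
    by (rule F_subconjugateE)
  obtain g where g: "g \<in> carrier S" "\<And>x. x \<in> carrier S \<Longrightarrow> conjugate S g x \<in> Q"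
    using Q(1) by (rule subconjugateE) (rule that)
  have "carrier S \<subseteq> Q"
    using g(1) by (rule subset_of_conjugate_subset[where B = "carrier S"]) (simp_all add: g)
  then show "carrier S \<subseteq> normalizer S U"
    using Q(2) by (rule subset_trans)
qed

lemma normal_U: "U \<lhd> S"
  using subgroup_U normalizer_U by (rule normal_of_normalizer_eq_carrier)

lemma F_extends_to_set_mult:
  assumes \<phi>: "\<phi> \<in> F P R"
  shows "\<exists>\<theta>\<in>F (P <#> U) (R <#> U). restrict \<theta> P = \<phi> \<and> \<theta> ` U = U"
proof -
  note P = F_subgroup(1)[OF \<phi>] and R = F_subgroup(2)[OF \<phi>]
  note PU = subgroup_set_mult_normal[OF normal_U P] subset_set_mult_normal[OF normal_U P]
    normal_subset_set_mult[OF normal_U P]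
  obtain Q \<psi> where Q: "\<psi> \<in> F Q (carrier S)" "subconjugate S S P \<phi> Q \<psi>" "U \<subseteq> Q" "\<psi> ` U = U"
    using F_into_carrier[OF \<phi>] by (rule F_subconjugateE)
  obtain h g where hg: "h \<in> carrier S" "g \<in> carrier S" "\<And>q. q \<in> P \<Longrightarrow> conjugate S g q \<in> Q"
    "\<And>q. q \<in> P \<Longrightarrow> \<phi> q = conjugate S h (\<psi> (conjugate S g q))"
    using Q(2) by (rule subconjugateE) (rule that)
  define \<theta> where "\<theta> = (\<lambda>q\<in>P <#> U. conjugate S h (\<psi> (conjugate S g q)))"
  have "conjugate S g q \<in> Q" if "q \<in> P <#> U" for q
    using F_subgroup(1)[OF Q(1)] normal_U Q(3) hg(2) subgroup.subset[OF P] hg(3) that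
    by (rule conjugate_set_mult_closed)
  then have \<theta>: "\<theta> \<in> F (P <#> U) (carrier S)"
    unfolding \<theta>_def using Q(1) hg(1,2) PU(1) by (intro F_twist)
  have \<theta>_P: "\<theta> q = \<phi> q" if "q \<in> P" for q
    using that PU(2) hg(4) by (auto simp: \<theta>_def)
  have "\<theta> u \<in> U" if u: "u \<in> U" for u
  proof -
    have "\<psi> (conjugate S g u) \<in> U"
      using normal_conjugate_closed[OF normal_U hg(2) u] Q(4) by blast
    then show ?thesis
      using normal_conjugate_closed[OF normal_U hg(1)] u PU(3) by (auto simp: \<theta>_def)
  qed
  then have \<theta>_U: "\<theta> ` U = U"
    using inj_on_subset[OF F_inj_on[OF \<theta>] PU(3)] subgroup_finite[OF subgroup_U]
    by (intro endo_inj_surj) auto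
  have "\<theta> ` P \<subseteq> R"
    using \<theta>_P F_closed[OF \<phi>] by auto
  then have "\<theta> ` (P <#> U) \<subseteq> R <#> U"
    unfolding F_image_set_mult[OF \<theta> PU(2,3)] \<theta>_U by (rule mono_set_mult) simp
  then have "\<theta> \<in> F (P <#> U) (R <#> U)"
    using subgroup_set_mult_normal[OF normal_U R] by (intro F_codomain[OF \<theta>])
  moreover have "restrict \<theta> P = \<phi>"
    using \<theta>_P F_extensional[OF \<phi>] by (intro extensionalityI[of _ P]) auto
  ultimately show ?thesis
    using \<theta>_U by blast
qed

lemma F_eq_normalizer_system: "F = normalizer_system S F U"
proof (intro ext equalityI subsetI)
  show "\<phi> \<in> normalizer_system S F U P R" if "\<phi> \<in> F P R" for \<phi> P R
    using that F_subgroup[OF that] F_extends_to_set_mult[OF that]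
    by (simp add: normalizer_system_def normalizer_U)
  show "\<phi> \<in> F P R" if "\<phi> \<in> normalizer_system S F U P R" for \<phi> P R
    using that by (rule normalizer_systemD(1))
qed

end

subsection \<open>Extending morphisms over a normal subgroup\<close>

locale normal_in_fusion = char_idempotent S F p \<omega>
  for S :: "('a, 'm) monoid_scheme" (structure) and F :: "'a homsets" and p \<omega> +
  fixes U :: "'a set"
  assumes normal_U: "U \<lhd> S" and F_eq: "F = normalizer_system S F U"
begin

lemmas subgroup_PU = subgroup_set_mult_normal[OF normal_U]
  and P_subset_PU = subset_set_mult_normal[OF normal_U]
  and U_subset_PU = normal_subset_set_mult[OF normal_U]

definition extensions :: "'a set \<Rightarrow> ('a \<Rightarrow> 'a) \<Rightarrow> ('a \<Rightarrow> 'a) set"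
  where "extensions P \<phi> = {\<theta> \<in> F (P <#> U) (carrier S). restrict \<theta> P = \<phi>}"

lemma finite_extensions: "finite (extensions P \<phi>)"
  using finite_F by (simp add: extensions_def)

lemma extensions_apply: "\<lbrakk>\<theta> \<in> extensions P \<phi>; q \<in> P\<rbrakk> \<Longrightarrow> \<theta> q = \<phi> q"
  by (auto simp: extensions_def)

lemma F_image_U: "\<lbrakk>\<phi> \<in> F R (carrier S); U \<subseteq> R\<rbrakk> \<Longrightarrow> \<phi> ` U = U"
  using F_eq normalizer_systemD(3) by metis

lemma extensions_nonempty:
  assumes "\<phi> \<in> F P (carrier S)"
  shows "extensions P \<phi> \<noteq> {}"
proof -
  have "\<phi> \<in> normalizer_system S F U P (carrier S)"
    using assms F_eq by metis
  then obtain \<theta> where "\<theta> \<in> F (P <#> U) (carrier S <#> U)" "restrict \<theta> P = \<phi>"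
    using normalizer_systemD(4) by blast
  then show ?thesis
    using F_into_carrier by (auto simp: extensions_def)
qed

lemma extensions_image:
  assumes "subgroup P S" "\<theta> \<in> extensions P \<phi>"
  shows "\<theta> ` (P <#> U) = (\<phi> ` P) <#> U"
proof -
  have \<theta>: "\<theta> \<in> F (P <#> U) (carrier S)"
    using assms(2) by (simp add: extensions_def)
  have "\<theta> ` P = \<phi> ` P"
    using extensions_apply[OF assms(2)] by simp
  then show ?thesis
    using F_image_set_mult[OF \<theta> P_subset_PU[OF assms(1)] U_subset_PU[OF assms(1)]]
      F_image_U[OF \<theta> U_subset_PU[OF assms(1)]] by simp
qed

lemma ex_transition:
  assumes \<phi>: "\<phi> \<in> F P (carrier S)" and \<phi>': "\<phi>' \<in> F P (carrier S)"
  obtains \<tau> where "\<tau> \<in> F ((\<phi> ` P) <#> U) (carrier S)" "\<And>q. q \<in> P \<Longrightarrow> \<tau> (\<phi> q) = \<phi>' q"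
proof -
  note P = F_subgroup(1)[OF \<phi>]
  let ?T = "P <#> U"
  obtain \<theta> \<theta>' where ext: "\<theta> \<in> extensions P \<phi>" "\<theta>' \<in> extensions P \<phi>'"
    using extensions_nonempty[OF \<phi>] extensions_nonempty[OF \<phi>'] by blast
  then have \<theta>: "\<theta> \<in> F ?T (carrier S)" and \<theta>': "\<theta>' \<in> F ?T (carrier S)"
    by (simp_all add: extensions_def)
  let ?\<tau> = "compose (\<theta> ` ?T) \<theta>' (inv_map ?T \<theta>)"
  have "?\<tau> \<in> F (\<theta> ` ?T) (carrier S)"
    using F_inv_map[OF \<theta>] \<theta>' by (rule F_compose)
  moreover have "?\<tau> (\<phi> q) = \<phi>' q" if q: "q \<in> P" for q
  proof -
    have "q \<in> ?T"
      using q P_subset_PU[OF P] by blast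
    then have "?\<tau> (\<theta> q) = \<theta>' q"
      using F_inj_on[OF \<theta>] by (simp add: compose_def)
    then show ?thesis
      using extensions_apply[OF ext(1) q] extensions_apply[OF ext(2) q] by simp
  qed
  ultimately show ?thesis
    using that extensions_image[OF P ext(1)] by simp
qed

lemma card_extensions_le:
  assumes \<phi>: "\<phi> \<in> F P (carrier S)" and \<phi>': "\<phi>' \<in> F P (carrier S)"
  shows "card (extensions P \<phi>) \<le> card (extensions P \<phi>')"
proof -
  note P = F_subgroup(1)[OF \<phi>]
  let ?T = "P <#> U"
  obtain \<tau> where \<tau>: "\<tau> \<in> F ((\<phi> ` P) <#> U) (carrier S)" "\<And>q. q \<in> P \<Longrightarrow> \<tau> (\<phi> q) = \<phi>' q"
    using \<phi> \<phi>' by (rule ex_transition) (rule that)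
  show ?thesis
  proof (rule card_inj_on_le[of "compose ?T \<tau>"])
    show "compose ?T \<tau> ` extensions P \<phi> \<subseteq> extensions P \<phi>'"
    proof (rule image_subsetI)
      fix \<eta> assume \<eta>: "\<eta> \<in> extensions P \<phi>"
      have "\<eta> \<in> F ?T ((\<phi> ` P) <#> U)"
        unfolding extensions_image[OF P \<eta>, symmetric]
        using \<eta> by (intro F_image[of _ _ "carrier S"]) (simp add: extensions_def)
      then have "compose ?T \<tau> \<eta> \<in> F ?T (carrier S)"
        using \<tau>(1) by (rule F_compose)
      moreover have "compose ?T \<tau> \<eta> q = \<phi>' q" if q: "q \<in> P" for q
        using subsetD[OF P_subset_PU[OF P] q] \<tau>(2)[OF q] extensions_apply[OF \<eta> q]
        by (simp add: compose_eq)
      then have "restrict (compose ?T \<tau> \<eta>) P = \<phi>'"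
        using F_extensional[OF \<phi>'] by (intro extensionalityI[of _ P]) auto
      ultimately show "compose ?T \<tau> \<eta> \<in> extensions P \<phi>'"
        by (simp add: extensions_def)
    qed
    show "inj_on (compose ?T \<tau>) (extensions P \<phi>)"
    proof (intro inj_onI extensionalityI[of _ ?T])
      fix \<eta> \<eta>' assume \<eta>: "\<eta> \<in> extensions P \<phi>" "\<eta>' \<in> extensions P \<phi>"
        and eq: "compose ?T \<tau> \<eta> = compose ?T \<tau> \<eta>'"
      show "\<eta> \<in> extensional ?T" "\<eta>' \<in> extensional ?T"
        using \<eta> F_extensional by (auto simp: extensions_def)
      fix x assume x: "x \<in> ?T"
      then have "\<tau> (\<eta> x) = \<tau> (\<eta>' x)"
        using eq by (metis compose_eq)
      moreover have "\<eta> x \<in> (\<phi> ` P) <#> U" "\<eta>' x \<in> (\<phi> ` P) <#> U"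
        using extensions_image[OF P \<eta>(1)] extensions_image[OF P \<eta>(2)] x by blast+
      ultimately show "\<eta> x = \<eta>' x"
        by (rule inj_onD[OF F_inj_on[OF \<tau>(1)]])
    qed
  qed (rule finite_extensions)
qed

lemma card_extensions:
  assumes \<phi>: "\<phi> \<in> F P (carrier S)"
  shows "card (extensions P \<phi>) * card (F P (carrier S)) = card (F (P <#> U) (carrier S))"
proof -
  note P = F_subgroup(1)[OF \<phi>]
  have "card (F (P <#> U) (carrier S)) = (\<Sum>\<psi>\<in>F P (carrier S). card (extensions P \<psi>))"
  proof (rule sum_card_unique_cover[symmetric])
    show "\<exists>!\<psi>. \<psi> \<in> F P (carrier S) \<and> \<theta> \<in> extensions P \<psi>" if "\<theta> \<in> F (P <#> U) (carrier S)" for \<theta>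
      using F_restrict[OF that P P_subset_PU[OF P]] that by (auto simp: extensions_def)
  qed (simp_all add: finite_F extensions_def)
  also have "\<dots> = (\<Sum>\<psi>\<in>F P (carrier S). card (extensions P \<phi>))"
    by (intro sum.cong refl antisym card_extensions_le \<phi>)
  finally show ?thesis
    by simp
qed

lemma ex_extension_fixed:
  assumes \<psi>: "\<psi> \<in> F Q (carrier S)" and UQ: "U \<subseteq> Q" and \<phi>: "\<phi> \<in> F P (carrier S)"
    and x: "x \<in> fixed_points (std_biset S S Q \<psi>) P (\<lambda>q. q) \<phi>"
  shows "\<exists>\<theta>\<in>extensions P \<phi>. x \<in> fixed_points (std_biset S S Q \<psi>) (P <#> U) (\<lambda>q. q) \<theta>"
proof -
  interpret Q: standard_biset S S Q \<psi>
    using \<psi> by (rule F_standard_biset)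
  note P = F_subgroup(1)[OF \<phi>]
  note PU = subgroup_PU[OF P]
  let ?T = "P <#> U"
  have "x \<in> points (std_biset S S Q \<psi>)"
    using x by (simp add: fixed_points_def)
  then obtain h g where hg: "h \<in> carrier S" "g \<in> carrier S" "x = std_point S S Q \<psi> h g"
    by (rule Q.std_pointE)
  have "\<phi> \<in> P \<rightarrow> carrier S"
    using F_closed[OF \<phi>] by auto
  then have twist: "conjugate S g q \<in> Q" "\<phi> q = conjugate S h (\<psi> (conjugate S g q))" if "q \<in> P" for q
    using x that Q.std_point_fixed_iff[OF hg(1,2) subgroup.subset[OF P]] unfolding hg(3) by blast+
  let ?\<theta> = "\<lambda>q\<in>?T. conjugate S h (\<psi> (conjugate S g q))"
  have conj: "conjugate S g q \<in> Q" if "q \<in> ?T" for q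
    using Q.subgroup_K normal_U UQ hg(2) subgroup.subset[OF P] twist(1) that
    by (rule conjugate_set_mult_closed)
  then have \<theta>: "?\<theta> \<in> F ?T (carrier S)"
    using \<psi> hg(1,2) PU by (intro F_twist)
  have "restrict ?\<theta> P = \<phi>"
  proof (rule extensionalityI[OF restrict_extensional F_extensional[OF \<phi>]])
    show "restrict ?\<theta> P q = \<phi> q" if "q \<in> P" for q
      using that P_subset_PU[OF P] twist(2) by auto
  qed
  then have "?\<theta> \<in> extensions P \<phi>"
    using \<theta> unfolding extensions_def by blast
  moreover have "?\<theta> \<in> ?T \<rightarrow> carrier S"
    using F_closed[OF \<theta>] by auto
  then have "x \<in> fixed_points (std_biset S S Q \<psi>) ?T (\<lambda>q. q) ?\<theta>"
    unfolding hg(3) using conj Q.std_point_fixed_iff[OF hg(1,2) subgroup.subset[OF PU]] by simp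
  ultimately show ?thesis
    by blast
qed

lemma mark_eq_sum_extensions:
  assumes \<psi>: "\<psi> \<in> F Q (carrier S)" and UQ: "U \<subseteq> Q" and \<phi>: "\<phi> \<in> F P (carrier S)"
  shows "mark (std_class Q \<psi>) P (\<lambda>q. q) \<phi> =
    (\<Sum>\<theta>\<in>extensions P \<phi>. mark (std_class Q \<psi>) (P <#> U) (\<lambda>q. q) \<theta>)"
proof -
  interpret Q: standard_biset S S Q \<psi>
    using \<psi> by (rule F_standard_biset)
  note P = F_subgroup(1)[OF \<phi>]
  let ?B = "std_biset S S Q \<psi>" and ?T = "P <#> U"
  have mark: "mark (std_class Q \<psi>) R (\<lambda>q. q) \<eta> = of_nat (card (fixed_points ?B R (\<lambda>q. q) \<eta>))"
    if "\<eta> \<in> F R (carrier S)" for R \<eta>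
    using subgroup.mem_carrier[OF F_subgroup(1)[OF that]] F_closed[OF that]
    by (intro Q.mark_iso_class) auto
  have "(\<Sum>\<theta>\<in>extensions P \<phi>. card (fixed_points ?B ?T (\<lambda>q. q) \<theta>)) = card (fixed_points ?B P (\<lambda>q. q) \<phi>)"
  proof (rule sum_card_unique_cover)
    show "fixed_points ?B ?T (\<lambda>q. q) \<theta> \<subseteq> fixed_points ?B P (\<lambda>q. q) \<phi>" if "\<theta> \<in> extensions P \<phi>" for \<theta>
      using P_subset_PU[OF P] extensions_apply[OF that] by (auto simp: fixed_points_def)
    have "\<theta> = \<theta>'" if "\<theta> \<in> extensions P \<phi>" "x \<in> fixed_points ?B ?T (\<lambda>q. q) \<theta>"
      "\<theta>' \<in> extensions P \<phi>" "x \<in> fixed_points ?B ?T (\<lambda>q. q) \<theta>'" for x \<theta> \<theta>'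
      using that F_PiE by (intro Q.fixed_points_twist_unique[OF that(2,4)]) (auto simp: extensions_def)
    then show "\<exists>!\<theta>. \<theta> \<in> extensions P \<phi> \<and> x \<in> fixed_points ?B ?T (\<lambda>q. q) \<theta>"
      if "x \<in> fixed_points ?B P (\<lambda>q. q) \<phi>" for x
      using ex_extension_fixed[OF \<psi> UQ \<phi> that] by blast
  qed (simp_all add: finite_extensions)
  moreover have "mark (std_class Q \<psi>) ?T (\<lambda>q. q) \<theta> = of_nat (card (fixed_points ?B ?T (\<lambda>q. q) \<theta>))"
    if "\<theta> \<in> extensions P \<phi>" for \<theta>
    using that by (intro mark) (simp add: extensions_def)
  ultimately show ?thesis
    by (simp add: mark[OF \<phi>] flip: of_nat_sum)
qed

lemma subset_of_subconjugate:
  assumes "subconjugate S S R \<theta> Q \<psi>" "U \<subseteq> R"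
  shows "U \<subseteq> Q"
proof -
  obtain g where g: "g \<in> carrier S" "\<And>q. q \<in> R \<Longrightarrow> conjugate S g q \<in> Q"
    using assms(1) by (rule subconjugateE) (rule that)
  show ?thesis
  proof (rule subset_of_conjugate_subset[OF g(1)])
    show "U \<subseteq> carrier S"
      using normal_imp_subgroup[OF normal_U] by (rule subgroup.subset)
    show "conjugate S (inv g) u \<in> R" if "u \<in> U" for u
      using normal_conjugate_closed[OF normal_U _ that] g(1) assms(2) by auto
  qed (rule g(2))
qed

end

subsection \<open>The part of the idempotent supported over a normal subgroup\<close>

definition restrict_keys :: "'c set \<Rightarrow> ('c \<Rightarrow>\<^sub>0 rat) \<Rightarrow> ('c \<Rightarrow>\<^sub>0 rat)"
  where "restrict_keys A x =
    (\<Sum>c\<in>Poly_Mapping.keys x \<inter> A. Poly_Mapping.single c (Poly_Mapping.lookup x c))"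

lemma keys_restrict_keys: "Poly_Mapping.keys (restrict_keys A x) = Poly_Mapping.keys x \<inter> A"
  by (auto simp: restrict_keys_def in_keys_iff lookup_sum lookup_single when_def split: if_splits)

lemma lin_ext_restrict_keys:
  "lin_ext f (restrict_keys A x) = (\<Sum>c\<in>Poly_Mapping.keys x \<inter> A. Poly_Mapping.lookup x c * f c)"
  by (simp add: restrict_keys_def lin_ext_sum)

lemma lin_ext_restrict_keys_Compl:
  "lin_ext f x = lin_ext f (restrict_keys A x) + lin_ext f (restrict_keys (- A) x)"
  unfolding lin_ext_restrict_keys lin_ext_def[of f x] Diff_eq[symmetric]
  by (rule sum.Int_Diff) simp

context normal_in_fusion
begin

definition over_U :: "('a, 'a) biset_class set"
  where "over_U = {std_class Q \<psi> | Q \<psi>. \<psi> \<in> F Q (carrier S) \<and> U \<subseteq> Q}"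

abbreviation expansion_over_U :: "('a, 'a) biset_class \<Rightarrow>\<^sub>0 rat"
  where "expansion_over_U \<equiv> restrict_keys over_U (std_expansion S S \<omega>)"

abbreviation expansion_not_over_U :: "('a, 'a) biset_class \<Rightarrow>\<^sub>0 rat"
  where "expansion_not_over_U \<equiv> restrict_keys (- over_U) (std_expansion S S \<omega>)"

lemma mark_not_over_U:
  assumes "c \<in> Poly_Mapping.keys expansion_not_over_U" and \<theta>: "\<theta> \<in> F R (carrier S)" and "U \<subseteq> R"
  shows "mark c R (\<lambda>q. q) \<theta> = 0"
proof (rule ccontr)
  assume nonzero: "mark c R (\<lambda>q. q) \<theta> \<noteq> 0"
  have c: "c \<in> Poly_Mapping.keys (std_expansion S S \<omega>)" "c \<notin> over_U"
    using assms(1) by (simp_all add: keys_restrict_keys)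
  obtain Q \<psi> where Q: "\<psi> \<in> F Q (carrier S)" "c = std_class Q \<psi>"
    using c(1) by (rule keys_expansionE)
  have "\<theta> \<in> R \<rightarrow> carrier S"
    using F_closed[OF \<theta>] by auto
  then have "subconjugate S S R \<theta> Q \<psi>"
    using nonzero mark_std_nonzero_iff[OF F_standard_biset[OF Q(1)] F_subgroup(1)[OF \<theta>]] Q(2) by simp
  then have "U \<subseteq> Q"
    using assms(3) by (rule subset_of_subconjugate)
  then show False
    using c(2) Q by (auto simp: over_U_def)
qed

lemma \<Phi>_eq_mark_over_U_of_subset:
  assumes "\<theta> \<in> F R (carrier S)" "U \<subseteq> R"
  shows "lin_ext (\<lambda>c. mark c R (\<lambda>q. q) \<theta>) expansion_over_U = \<Phi> R \<theta>"
proof -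
  have "lin_ext (\<lambda>c. mark c R (\<lambda>q. q) \<theta>) expansion_not_over_U = 0"
    unfolding lin_ext_def using mark_not_over_U[OF _ assms] by (intro sum.neutral) auto
  moreover have "\<theta> \<in> R \<rightarrow> carrier S"
    using F_closed[OF assms(1)] by auto
  ultimately show ?thesis
    using \<Phi>_eq_lin_ext[OF F_subgroup(1)[OF assms(1)], of \<theta>]
      lin_ext_restrict_keys_Compl[of "\<lambda>c. mark c R (\<lambda>q. q) \<theta>" "std_expansion S S \<omega>" over_U] by simp
qed

text \<open>The left-hand side counts extensions: there are \<open>|F(PU, S)| / |F(P, S)|\<close> of them, and each contributes
  \<open>|S| / |F(PU, S)|\<close>.\<close>

lemma \<Phi>_eq_mark_over_U:
  assumes \<phi>: "\<phi> \<in> F P (carrier S)"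
  shows "lin_ext (\<lambda>c. mark c P (\<lambda>q. q) \<phi>) expansion_over_U = \<Phi> P \<phi>"
proof -
  note P = F_subgroup(1)[OF \<phi>]
  let ?T = "P <#> U"
  have "lin_ext (\<lambda>c. mark c P (\<lambda>q. q) \<phi>) expansion_over_U =
      lin_ext (\<lambda>c. \<Sum>\<theta>\<in>extensions P \<phi>. mark c ?T (\<lambda>q. q) \<theta>) expansion_over_U"
  proof (rule lin_ext_cong)
    fix c assume "c \<in> Poly_Mapping.keys expansion_over_U"
    then obtain Q \<psi> where "\<psi> \<in> F Q (carrier S)" "U \<subseteq> Q" "c = std_class Q \<psi>"
      by (auto simp: keys_restrict_keys over_U_def)
    then show "mark c P (\<lambda>q. q) \<phi> = (\<Sum>\<theta>\<in>extensions P \<phi>. mark c ?T (\<lambda>q. q) \<theta>)"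
      using \<phi> by (simp add: mark_eq_sum_extensions)
  qed
  also have "\<dots> = (\<Sum>\<theta>\<in>extensions P \<phi>. \<Phi> ?T \<theta>)"
    unfolding lin_ext_fun_sum
    using U_subset_PU[OF P] by (intro sum.cong refl \<Phi>_eq_mark_over_U_of_subset)
      (auto simp: extensions_def)
  also have "\<dots> = (\<Sum>\<theta>\<in>extensions P \<phi>. of_nat (card (carrier S)) / of_nat (card (F ?T (carrier S))))"
    by (intro sum.cong refl \<Phi>_eq) (simp add: extensions_def)
  also have "\<dots> = of_nat (card (extensions P \<phi>)) * of_nat (card (carrier S)) /
      (of_nat (card (extensions P \<phi>)) * of_nat (card (F P (carrier S))))"
    by (simp flip: card_extensions[OF \<phi>])
  also have "\<dots> = \<Phi> P \<phi>"
    using extensions_nonempty[OF \<phi>] finite_extensions by (simp add: \<Phi>_eq[OF \<phi>])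
  finally show ?thesis .
qed

lemma expansion_not_over_U_eq_zero: "expansion_not_over_U = 0"
proof (rule ccontr)
  assume "expansion_not_over_U \<noteq> 0"
  moreover have "Poly_Mapping.keys expansion_not_over_U \<subseteq> {std_class Q \<psi> | Q \<psi>. \<psi> \<in> F Q (carrier S)}"
    using keys_expansion by (auto simp: keys_restrict_keys)
  ultimately obtain P \<phi> where \<phi>: "\<phi> \<in> F P (carrier S)"
    "lin_ext (\<lambda>c. mark c P (\<lambda>q. q) \<phi>) expansion_not_over_U \<noteq> 0"
    using F_standard_biset by (rule SS.ex_mark_nonzero)
  have "\<phi> \<in> P \<rightarrow> carrier S"
    using F_closed[OF \<phi>(1)] by auto
  then have "\<Phi> P \<phi> = lin_ext (\<lambda>c. mark c P (\<lambda>q. q) \<phi>) expansion_over_U +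
      lin_ext (\<lambda>c. mark c P (\<lambda>q. q) \<phi>) expansion_not_over_U"
    using \<Phi>_eq_lin_ext[OF F_subgroup(1)[OF \<phi>(1)], of \<phi>]
      lin_ext_restrict_keys_Compl[of "\<lambda>c. mark c P (\<lambda>q. q) \<phi>" "std_expansion S S \<omega>" over_U] by simp
  then show False
    using \<Phi>_eq_mark_over_U[OF \<phi>(1)] \<phi>(2) by simp
qed

lemma chi_eq_zero:
  assumes P: "subgroup P S" and \<phi>: "\<phi> \<in> Homs S P (carrier S)"
    and outside: "\<not> (U \<subseteq> P \<and> (\<exists>Q. \<phi> \<in> normalizer_system S F U P Q))"
  shows "chi S S P \<phi> \<omega> = 0"
proof (rule ccontr)
  assume "chi S S P \<phi> \<omega> \<noteq> 0"
  then have "std_class P \<phi> \<in> Poly_Mapping.keys (std_expansion S S \<omega>)"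
    by (simp add: chi_nonzero_iff)
  moreover have "Poly_Mapping.keys (std_expansion S S \<omega>) \<subseteq> over_U"
    using expansion_not_over_U_eq_zero keys_restrict_keys[of "- over_U" "std_expansion S S \<omega>"] by auto
  ultimately obtain Q \<psi> where Q: "\<psi> \<in> F Q (carrier S)" "U \<subseteq> Q" "std_class P \<phi> = std_class Q \<psi>"
    by (auto simp: over_U_def)
  have std: "standard_biset S S P \<phi>"
    using P \<phi> by (intro SS.standard_bisetI) (simp_all add: Homs_def hom_def)
  have \<phi>_maps: "\<phi> \<in> P \<rightarrow>\<^sub>E carrier S"
    using \<phi> by (auto simp: Homs_def hom_def PiE_def)
  have "mark (std_class Q \<psi>) P (\<lambda>q. q) \<phi> \<noteq> 0"
    using standard_biset.mark_self_nonzero[OF std] Q(3) by simp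
  then have "\<phi> \<in> F P (carrier S)"
    by (rule mark_nonzero_imp_F[OF Q(1) P \<phi>_maps])
  then have "\<phi> \<in> normalizer_system S F U P (carrier S)"
    using F_eq by metis
  moreover have "\<psi> \<in> Q \<rightarrow> carrier S"
    using F_closed[OF Q(1)] by auto
  then have "subconjugate S S Q \<psi> P \<phi>"
    using standard_biset.mark_self_nonzero[OF F_standard_biset[OF Q(1)]] Q(3)
      mark_std_nonzero_iff[OF std F_subgroup(1)[OF Q(1)]] by simp
  then have "U \<subseteq> P"
    using Q(2) by (rule subset_of_subconjugate)
  ultimately show False
    using outside by blast
qed

end

theorem lemma4p2:
  fixes p :: nat
    and S :: "('a, 'm) monoid_scheme"
    and F :: "'a homsets"
    and U :: "'a set"
    and \<omega> :: "('a, 'a) burnside_elt"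
  assumes "prime p"
    and "p_group p S"
    and "fusion_system S F"
    and "saturated p S F"
    and "subgroup U S"
    and "characteristic_idempotent p S F \<omega>"
  shows "(normalizer S U = carrier S \<and> F = normalizer_system S F U) \<longleftrightarrow>
    (\<forall>P \<phi>. subgroup P S \<and> \<phi> \<in> Homs S P (carrier S) \<longrightarrow>
      \<not> (U \<subseteq> P \<and> (\<exists>Q. \<phi> \<in> normalizer_system S F U P Q)) \<longrightarrow>
      chi S S P \<phi> \<omega> = 0)"
proof -
  interpret group S
    using assms(2) by (simp add: p_group_def)
  interpret char_idempotent S F p \<omega>
    using assms by unfold_locales (simp_all add: p_group_def)
  show ?thesis
  proof
    assume "normalizer S U = carrier S \<and> F = normalizer_system S F U"
    then interpret normal_in_fusion S F p \<omega> U
      using assms(5) by (intro normal_in_fusion.intro normal_in_fusion_axioms.intro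
        char_idempotent_axioms normal_of_normalizer_eq_carrier) auto
    show "\<forall>P \<phi>. subgroup P S \<and> \<phi> \<in> Homs S P (carrier S) \<longrightarrow>
        \<not> (U \<subseteq> P \<and> (\<exists>Q. \<phi> \<in> normalizer_system S F U P Q)) \<longrightarrow> chi S S P \<phi> \<omega> = 0"
      using chi_eq_zero by blast
  next
    assume zero: "\<forall>P \<phi>. subgroup P S \<and> \<phi> \<in> Homs S P (carrier S) \<longrightarrow>
        \<not> (U \<subseteq> P \<and> (\<exists>Q. \<phi> \<in> normalizer_system S F U P Q)) \<longrightarrow> chi S S P \<phi> \<omega> = 0"
    interpret supported_idempotent S F p \<omega> U
      using assms(5) zero F_subgroup(1) F_Homs
      by (intro supported_idempotent.intro supported_idempotent_axioms.intro
        char_idempotent_axioms) blast+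
    show "normalizer S U = carrier S \<and> F = normalizer_system S F U"
      using normalizer_U F_eq_normalizer_system by blast
  qed
qed

end
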